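(* For $i\in\{0,2\}$ let $\mathcal{S}_i\subset\mathbf{H}^5$ be the complete (simply truncated) Coxeter orthoscheme of degree $d=1$ with Coxeter symbol $[5,3,3,3,3]$ if $i=0$ and $[5,3,3,3,4]$ if $i=2$. Let $h_i$ be the height of the optimal hyperball $\mathcal{H}^{h_i}_{opt}$ of the associated regular prism tiling $\mathcal{T}_i$, let $Vol(\mathcal{H}^{h_i}_{opt})$ be the volume of the piece of this hyperball contained in $\mathcal{S}_i$, and let $$\delta^{opt}(\mathcal{T}_i)=\frac{Vol(\mathcal{H}^{h_i}_{opt})}{Vol_5(\mathcal{S}_i)}$$ be the density of the optimal hyperball packing to $\mathcal{T}_i$. Then these quantities have the following approximate numerical values: (1) for $[5,3,3,3,3]$: $Vol_5(\mathcal{S}_0)\approx 0.00076730$, $h_0\approx 0.38359861$, $Vol(\mathcal{H}^{h_0}_{opt})\approx 0.00038760$, $\delta^{opt}(\mathcal{T}_0)\approx 0.50514481$; (2) for $[5,3,3,3,4]$: $Vol_5(\mathcal{S}_2)\approx 0.00198469$, $h_2\approx 0.53063753$, $Vol(\mathcal{H}^{h_2}_{opt})\approx 0.00059001$, $\delta^{opt}(\mathcal{T}_2)\approx 0.29727979$.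
   Context: Model. $\mathbf{H}^5$ is the hyperbolic 5-space of constant sectional curvature $-1$, in the projective model: on $\mathbf{R}^6$ take the bilinear form $\langle \mathbf{x},\mathbf{y}\rangle=-x^0y^0+x^1y^1+\dots+x^5y^5$; points of $\mathbf{H}^5$ are the projective classes $[\mathbf{x}]$ with $\langle \mathbf{x},\mathbf{x}\rangle<0$, and an outer point is a class $[\mathbf{x}]$ with $\langle \mathbf{x},\mathbf{x}\rangle>0$. The polar hyperplane of an outer point $A=[\mathbf{a}]$ is $pol(A)=\{[\mathbf{x}]\in \mathbf{H}^5 : \langle \mathbf{a},\mathbf{x}\rangle=0\}$. The symbol $\approx$ denotes a decimal approximation. Orthoscheme. Let $(p,q,r,s,t)=(5,3,3,3,3)$ for $i=0$ and $(5,3,3,3,4)$ for $i=2$. Let $(c^{jk})_{0\le j,k\le 5}$ be the symmetric tridiagonal $6\times 6$ matrix with $c^{jj}=1$ and $c^{01}=-\cos\frac{\pi}{p}$, $c^{12}=-\cos\frac{\pi}{q}$, $c^{23}=-\cos\frac{\pi}{r}$, $c^{34}=-\cos\frac{\pi}{s}$, $c^{45}=-\cos\frac{\pi}{t}$, all other off-diagonal entries being $0$. It has signature $(1,5)$ (one negative, five positive eigenvalues), so there are vectors $b^0,\dots,b^5\in\mathbf{R}^6$, unique up to isometry, with $\langle b^j,b^k\rangle=c^{jk}$. Let $H^j=\{[\mathbf{x}]\in\mathbf{H}^5:\langle \mathbf{x},b^j\rangle=0\}$, and let $A_k$ be the projective point orthogonal to all $b^j$ with $j\neq k$ (the vertex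 opposite to $H^k$). Here $A_0,\dots,A_4$ are proper points of $\mathbf{H}^5$ and $A_5$ is an outer point; let $\pi=pol(A_5)$ (as a hyperplane, not to be confused with the number $\pi$ in the angles above). The hyperplane $\pi$ is orthogonal to $H^0,\dots,H^4$. The complete orthoscheme $\mathcal{S}_i$ of degree $1$ is the compact polytope obtained from the simplex with vertices $A_0,\dots,A_5$ (bounded by $H^0,\dots,H^5$) by truncating its outer vertex $A_5$ by $\pi$; that is, it is bounded by $H^0,\dots,H^5$ and $\pi$ and contains $A_0,\dots,A_4$. Its facet $\mathcal{S}_\pi=\mathcal{S}_i\cap\pi$ is the compact 4-dimensional Coxeter simplex $[5,3,3,3]$, whose vertices $P_0,\dots,P_4$ are the feet of the perpendiculars dropped from $A_0,\dots,A_4$ to $\pi$. $Vol_5$ denotes 5-dimensional hyperbolic volume. Prism tiling. Let $\mathcal{F}_i$ be the union of all images of $\mathcal{S}_i$ under the group generated by the reflections in $H^0,\dots,H^4$ and $\pi$. It is an infinite polyhedron which is a union of congruent regular prisms having the common mid-hyperplane $\pi$; its facets, called cover-faces, lie in images of $H^5$. The images of $\mathcal{F}_i$ under repeated reflections in cover-faces fill $\mathbf{H}^5$ without overlap; the resulting tiling by regular prisms is $\mathcal{T}_i$. Optimal hyperball. The hyperball of height $h$ with base hyperplane $\pi$ is the set of points of $\mathbf{H}^5$ at distance at most $h$ from $\pi$ (on both sides). The optimal hyperball $\mathcal{H}^{h_i}_{opt}$ is the hyperball with base $\pi$, inscribed in $\mathcal{F}_i$, of maximal height, i.e. touching the cover-faces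 of $\mathcal{F}_i$; its height is $h_i=d(P_4,A_4)$, the hyperbolic distance between $P_4$ and $A_4$. Its images under the repeated reflections in cover-faces form the optimal hyperball packing to $\mathcal{T}_i$. $Vol(\mathcal{H}^{h_i}_{opt})$ denotes the 5-dimensional volume of the piece of the hyperball in $\mathcal{S}_i$, i.e. of $\{x\in\mathcal{S}_i : d(x,\pi)\le h_i\}$ (the part over $\mathcal{S}_\pi$, bounded by $\mathcal{S}_\pi$, the hypersphere at distance $h_i$ from $\pi$, and the hyperplanes $H^0,\dots,H^4$ orthogonal to $\pi$).
   Formalization: "≈" is read as agreement within one unit of the eighth decimal, except for the density of [5,3,3,3,3]: its true value is 0.5051447998…, just over one unit from the printed 0.50514481, so that entry is stated with a tolerance of two units. *)

theory Defs
  imports "HOL-Analysis.Analysis"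
begin

text \<open>
  We write \<open>\<real>\<^sup>6\<close> as \<open>\<real> \<times> \<real>\<^sup>5\<close>, the first factor being the time coordinate \<open>x\<^sup>0\<close>.
  A projective point is a one-dimensional linear subspace of \<open>\<real>\<^sup>6\<close>.
\<close>

type_synonym vec6 = "real \<times> (real^5)"

definition mink :: "vec6 \<Rightarrow> vec6 \<Rightarrow> real" where
  "mink x y = - fst x * fst y + snd x \<bullet> snd y"

definition hyp5 :: "vec6 set set" where
  "hyp5 = {span {x} | x. mink x x < 0}"

definition pol :: "vec6 set \<Rightarrow> vec6 set set" where
  "pol A = {P \<in> hyp5. \<forall>a\<in>A. \<forall>x\<in>P. mink a x = 0}"

text \<open>The representative of a point of \<^const>\<open>hyp5\<close> on the upper sheet of the hyperboloid.\<close>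

definition unit_rep :: "vec6 set \<Rightarrow> vec6" where
  "unit_rep P = (THE x. x \<in> P \<and> mink x x = -1 \<and> 0 < fst x)"

definition hdist :: "vec6 set \<Rightarrow> vec6 set \<Rightarrow> real" where
  "hdist P Q = arcosh (- mink (unit_rep P) (unit_rep Q))"

definition hdist_set :: "vec6 set \<Rightarrow> vec6 set set \<Rightarrow> real" where
  "hdist_set P X = (INF Q\<in>X. hdist P Q)"

text \<open>
  The volume is computed in the affine chart \<open>y \<mapsto> [(1, y)]\<close>, in which hyperbolic 5-space
  is the open unit ball (Cayley--Klein model).  In curvature -1 and dimension \<open>n\<close> the
  volume element of that model is \<open>(1 - |y|\<^sup>2) powr (-(n + 1)/2) dy\<close>; here \<open>n = 5\<close>.
\<close>

definition hvol :: "vec6 set set \<Rightarrow> real" where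
  "hvol X = (LINT y : {y :: real^5. norm y < 1 \<and> span {(1, y)} \<in> X} | lborel.
               1 / (1 - (norm y)\<^sup>2) ^ 3)"

definition coxeter_matrix :: "nat list \<Rightarrow> nat \<Rightarrow> nat \<Rightarrow> real" where
  "coxeter_matrix ps j k =
     (if j = k then 1
      else if k = Suc j then - cos (pi / real (ps ! j))
      else if j = Suc k then - cos (pi / real (ps ! k))
      else 0)"

definition coxeter_normals :: "nat list \<Rightarrow> (nat \<Rightarrow> vec6) \<Rightarrow> bool" where
  "coxeter_normals ps b \<longleftrightarrow> (\<forall>j\<le>5. \<forall>k\<le>5. mink (b j) (b k) = coxeter_matrix ps j k)"

definition vertex :: "(nat \<Rightarrow> vec6) \<Rightarrow> nat \<Rightarrow> vec6 set" where
  "vertex b k = {x. \<forall>j\<le>5. j \<noteq> k \<longrightarrow> mink x (b j) = 0}"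

definition base_hyperplane :: "(nat \<Rightarrow> vec6) \<Rightarrow> vec6 set set" where
  "base_hyperplane b = pol (vertex b 5)"

text \<open>
  With respect to inward normals the Gram matrix has entries minus the cosines of the dihedral
  angles, so the simplex with vertices \<open>A\<^sub>0, \<dots>, A\<^sub>5\<close> is the projection of the cone below;
  its edges are the rays of the \<open>A\<^sub>k\<close> on which \<open>b k\<close> is nonnegative.
\<close>

definition simplex_cone :: "(nat \<Rightarrow> vec6) \<Rightarrow> vec6 set" where
  "simplex_cone b = {x. \<forall>j\<le>5. 0 \<le> mink x (b j)}"

text \<open>
  Truncation discards the side of the polar hyperplane that contains \<open>A\<^sub>5\<close>.  A vector \<open>a\<close> on the
  ray of \<open>A\<^sub>5\<close> in the cone satisfies \<open>mink a a > 0\<close>, so the side that is kept is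
  \<open>mink x a \<le> 0\<close>; the vectors of the cone representing \<open>A\<^sub>0, \<dots>, A\<^sub>4\<close> satisfy this.
\<close>

definition orthoscheme :: "(nat \<Rightarrow> vec6) \<Rightarrow> vec6 set set" where
  "orthoscheme b = {P \<in> hyp5. \<exists>x\<in>P. x \<noteq> 0 \<and> x \<in> simplex_cone b \<and>
                       (\<forall>a \<in> vertex b 5 \<inter> simplex_cone b. mink x a \<le> 0)}"

text \<open>The reflection in the hyperplane with normal \<open>n\<close>.\<close>

definition refl_in :: "vec6 \<Rightarrow> vec6 \<Rightarrow> vec6" where
  "refl_in n x = x - (2 * mink x n / mink n n) *\<^sub>R n"

text \<open>Reflections being involutions, the monoid they generate is the group.\<close>

inductive_set refl_group :: "vec6 set \<Rightarrow> (vec6 \<Rightarrow> vec6) set" for N :: "vec6 set" where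
  one: "id \<in> refl_group N"
| refl: "n \<in> N \<Longrightarrow> g \<in> refl_group N \<Longrightarrow> refl_in n \<circ> g \<in> refl_group N"

text \<open>
  The infinite polyhedron (union of regular prisms) tiled by the images of the orthoscheme; the
  nonzero vectors of \<open>A\<^sub>5\<close> are the normals of the base hyperplane.
\<close>

definition prism_polyhedron :: "(nat \<Rightarrow> vec6) \<Rightarrow> vec6 set set" where
  "prism_polyhedron b =
     (\<Union>g \<in> refl_group (b ` {0..4} \<union> (vertex b 5 - {0})). (\<lambda>P. g ` P) ` orthoscheme b)"

definition hyperball :: "vec6 set set \<Rightarrow> real \<Rightarrow> vec6 set set" where
  "hyperball p h = {P \<in> hyp5. hdist_set P p \<le> h}"

definition opt_height :: "(nat \<Rightarrow> vec6) \<Rightarrow> real" where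
  "opt_height b = (GREATEST h. hyperball (base_hyperplane b) h \<subseteq> prism_polyhedron b)"

definition opt_hyperball :: "(nat \<Rightarrow> vec6) \<Rightarrow> vec6 set set" where
  "opt_hyperball b = hyperball (base_hyperplane b) (opt_height b)"

definition opt_hyperball_vol :: "(nat \<Rightarrow> vec6) \<Rightarrow> real" where
  "opt_hyperball_vol b = hvol (opt_hyperball b \<inter> orthoscheme b)"

definition opt_density :: "(nat \<Rightarrow> vec6) \<Rightarrow> real" where
  "opt_density b = opt_hyperball_vol b / hvol (orthoscheme b)"

text \<open>
  Agreement of \<open>x\<close> with an 8-digit decimal \<open>v\<close> up to \<open>k\<close> units in the last place.  One unit
  allows the last digit to be either rounded or truncated.
\<close>

definition approx8 :: "nat \<Rightarrow> real \<Rightarrow> real \<Rightarrow> bool" where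
  "approx8 k x v \<longleftrightarrow> \<bar>x - v\<bar> \<le> real k / 10 ^ 8"

end

theory Submission
  imports Defs "HOL-Library.Option_ord"
begin

text \<open>
  Let \<open>\<tau>\<close> be the hyperbolic tangent of \<open>d(P\<^sub>4, A\<^sub>4)\<close>.  In an orthonormal frame whose last vector is the
  pole of the base hyperplane and whose time vector spans \<open>P\<^sub>4\<close>, the Klein chart turns the orthoscheme
  into the product of the interval \<open>[0, \<tau>]\<close> with a Euclidean simplex of orthoscheme shape.  The hyperball of
  height \<open>artanh \<tau>\<close> stays inside the prism because every point of the base hyperplane has an image in the
  chamber of \<open>H\<^sup>0, \<dots>, H\<^sup>4\<close>: the Galois conjugate of the Gram matrix is positive definite, so
  orbits are discrete, and among the images of an interior point of the chamber there is one nearest to the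
  given point.  A larger hyperball leaves
  the prism near \<open>A\<^sub>4\<close>.

  Expanding the density \<open>(1 - |y|\<^sup>2) ^ (-3)\<close> of the orthoscheme in the three innermost coordinates gives a series
  with nonnegative terms.  Its terms are products of a simplex moment and of a one-dimensional integral, both
  given by recursions, and its tail is dominated by a geometric bound.  The volume of the hyperball piece is that
  of the base simplex times an elementary function of \<open>\<tau>\<close>, and the base simplex is treated in the same way.
\<close>

section \<open>Hyperbolic volume and isometries\<close>

text \<open>Only three coordinates are expanded because t^2 + y1^2 (t the height coordinate) can
  reach about 0.85, so a full power series in |y|^2 would converge slowly. With y1 and t integrated
  in closed form, the expansion ratio (y2^2 + y3^2 + y4^2) / (1 - t^2 - y1^2) is at most 0.42 for
  \<open>[5,3,3,3,3]\<close> and at most 0.71 for \<open>[5,3,3,3,4]\<close>. The frame may be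
  chosen freely because hyperbolic volume is, up to a constant factor, the Lebesgue measure of a
  truncated cone in R^6, and Lorentz isometries have determinant of modulus one. Discreteness has an
  arithmetic source: the coordinates of the orbits lie in Z[golden], where a nonzero element has
  norm of modulus at least one and where an element bounded together with its conjugate takes only
  finitely many values. The finiteness yields the nearest image used for the covering; the norm
  bound shows that the orbit of P_4 meets the chamber only in P_4, which is what stops a larger
  hyperball.\<close>

lemma distr_lborel_basis:
  fixes f :: "'a::euclidean_space \<Rightarrow> 'b::euclidean_space"
  assumes lin: "linear f" and bij: "bij_betw f Basis Basis"
  shows "distr lborel borel f = lborel"
proof (rule lborel_eqI[symmetric])
  have mf[measurable]: "f \<in> borel_measurable borel"
    using lin by (intro borel_measurable_continuous_onI linear_continuous_on) (simp add: linear_conv_bounded_linear)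
  have inn: "f x \<bullet> f b = x \<bullet> b" if b: "b \<in> Basis" for x b
  proof -
    have "f x = (\<Sum>c\<in>Basis. (x \<bullet> c) *\<^sub>R f c)"
      by (subst euclidean_representation[of x, symmetric]) (simp add: linear_sum[OF lin] linear_cmul[OF lin])
    also have "\<dots> \<bullet> f b = (\<Sum>c\<in>Basis. (x \<bullet> c) * (f c \<bullet> f b))"
      by (simp add: inner_sum_left)
    also have "\<dots> = (\<Sum>c\<in>Basis. if c = b then x \<bullet> c else 0)"
    proof (rule sum.cong[OF HOL.refl])
      fix c :: "'a" assume c: "c \<in> Basis"
      then have "f c \<in> Basis" "f b \<in> Basis" "f c = f b \<longleftrightarrow> c = b"
        using bij b unfolding bij_betw_def inj_on_def by auto
      then show "(x \<bullet> c) * (f c \<bullet> f b) = (if c = b then x \<bullet> c else 0)"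
        by (simp add: inner_Basis)
    qed
    finally show ?thesis using b by simp
  qed
  show "sets (distr lborel borel f) = sets borel" by simp
  fix l u :: 'b assume lu: "\<And>b. b \<in> Basis \<Longrightarrow> l \<bullet> b \<le> u \<bullet> b"
  define pull where "pull v = (\<Sum>b\<in>Basis. (v \<bullet> f b) *\<^sub>R b)" for v
  have pull: "pull v \<bullet> b = v \<bullet> f b" if "b \<in> Basis" for v b
    using that by (simp add: pull_def)
  have all: "(\<forall>b\<in>Basis. P b) \<longleftrightarrow> (\<forall>b\<in>Basis. P (f b))" for P
    using bij unfolding bij_betw_def by (metis image_iff)
  have "f -` box l u = box (pull l) (pull u)"
    by (auto simp: mem_box all[of "\<lambda>b. _ b \<and> _ b"] all[of "\<lambda>b. _ \<bullet> b < _ \<bullet> b"] inn pull)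
  moreover have "emeasure lborel (box (pull l) (pull u)) = (\<Prod>b\<in>Basis. (pull u - pull l) \<bullet> b)"
    using lu bij unfolding bij_betw_def by (intro emeasure_lborel_box) (auto simp: pull)
  moreover have "(\<Prod>b\<in>Basis. (pull u - pull l) \<bullet> b) = (\<Prod>b\<in>Basis. (u - l) \<bullet> f b)"
    by (intro prod.cong) (auto simp: pull inner_diff_left)
  moreover have "\<dots> = (\<Prod>b\<in>Basis. (u - l) \<bullet> b)"
    by (rule prod.reindex_bij_betw[OF bij])
  ultimately show "emeasure (distr lborel borel f) (box l u) = (\<Prod>b\<in>Basis. (u - l) \<bullet> b)"
    by (simp add: emeasure_distr)
qed

lemma distr_lborel_linear:
  fixes f :: "real^'n::{finite,wellorder} \<Rightarrow> real^'n::_"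
  assumes lin: "linear f" and det: "\<bar>det (matrix f)\<bar> = 1"
  shows "distr lborel borel f = lborel"
proof (rule lborel_eqI[symmetric])
  have mf[measurable]: "f \<in> borel_measurable borel"
    using lin by (intro borel_measurable_continuous_onI linear_continuous_on) (simp add: linear_conv_bounded_linear)
  show "sets (distr lborel borel f) = sets borel" by simp
  have "inj f" using det det_nz_iff_inj[OF lin] by fastforce
  then obtain g where g: "linear g" "g \<circ> f = id"
    using linear_injective_left_inverse[OF lin] by auto
  have fg: "f \<circ> g = id" using g lin linear_inverse_left by metis
  have "matrix g ** matrix f = mat 1"
    using matrix_compose[OF lin g(1)] g(2) by (simp add: matrix_id_mat_1)
  then have detg: "\<bar>det (matrix g)\<bar> = 1"
    using det by (metis abs_mult abs_one det_I det_mul mult.right_neutral)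
  fix l u :: "real^'n::_" assume lu: "\<And>b. b \<in> Basis \<Longrightarrow> l \<bullet> b \<le> u \<bullet> b"
  have eq: "f -` box l u = g ` box l u"
    using g(2) fg by (auto simp: image_iff fun_eq_iff) metis+
  have b: "box l u \<in> lmeasurable" by simp
  have gm: "g ` box l u \<in> lmeasurable"
    using measurable_linear_image[OF g(1) b] .
  have sb: "g ` box l u \<in> sets borel"
    unfolding eq[symmetric] using measurable_sets[OF mf, of "box l u"] by simp
  have "emeasure lborel (g ` box l u) = emeasure lebesgue (g ` box l u)"
    using sb by simp
  also have "\<dots> = ennreal (measure lebesgue (g ` box l u))"
    using gm by (rule emeasure_eq_measure2)
  also have "\<dots> = ennreal (measure lebesgue (box l u))"
    using measure_linear_image[OF g(1) b] detg by simp
  also have "\<dots> = (\<Prod>b\<in>Basis. (u - l) \<bullet> b)"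
    using lu by (simp add: measure_completion measure_lborel_box_eq)
  finally show "emeasure (distr lborel borel f) (box l u) = (\<Prod>b\<in>Basis. (u - l) \<bullet> b)"
    by (simp add: emeasure_distr eq)
qed

lemma mink_simps:
  "mink (x + y) z = mink x z + mink y z" "mink z (x + y) = mink z x + mink z y"
  "mink (x - y) z = mink x z - mink y z" "mink z (x - y) = mink z x - mink z y"
  "mink (c *\<^sub>R x) y = c * mink x y" "mink x (c *\<^sub>R y) = c * mink x y"
  "mink (- x) y = - mink x y" "mink x (- y) = - mink x y"
  "mink 0 y = 0" "mink x 0 = 0"
  by (simp_all add: mink_def algebra_simps inner_simps)

lemma mink_commute: "mink x y = mink y x"
  by (simp add: mink_def inner_commute mult.commute)

lemma mink_nondegenerate:
  assumes "\<And>y. mink x y = 0" shows "x = 0"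
  \<comment> \<open>Against the time-reversed vector the form becomes the Euclidean square of
    \<open>x\<close>.\<close>
  using assms[of "(- fst x, snd x)"]
  by (simp add: mink_def prod_eq_iff add_nonneg_eq_0_iff power2_eq_square[symmetric])

lemma span_singleton_eq:
  assumes "c \<noteq> 0" shows "span {c *\<^sub>R x} = span {x :: vec6}"
  using span_image_scale[of "{x}" "\<lambda>_. c"] assms by simp

text \<open>The determinant formula for Lebesgue measure is about \<open>real^'n\<close> with a
  well-ordered index type; \<open>5 option\<close>, well-ordered by \<open>Option_ord\<close>,
  supplies six indices, \<open>None\<close> being the time coordinate.\<close>

definition coords6 :: "real^(5 option) \<Rightarrow> vec6" where
  "coords6 v = (v $ None, \<chi> i. v $ Some i)"

definition uncoords6 :: "vec6 \<Rightarrow> real^(5 option)" where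
  "uncoords6 x = (\<chi> i. case i of None \<Rightarrow> fst x | Some j \<Rightarrow> snd x $ j)"

lemma coords6_inverse: "coords6 (uncoords6 x) = x" "uncoords6 (coords6 v) = v"
  by (auto simp: coords6_def uncoords6_def prod_eq_iff vec_eq_iff split: option.split)

lemma linear_coords6: "linear coords6" "linear uncoords6"
  by (rule linearI; auto simp: coords6_def uncoords6_def prod_eq_iff vec_eq_iff split: option.split)+

lemma distr_coords6: "distr lborel borel coords6 = lborel"
proof (rule distr_lborel_basis[OF linear_coords6(1)])
  have 1: "coords6 (axis None 1) = (1, 0)"
    by (simp add: coords6_def axis_def vec_eq_iff)
  have 2: "coords6 (axis (Some i) 1) = (0, axis i 1)" for i
    by (simp add: coords6_def axis_def vec_eq_iff)
  have "coords6 ` Basis = Basis"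
    by (auto simp: Basis_vec_def Basis_prod_def UNIV_option_conv image_iff 1 2)
  moreover have "inj_on coords6 Basis"
    by (metis coords6_inverse(2) inj_on_inverseI)
  ultimately show "bij_betw coords6 Basis Basis"
    by (simp add: bij_betw_def)
qed

text \<open>The matrix A of a Lorentz isometry satisfies A^T J A = J with J = diag(-1, 1, ..., 1),
  so (det A)^2 = 1.\<close>

lemma distr_lborel_mink:
  fixes L :: "vec6 \<Rightarrow> vec6"
  assumes lin: "linear L" and L: "\<And>x y. mink (L x) (L y) = mink x y"
  shows "distr lborel borel L = lborel"
proof -
  define A where "A = uncoords6 \<circ> L \<circ> coords6"
  have linA: "linear A"
    unfolding A_def by (intro linear_compose linear_coords6 lin)
  define J :: "real^(5 option)^(5 option)"
    where "J = (\<chi> i j. if i = j then (if i = None then -1 else 1) else 0)"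
  have sumopt: "(\<Sum>i\<in>UNIV. f i) = f None + (\<Sum>i\<in>UNIV. f (Some i))" for f :: "5 option \<Rightarrow> real"
    by (simp add: UNIV_option_conv sum.reindex)
  have Jv: "(J *v v) $ i = (if i = None then - (v $ i) else v $ i)" for v i
  proof -
    have "(J *v v) $ i = (\<Sum>j\<in>UNIV. if j = i then (if i = None then - (v $ i) else v $ i) else 0)"
      by (simp only: J_def matrix_vector_mult_def vec_lambda_beta) (rule sum.cong, auto)
    then show ?thesis by simp
  qed
  have J: "v \<bullet> (J *v w) = mink (coords6 v) (coords6 w)" for v w
    by (simp add: inner_vec_def sumopt Jv mink_def coords6_def)
  have "v \<bullet> ((transpose (matrix A) ** J ** matrix A) *v w) = v \<bullet> (J *v w)" for v w
  proof -
    have mA: "matrix A *v u = A u" for u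
      using fun_cong[OF matrix_vector_mul(2)[OF linA], of u] .
    have "v \<bullet> ((transpose (matrix A) ** J ** matrix A) *v w) = v \<bullet> (transpose (matrix A) *v (J *v (matrix A *v w)))"
      by (simp only: matrix_vector_mul_assoc matrix_mul_assoc)
    also have "\<dots> = (matrix A *v v) \<bullet> (J *v (matrix A *v w))"
      by (simp add: dot_lmul_matrix[symmetric] transpose_matrix_vector[symmetric] inner_commute[of v] del: transpose_matrix_vector)
    also have "\<dots> = A v \<bullet> (J *v A w)"
      by (simp only: mA)
    also have "\<dots> = v \<bullet> (J *v w)"
      by (simp add: J A_def coords6_inverse L)
    finally show ?thesis .
  qed
  then have "transpose (matrix A) ** J ** matrix A = J"
    by (metis matrix_eq vector_eq_ldot)
  then have "det (matrix A) * det J * det (matrix A) = det J"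
    by (metis det_mul det_transpose)
  moreover have "J ** J = mat 1"
    by (simp add: matrix_eq vec_eq_iff matrix_vector_mul_assoc[symmetric] Jv)
  then have "det J * det J = 1"
    by (metis det_I det_mul)
  then have "det J \<noteq> 0" by auto
  ultimately have "\<bar>det (matrix A)\<bar> = 1"
    by (simp add: mult.commute mult.left_commute abs_square_eq_1 flip: power2_eq_square)
  then have dA: "distr lborel borel A = lborel"
    by (rule distr_lborel_linear[OF linA])
  have [measurable]: "A \<in> borel_measurable borel" "coords6 \<in> borel_measurable borel" "L \<in> borel_measurable borel"
    using linA linear_coords6 lin
    by (auto intro!: borel_measurable_continuous_onI linear_continuous_on simp: linear_conv_bounded_linear)
  have "distr lborel borel L = distr (distr lborel borel coords6) borel L"
    by (simp add: distr_coords6)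
  also have "\<dots> = distr lborel borel (coords6 \<circ> A)"
    by (subst distr_distr) (auto simp: A_def o_def coords6_inverse)
  also have "\<dots> = distr (distr lborel borel A) borel coords6"
    by (subst distr_distr) (auto simp: o_def)
  finally show ?thesis by (simp add: dA distr_coords6)
qed


section \<open>Hyperbolic volume as the Lebesgue measure of a truncated cone\<close>

definition cone_of :: "vec6 set set \<Rightarrow> vec6 set" where
  "cone_of X = {v. - 1 \<le> mink v v \<and> mink v v < 0 \<and> span {v} \<in> X}"

definition klein_chart :: "vec6 set set \<Rightarrow> (real^5) set" where
  "klein_chart X = {y. norm y < 1 \<and> span {(1, y)} \<in> X}"

lemma cone_of_iff:
  "(t, y) \<in> cone_of X \<longleftrightarrow>
     t \<noteq> 0 \<and> (1 / t) *\<^sub>R y \<in> klein_chart X \<and> t\<^sup>2 * (1 - (norm ((1 / t) *\<^sub>R y))\<^sup>2) \<le> 1"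
proof (cases "t = 0")
  case True
  then show ?thesis
    by (simp add: cone_of_def mink_def not_less)
next
  case False
  have eq: "(t, y) = t *\<^sub>R (1, (1 / t) *\<^sub>R y)"
    using False by simp
  have sp: "span {(t, y)} = span {(1, (1 / t) *\<^sub>R y)}"
    by (subst eq, rule span_singleton_eq[OF False])
  have mk: "mink (t, y) (t, y) = - (t\<^sup>2 * (1 - (norm ((1 / t) *\<^sub>R y))\<^sup>2))"
    using False by (simp add: mink_def dot_square_norm power2_eq_square field_simps)
  have "mink (t, y) (t, y) < 0 \<longleftrightarrow> norm ((1 / t) *\<^sub>R y) < 1"
    unfolding mk using False by (simp add: zero_less_mult_iff abs_square_less_1 del: norm_scaleR)
  then show ?thesis
    using False unfolding cone_of_def klein_chart_def mem_Collect_eq sp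
    by (simp add: mk del: norm_scaleR) auto
qed

lemma nn_integral_abs_power5:
  assumes "0 \<le> r"
  shows "(\<integral>\<^sup>+t. ennreal (\<bar>t\<bar> ^ 5) * indicator {- r..r} t \<partial>lborel) = ennreal (r ^ 6 / 3)"
proof -
  have 1: "(\<integral>\<^sup>+t. ennreal (t ^ 5) * indicator {0..r} t \<partial>lborel) = ennreal (r ^ 6 / 6 - 0 ^ 6 / 6)"
    using assms by (intro nn_integral_FTC_Icc[where F = "\<lambda>t. t ^ 6 / 6"]) (auto intro!: derivative_eq_intros)
  have 2: "(\<integral>\<^sup>+t. ennreal (- (t ^ 5)) * indicator {- r..0} t \<partial>lborel) = ennreal (- (0 ^ 6 / 6) - - ((- r) ^ 6 / 6))"
    using assms by (intro nn_integral_FTC_Icc[where F = "\<lambda>t. - (t ^ 6 / 6)"])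
      (auto intro!: derivative_eq_intros simp: power_less_zero_eq_numeral zero_le_odd_power odd_numeral power_le_zero_eq)
  have "(\<integral>\<^sup>+t. ennreal (\<bar>t\<bar> ^ 5) * indicator {- r..r} t \<partial>lborel)
      = (\<integral>\<^sup>+t. ennreal (t ^ 5) * indicator {0..r} t + ennreal (- (t ^ 5)) * indicator {- r..0} t \<partial>lborel)"
    by (intro nn_integral_cong) (auto split: split_indicator simp: power_even_abs abs_if)
  also have "\<dots> = ennreal (r ^ 6 / 6) + ennreal (r ^ 6 / 6)"
    using 1 2 by (subst nn_integral_add) auto
  also have "\<dots> = ennreal (r ^ 6 / 3)"
    using assms by (simp flip: ennreal_plus)
  finally show ?thesis .
qed

text \<open>In the coordinates v = t (1, y) the Lebesgue measure of R^6 is |t|^5 dt dy, and over a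
  chart point y the cone is |t| <= r with r = (1 - |y|^2)^(-1/2). Both signs of t together
  contribute r^6 / 3, which is a third of the Klein density.\<close>

lemma cone_of_measure:
  assumes [measurable]: "klein_chart X \<in> sets borel"
  shows cone_of_borel: "cone_of X \<in> sets borel"
    and emeasure_cone_of: "(\<integral>\<^sup>+y. ennreal (1 / (1 - (norm y)\<^sup>2) ^ 3) * indicator (klein_chart X) y \<partial>lborel)
           = 3 * emeasure lborel (cone_of X)"
proof -
  let ?K = "klein_chart X"
  define g where "g t y = (indicator {y\<in>?K. t\<^sup>2 * (1 - (norm y)\<^sup>2) \<le> 1} y :: ennreal)" for t y
  have "cone_of X = {v \<in> space borel. fst v \<noteq> 0 \<and> (1 / fst v) *\<^sub>R snd v \<in> ?K \<and>
          (fst v)\<^sup>2 * (1 - (norm ((1 / fst v) *\<^sub>R snd v))\<^sup>2) \<le> 1}"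
    using cone_of_iff[of "fst v" "snd v" X for v] by auto
  also have "\<dots> \<in> sets (borel :: vec6 measure)"
    by (unfold borel_prod[symmetric]) measurable
  finally show C: "cone_of X \<in> sets borel" .
  have gm[measurable]: "(\<lambda>(t, y). g t y) \<in> borel_measurable (borel \<Otimes>\<^sub>M borel)"
    unfolding g_def indicator_def mem_Collect_eq by measurable
  have gm2[measurable]: "g t \<in> borel_measurable borel" for t
    unfolding g_def indicator_def mem_Collect_eq by measurable
  have inner: "(\<integral>\<^sup>+y. indicator (cone_of X) (t, y) \<partial>lborel) = (\<integral>\<^sup>+y. ennreal (\<bar>t\<bar> ^ 5) * g t y \<partial>lborel)" for t
  proof (cases "t = 0")
    case True
    then show ?thesis by (simp add: cone_of_iff indicator_def)
  next
    case False
    have "(\<integral>\<^sup>+y. indicator (cone_of X) (t, y) \<partial>lborel) = (\<integral>\<^sup>+y. g t ((1 / t) *\<^sub>R y) \<partial>lborel)"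
      using False by (intro nn_integral_cong) (auto simp: g_def cone_of_iff indicator_def simp del: norm_scaleR)
    also have "\<dots> = (\<integral>\<^sup>+y. g t ((1 / t) *\<^sub>R y) \<partial>density (distr lborel borel (\<lambda>x::real^5. 0 + t *\<^sub>R x)) (\<lambda>_. \<bar>t\<bar>^DIM(real^5)))"
      using lborel_affine[OF False, where 'a = "real^5" and t = 0] by simp
    also have "\<dots> = (\<integral>\<^sup>+y. ennreal (\<bar>t\<bar> ^ 5) * g t y \<partial>lborel)"
      using False by (simp add: nn_integral_density nn_integral_distr)
    finally show ?thesis .
  qed
  have swap: "(\<integral>\<^sup>+t. ennreal (\<bar>t\<bar> ^ 5) * g t y \<partial>lborel)
      = ennreal (1 / (1 - (norm y)\<^sup>2) ^ 3 / 3) * indicator ?K y" for y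
  proof (cases "y \<in> ?K")
    case True
    define d where "d = 1 - (norm y)\<^sup>2"
    have "0 < d"
      using True unfolding klein_chart_def d_def by (simp add: abs_square_less_1)
    define r where "r = 1 / sqrt d"
    have "t\<^sup>2 * d \<le> 1 \<longleftrightarrow> t \<in> {- r..r}" for t
    proof -
      have "t\<^sup>2 * d \<le> 1 \<longleftrightarrow> (t * sqrt d)\<^sup>2 \<le> 1"
        using \<open>0 < d\<close> by (simp add: power_mult_distrib)
      also have "\<dots> \<longleftrightarrow> \<bar>t\<bar> * sqrt d \<le> 1"
        using \<open>0 < d\<close> by (simp add: abs_square_le_1 abs_mult)
      also have "\<dots> \<longleftrightarrow> \<bar>t\<bar> \<le> r"
        using \<open>0 < d\<close> by (simp add: r_def pos_le_divide_eq)
      also have "\<dots> \<longleftrightarrow> t \<in> {- r..r}"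
        by (auto simp: abs_le_iff)
      finally show ?thesis .
    qed
    then have "(\<integral>\<^sup>+t. ennreal (\<bar>t\<bar> ^ 5) * g t y \<partial>lborel) = (\<integral>\<^sup>+t. ennreal (\<bar>t\<bar> ^ 5) * indicator {- r..r} t \<partial>lborel)"
      using True by (intro nn_integral_cong) (simp add: g_def d_def indicator_def)
    also have "\<dots> = ennreal (r ^ 6 / 3)"
      using \<open>0 < d\<close> by (intro nn_integral_abs_power5) (simp add: r_def)
    also have "r ^ 6 = 1 / d ^ 3"
      using \<open>0 < d\<close> power_mult[of "sqrt d" 2 3] by (simp add: r_def power_divide)
    finally show ?thesis using True by (simp add: d_def)
  next
    case False
    then show ?thesis by (simp add: g_def)
  qed
  have "emeasure lborel (cone_of X) = (\<integral>\<^sup>+v. indicator (cone_of X) v \<partial>(lborel \<Otimes>\<^sub>M lborel))"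
    using C by (simp add: lborel_prod)
  also have "\<dots> = (\<integral>\<^sup>+t. \<integral>\<^sup>+y. indicator (cone_of X) (t, y) \<partial>lborel \<partial>lborel)"
    using C by (intro lborel.nn_integral_fst[symmetric]) (simp add: lborel_prod)
  also have "\<dots> = (\<integral>\<^sup>+t. \<integral>\<^sup>+y. ennreal (\<bar>t\<bar> ^ 5) * g t y \<partial>lborel \<partial>lborel)"
    by (simp add: inner)
  also have "\<dots> = (\<integral>\<^sup>+y. \<integral>\<^sup>+t. ennreal (\<bar>t\<bar> ^ 5) * g t y \<partial>lborel \<partial>lborel)"
    by (rule lborel_pair.Fubini') measurable
  also have "\<dots> = (\<integral>\<^sup>+y. ennreal (1 / 3) * (ennreal (1 / (1 - (norm y)\<^sup>2) ^ 3) * indicator ?K y) \<partial>lborel)"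
  proof (intro nn_integral_cong)
    fix y
    show "(\<integral>\<^sup>+t. ennreal (\<bar>t\<bar> ^ 5) * g t y \<partial>lborel) = ennreal (1 / 3) * (ennreal (1 / (1 - (norm y)\<^sup>2) ^ 3) * indicator ?K y)"
      unfolding swap
    proof (cases "y \<in> ?K")
      case True
      then have "0 \<le> 1 / (1 - (norm y)\<^sup>2) ^ 3"
        by (simp add: klein_chart_def power_le_one)
      then have "ennreal (1 / 3 * (1 / (1 - (norm y)\<^sup>2) ^ 3)) = ennreal (1 / 3) * ennreal (1 / (1 - (norm y)\<^sup>2) ^ 3)"
        by (intro ennreal_mult) auto
      then show "ennreal (1 / (1 - (norm y)\<^sup>2) ^ 3 / 3) * indicator ?K y
          = ennreal (1 / 3) * (ennreal (1 / (1 - (norm y)\<^sup>2) ^ 3) * indicator ?K y)"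
        using True by (simp add: mult.commute)
    qed simp
  qed
  also have "\<dots> = ennreal (1 / 3) * (\<integral>\<^sup>+y. ennreal (1 / (1 - (norm y)\<^sup>2) ^ 3) * indicator ?K y \<partial>lborel)"
    by (intro nn_integral_cmult) measurable
  finally have "ennreal 3 * emeasure lborel (cone_of X)
      = ennreal 3 * ennreal (1 / 3) * (\<integral>\<^sup>+y. ennreal (1 / (1 - (norm y)\<^sup>2) ^ 3) * indicator ?K y \<partial>lborel)"
    by (simp add: mult.assoc)
  also have "ennreal 3 * ennreal (1 / 3) = 1"
    by (subst ennreal_mult'[symmetric]) auto
  finally show "(\<integral>\<^sup>+y. ennreal (1 / (1 - (norm y)\<^sup>2) ^ 3) * indicator ?K y \<partial>lborel) = 3 * emeasure lborel (cone_of X)"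
    by simp
qed

text \<open>The chart of \<open>X\<close> is traded for the chart \<open>K\<close> of its pullback
  along \<open>L\<close>, where the region is explicit. The Bochner integral in \<open>hvol\<close>
  and \<open>enn2real\<close> of the nonnegative integral agree even in the divergent case, where
  both are 0.\<close>

lemma hvol_mink_isometry:
  assumes lin: "linear L" and L: "\<And>x y. mink (L x) (L y) = mink x y"
    and K: "klein_chart {P. L ` P \<in> X} = K" and [measurable]: "K \<in> sets borel"
  shows "hvol X = enn2real (\<integral>\<^sup>+y. ennreal (1 / (1 - (norm y)\<^sup>2) ^ 3) * indicator K y \<partial>lborel)"
proof -
  let ?Y = "{P. L ` P \<in> X}"
  have "inj L"
    unfolding linear_injective_0[OF lin] using L mink_nondegenerate mink_simps(9) by metis
  then obtain M where M: "linear M" "M \<circ> L = id"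
    using linear_injective_left_inverse[OF lin] by auto
  have LM: "L \<circ> M = id"
    using M lin linear_inverse_left by metis
  have [measurable]: "M \<in> borel_measurable borel" "L \<in> borel_measurable borel"
    using lin M(1)
    by (auto intro!: borel_measurable_continuous_onI linear_continuous_on simp: linear_conv_bounded_linear)
  have pre: "cone_of ?Y = L -` cone_of X"
    by (auto simp: cone_of_def L linear_span_image[OF lin, symmetric])
  have Y: "cone_of ?Y \<in> sets borel"
    by (rule cone_of_borel) (simp add: K)
  have "cone_of X = M -` cone_of ?Y \<inter> space borel"
    by (simp add: pre vimage_comp LM)
  also have "\<dots> \<in> sets borel"
    using Y by (intro measurable_sets) auto
  finally have C[measurable]: "cone_of X \<in> sets borel" .
  \<comment> \<open>The chart is the slice of the cone at time 1: \<open>mink (1, y) (1, y)\<close>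
    is |y|^2 - 1 and hence at least -1.\<close>
  have "klein_chart X = (\<lambda>y. (1, y)) -` cone_of X \<inter> space borel"
    by (auto simp: klein_chart_def cone_of_def mink_def dot_square_norm abs_square_less_1)
  also have "\<dots> \<in> sets borel"
    by (intro measurable_sets[OF _ C] borel_measurable_continuous_onI continuous_intros)
  finally have [measurable]: "klein_chart X \<in> sets borel" .
  have "hvol X = (LINT y|lborel. indicator (klein_chart X) y * (1 / (1 - (norm y)\<^sup>2) ^ 3))"
    by (simp add: hvol_def set_lebesgue_integral_def klein_chart_def)
  also have "\<dots> = enn2real (\<integral>\<^sup>+y. ennreal (indicator (klein_chart X) y * (1 / (1 - (norm y)\<^sup>2) ^ 3)) \<partial>lborel)"
  proof (rule integral_eq_nn_integral)
    show "(\<lambda>y. indicator (klein_chart X) y * (1 / (1 - (norm y)\<^sup>2) ^ 3)) \<in> borel_measurable lborel"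
      by measurable
  qed (auto split: split_indicator simp: klein_chart_def power_le_one)
  also have "(\<integral>\<^sup>+y. ennreal (indicator (klein_chart X) y * (1 / (1 - (norm y)\<^sup>2) ^ 3)) \<partial>lborel)
     = (\<integral>\<^sup>+y. ennreal (1 / (1 - (norm y)\<^sup>2) ^ 3) * indicator (klein_chart X) y \<partial>lborel)"
    by (intro nn_integral_cong) (auto split: split_indicator)
  also have "\<dots> = 3 * emeasure lborel (cone_of X)"
    by (rule emeasure_cone_of) measurable
  also have "emeasure lborel (cone_of X) = emeasure (distr lborel borel L) (cone_of X)"
    by (simp add: distr_lborel_mink[OF lin L])
  also have "\<dots> = emeasure lborel (cone_of ?Y)"
    by (simp add: emeasure_distr pre)
  also have "3 * \<dots> = (\<integral>\<^sup>+y. ennreal (1 / (1 - (norm y)\<^sup>2) ^ 3) * indicator K y \<partial>lborel)"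
    using emeasure_cone_of[of ?Y] by (simp add: K)
  finally show ?thesis .
qed

section \<open>Coordinates adapted to the Coxeter diagram\<close>

definition golden :: real where "golden = (1 + sqrt 5) / 2"

lemma golden_sq: "golden * golden = golden + 1"
  by (simp add: golden_def field_simps)

lemma golden_sq': "golden * (golden * x) = (golden + 1) * x"
  by (simp add: golden_sq flip: mult.assoc)

lemma golden_bounds: "1618033988 / 10 ^ 9 < golden" "golden < 1618033989 / 10 ^ 9"
proof -
  have "sqrt ((2236067976 / 10 ^ 9)\<^sup>2) < sqrt 5" "sqrt 5 < sqrt ((2236067978 / 10 ^ 9)\<^sup>2)"
    by (intro real_sqrt_less_mono; simp add: power2_eq_square)+
  then show "1618033988 / 10 ^ 9 < golden" "golden < 1618033989 / 10 ^ 9"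
    by (simp_all add: golden_def)
qed

lemma golden_pos: "0 < golden" "1 < golden" "golden < 2"
  using golden_bounds by simp_all

lemma cos_pi_div_5: "cos (pi / 5) = golden / 2"
proof -
  let ?c = "cos (pi / 5)"
  \<comment> \<open>The angles 3 pi / 5 and 2 pi / 5 are supplementary; the multiple-angle formulas
    turn this into a cubic for the cosine with the spurious root -1.\<close>
  have "cos (3 * (pi / 5)) = - cos (2 * (pi / 5))"
    by (subst cos_minus_pi[symmetric]) (simp add: cos_pi_minus[symmetric] field_simps)
  then have "(?c + 1) * (4 * ?c\<^sup>2 - 2 * ?c - 1) = 0"
    unfolding cos_treble_cos cos_double_cos by (simp add: algebra_simps power2_eq_square power3_eq_cube)
  moreover have c: "0 < ?c"
    by (rule cos_gt_zero) auto
  ultimately have q: "4 * ?c\<^sup>2 - 2 * ?c - 1 = 0" by auto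
  have "(?c - golden / 2) * (?c + (golden - 1) / 2) = 0"
  proof -
    have "(?c - golden / 2) * (?c + (golden - 1) / 2) = (4 * ?c\<^sup>2 - 2 * ?c - 1) / 4 - (golden * golden - golden - 1) / 4"
      by (simp add: field_simps power2_eq_square)
    then show ?thesis using q golden_sq by simp
  qed
  moreover have "0 < ?c + (golden - 1) / 2"
    using c golden_pos(2) by (intro add_pos_pos) simp_all
  ultimately show ?thesis by auto
qed

lemma exhaust_5: "x = 1 \<or> x = 2 \<or> x = 3 \<or> x = 4 \<or> x = 5" for x :: 5
proof (induct x)
  case (of_int z)
  then have "z = 0 \<or> z = 1 \<or> z = 2 \<or> z = 3 \<or> z = 4" by simp arith
  then show ?case by auto
qed

lemma UNIV_5: "UNIV = {1, 2, 3, 4, 5 :: 5}"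
  using exhaust_5 by auto

lemma sum_5: "(\<Sum>i\<in>UNIV. f (i :: 5)) = f 1 + f 2 + f 3 + f 4 + f 5"
  unfolding UNIV_5 by (simp add: ac_simps)

text \<open>\<open>\<kappa>\<close> stands for cos(pi / t) with t the last entry of the symbol. The
  two orthoschemes differ only there, so everything about \<open>b 0, ..., b 4\<close>, in
  particular the base simplex, is shared.\<close>

locale coxeter_frame =
  fixes b :: "nat \<Rightarrow> vec6" and \<kappa> :: real
  assumes b_diag: "\<And>j. j \<le> 5 \<Longrightarrow> mink (b j) (b j) = 1"
    and b_super: "mink (b 0) (b 1) = - golden / 2" "mink (b 1) (b 2) = - 1 / 2"
      "mink (b 2) (b 3) = - 1 / 2" "mink (b 3) (b 4) = - 1 / 2" "mink (b 4) (b 5) = - \<kappa>"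
    and b_far: "mink (b 0) (b 2) = 0" "mink (b 0) (b 3) = 0" "mink (b 0) (b 4) = 0" "mink (b 0) (b 5) = 0"
      "mink (b 1) (b 3) = 0" "mink (b 1) (b 4) = 0" "mink (b 1) (b 5) = 0"
      "mink (b 2) (b 4) = 0" "mink (b 2) (b 5) = 0" "mink (b 3) (b 5) = 0"
    and kappa_pos: "0 < \<kappa>"
begin

declare One_nat_def [simp del]

lemma b_gram:
  "mink (b 0) (b 0) = 1" "mink (b 1) (b 1) = 1" "mink (b 2) (b 2) = 1"
  "mink (b 3) (b 3) = 1" "mink (b 4) (b 4) = 1" "mink (b 5) (b 5) = 1"
  "mink (b 1) (b 0) = - golden / 2" "mink (b 2) (b 1) = - 1 / 2"
  "mink (b 3) (b 2) = - 1 / 2" "mink (b 4) (b 3) = - 1 / 2" "mink (b 5) (b 4) = - \<kappa>"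
  "mink (b 2) (b 0) = 0" "mink (b 3) (b 0) = 0" "mink (b 4) (b 0) = 0" "mink (b 5) (b 0) = 0"
  "mink (b 3) (b 1) = 0" "mink (b 4) (b 1) = 0" "mink (b 5) (b 1) = 0"
  "mink (b 4) (b 2) = 0" "mink (b 5) (b 2) = 0" "mink (b 5) (b 3) = 0"
  "mink (b 0) (b 1) = - golden / 2" "mink (b 1) (b 2) = - 1 / 2"
  "mink (b 2) (b 3) = - 1 / 2" "mink (b 3) (b 4) = - 1 / 2" "mink (b 4) (b 5) = - \<kappa>"
  "mink (b 0) (b 2) = 0" "mink (b 0) (b 3) = 0" "mink (b 0) (b 4) = 0" "mink (b 0) (b 5) = 0"
  "mink (b 1) (b 3) = 0" "mink (b 1) (b 4) = 0" "mink (b 1) (b 5) = 0"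
  "mink (b 2) (b 4) = 0" "mink (b 2) (b 5) = 0" "mink (b 3) (b 5) = 0"
  by (simp_all add: b_diag b_super b_far b_super[THEN trans[OF mink_commute]] b_far[THEN trans[OF mink_commute]])

text \<open>Square roots of the absolute pivots when Gram-Schmidt is applied to
  \<open>b 0, ..., b 5\<close> in this order. All pivots are positive except that of
  \<open>b 4\<close>, which is - golden; this is where the time direction appears.\<close>

definition "s1 = sqrt ((3 - golden) / 4)"
definition "s2 = sqrt (1 / (2 + golden))"
definition "s3 = 1 / (2 * golden)"
definition "s4 = sqrt golden"
definition "s5 = sqrt (1 + \<kappa>\<^sup>2 / golden)"

lemma s_pos: "0 < s1" "0 < s2" "0 < s3" "0 < s4" "0 < s5"
  using golden_pos by (auto simp: s1_def s2_def s3_def s4_def s5_def intro!: add_pos_nonneg)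

lemma s_sq: "s1 * s1 = (3 - golden) / 4" "s2 * s2 = 1 / (2 + golden)" "s3 * s3 = (2 - golden) / 4"
  "s4 * s4 = golden" "s5 * s5 = 1 + \<kappa>\<^sup>2 / golden"
proof -
  show "s3 * s3 = (2 - golden) / 4"
    using golden_pos golden_sq by (simp add: s3_def field_simps)
qed (use golden_pos in \<open>auto simp: s1_def s2_def s4_def s5_def add_nonneg_nonneg\<close>)

text \<open>The numbering runs backwards so that \<open>e0\<close> is the time vector. Being
  orthogonal to \<open>b 0, ..., b 3\<close> and \<open>e5\<close>, it represents P_4;
  \<open>e5\<close>, orthogonal to \<open>b 0, ..., b 4\<close>, represents the pole A_5. The signs
  are chosen so that the time coordinate \<open>- mink x e0\<close> is nonnegative on the chamber
  and the height \<open>mink x e5\<close> is bounded above by the facet H^5.\<close>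

definition "e4 = b 0"
definition "e3 = (1 / s1) *\<^sub>R (b 1 + (golden / 2) *\<^sub>R e4)"
definition "e2 = (1 / s2) *\<^sub>R (b 2 + (1 / (2 * s1)) *\<^sub>R e3)"
definition "e1 = (1 / s3) *\<^sub>R (b 3 + (1 / (2 * s2)) *\<^sub>R e2)"
definition "e0 = (- 1 / s4) *\<^sub>R (b 4 + (1 / (2 * s3)) *\<^sub>R e1)"
definition "e5 = (- 1 / s5) *\<^sub>R (b 5 + (\<kappa> / s4) *\<^sub>R e0)"

lemma e4_b: "mink e4 (b 0) = 1" "mink e4 (b 1) = - golden / 2" "mink e4 (b 2) = 0"
  "mink e4 (b 3) = 0" "mink e4 (b 4) = 0" "mink e4 (b 5) = 0"
  by (simp_all add: e4_def b_gram)

lemma e3_b: "mink e3 (b 0) = 0" "mink e3 (b 1) = s1" "mink e3 (b 2) = - 1 / (2 * s1)"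
  "mink e3 (b 3) = 0" "mink e3 (b 4) = 0" "mink e3 (b 5) = 0"
proof -
  have "1 - golden * golden / 4 = s1 * s1" by (simp add: s_sq golden_sq field_simps)
  then show "mink e3 (b 1) = s1"
    using s_pos by (simp add: e3_def mink_simps e4_b b_gram field_simps)
qed (use b_super b_far s_pos in \<open>simp_all add: e3_def mink_simps e4_b b_gram field_simps\<close>)

lemma e2_b: "mink e2 (b 0) = 0" "mink e2 (b 1) = 0" "mink e2 (b 2) = s2"
  "mink e2 (b 3) = - 1 / (2 * s2)" "mink e2 (b 4) = 0" "mink e2 (b 5) = 0"
proof -
  have "1 - 1 / (4 * (s1 * s1)) = s2 * s2"
    using golden_pos unfolding s_sq by (simp add: field_simps) (simp add: algebra_simps golden_sq golden_sq')
  then show "mink e2 (b 2) = s2"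
    using s_pos by (simp add: e2_def mink_simps e3_b b_gram field_simps)
qed (use b_super b_far s_pos in \<open>simp_all add: e2_def mink_simps e3_b b_gram field_simps\<close>)

lemma e1_b: "mink e1 (b 0) = 0" "mink e1 (b 1) = 0" "mink e1 (b 2) = 0" "mink e1 (b 3) = s3"
  "mink e1 (b 4) = - 1 / (2 * s3)" "mink e1 (b 5) = 0"
proof -
  have "1 - 1 / (4 * (s2 * s2)) = s3 * s3"
    using golden_pos unfolding s_sq by (simp add: field_simps)
  then show "mink e1 (b 3) = s3"
    using s_pos by (simp add: e1_def mink_simps e2_b b_gram field_simps)
qed (use b_super b_far s_pos in \<open>simp_all add: e1_def mink_simps e2_b b_gram field_simps\<close>)

lemma e0_b: "mink e0 (b 0) = 0" "mink e0 (b 1) = 0" "mink e0 (b 2) = 0" "mink e0 (b 3) = 0"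
  "mink e0 (b 4) = s4" "mink e0 (b 5) = \<kappa> / s4"
proof -
  have "1 / (4 * (s3 * s3)) = 1 + s4 * s4"
    using golden_pos unfolding s_sq by (simp add: field_simps) (simp add: algebra_simps golden_sq golden_sq')
  then show "mink e0 (b 4) = s4"
    using s_pos by (simp add: e0_def mink_simps e1_b b_gram field_simps)
qed (use b_super b_far s_pos in \<open>simp_all add: e0_def mink_simps e1_b b_gram field_simps\<close>)

lemma e5_b: "mink e5 (b 0) = 0" "mink e5 (b 1) = 0" "mink e5 (b 2) = 0" "mink e5 (b 3) = 0"
  "mink e5 (b 4) = 0" "mink e5 (b 5) = - s5"
proof -
  have "1 + \<kappa> * \<kappa> / (s4 * s4) = s5 * s5"
    by (simp add: s_sq power2_eq_square)
  then show "mink e5 (b 5) = - s5"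
    using s_pos by (simp add: e5_def mink_simps e0_b b_gram field_simps)
qed (use b_super b_far s_pos in \<open>simp_all add: e5_def mink_simps e0_b b_gram field_simps\<close>)

lemma b_e: "b 0 = e4" "b 1 = s1 *\<^sub>R e3 - (golden / 2) *\<^sub>R e4" "b 2 = s2 *\<^sub>R e2 - (1 / (2 * s1)) *\<^sub>R e3"
  "b 3 = s3 *\<^sub>R e1 - (1 / (2 * s2)) *\<^sub>R e2" "b 4 = - (s4 *\<^sub>R e0) - (1 / (2 * s3)) *\<^sub>R e1"
  "b 5 = - (s5 *\<^sub>R e5) - (\<kappa> / s4) *\<^sub>R e0"
  using s_pos by (simp_all add: e0_def e1_def e2_def e3_def e4_def e5_def)

lemma e_orthonormal:
  "mink e0 e0 = - 1" "mink e1 e1 = 1" "mink e2 e2 = 1" "mink e3 e3 = 1" "mink e4 e4 = 1" "mink e5 e5 = 1"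
  "mink e0 e1 = 0" "mink e0 e2 = 0" "mink e0 e3 = 0" "mink e0 e4 = 0" "mink e0 e5 = 0"
  "mink e1 e2 = 0" "mink e1 e3 = 0" "mink e1 e4 = 0" "mink e1 e5 = 0"
  "mink e2 e3 = 0" "mink e2 e4 = 0" "mink e2 e5 = 0"
  "mink e3 e4 = 0" "mink e3 e5 = 0" "mink e4 e5 = 0"
proof -
  have 4: "mink x e4 = mink x (b 0)" for x by (simp add: e4_def)
  have 3: "mink x e3 = (1 / s1) * (mink x (b 1) + (golden / 2) * mink x e4)" for x
    by (simp add: e3_def mink_simps)
  have 2: "mink x e2 = (1 / s2) * (mink x (b 2) + (1 / (2 * s1)) * mink x e3)" for x
    by (simp add: e2_def mink_simps)
  have 1: "mink x e1 = (1 / s3) * (mink x (b 3) + (1 / (2 * s2)) * mink x e2)" for x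
    by (simp add: e1_def mink_simps)
  have 0: "mink x e0 = (- 1 / s4) * (mink x (b 4) + (1 / (2 * s3)) * mink x e1)" for x
    by (simp add: e0_def mink_simps)
  note b = e0_b e1_b e2_b e3_b e4_b e5_b
  have 44: "mink e4 e4 = 1" "mink e3 e4 = 0" "mink e2 e4 = 0" "mink e1 e4 = 0" "mink e0 e4 = 0" "mink e5 e4 = 0"
    by (simp_all add: 4 b)
  have 33: "mink e3 e3 = 1" "mink e2 e3 = 0" "mink e1 e3 = 0" "mink e0 e3 = 0" "mink e5 e3 = 0"
    using s_pos by (simp_all add: 3 b 44)
  have 22: "mink e2 e2 = 1" "mink e1 e2 = 0" "mink e0 e2 = 0" "mink e5 e2 = 0"
    using s_pos by (simp_all add: 2 b 33)
  have 11: "mink e1 e1 = 1" "mink e0 e1 = 0" "mink e5 e1 = 0"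
    using s_pos by (simp_all add: 1 b 22)
  have 00: "mink e0 e0 = - 1" "mink e5 e0 = 0"
    using s_pos by (simp_all add: 0 b 11)
  have 55: "mink e5 e5 = 1"
    using s_pos by (subst (2) e5_def) (simp add: mink_simps b 00)
  show "mink e0 e0 = - 1" "mink e1 e1 = 1" "mink e2 e2 = 1" "mink e3 e3 = 1" "mink e4 e4 = 1" "mink e5 e5 = 1"
    "mink e0 e1 = 0" "mink e0 e2 = 0" "mink e0 e3 = 0" "mink e0 e4 = 0" "mink e0 e5 = 0"
    "mink e1 e2 = 0" "mink e1 e3 = 0" "mink e1 e4 = 0" "mink e1 e5 = 0"
    "mink e2 e3 = 0" "mink e2 e4 = 0" "mink e2 e5 = 0"
    "mink e3 e4 = 0" "mink e3 e5 = 0" "mink e4 e5 = 0"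
    using 44 33 22 11 00 55 
      00(2)[THEN trans[OF mink_commute]] 11(3)[THEN trans[OF mink_commute]] 22(4)[THEN trans[OF mink_commute]]
      33(5)[THEN trans[OF mink_commute]] 44(6)[THEN trans[OF mink_commute]] by simp_all
qed

definition frame :: "vec6 \<Rightarrow> vec6" where
  "frame v = fst v *\<^sub>R e0 + (snd v $ 1) *\<^sub>R e1 + (snd v $ 2) *\<^sub>R e2 + (snd v $ 3) *\<^sub>R e3
     + (snd v $ 4) *\<^sub>R e4 + (snd v $ 5) *\<^sub>R e5"

lemma linear_frame: "linear frame"
  by (rule linearI) (simp_all add: frame_def algebra_simps)

lemmas e_orthonormal' = e_orthonormal e_orthonormal(7-21)[THEN trans[OF mink_commute]]

lemma mink_frame: "mink (frame v) (frame w) = mink v w"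
  by (simp add: frame_def mink_simps e_orthonormal') (simp add: mink_def inner_vec_def sum_5)

lemma frame_e: "mink (frame v) e0 = - fst v" "mink (frame v) e1 = snd v $ 1" "mink (frame v) e2 = snd v $ 2"
  "mink (frame v) e3 = snd v $ 3" "mink (frame v) e4 = snd v $ 4" "mink (frame v) e5 = snd v $ 5"
  by (simp_all add: frame_def mink_simps e_orthonormal')

lemma surj_frame: "surj frame"
proof -
  have "inj frame"
    unfolding linear_injective_0[OF linear_frame] using mink_frame mink_nondegenerate mink_simps(9) by metis
  then show ?thesis
    using linear_injective_imp_surjective[OF linear_frame] by simp
qed

lemma frame_ext:
  assumes "mink x e0 = mink y e0" "mink x e1 = mink y e1" "mink x e2 = mink y e2"
    "mink x e3 = mink y e3" "mink x e4 = mink y e4" "mink x e5 = mink y e5"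
  shows "x = y"
proof -
  obtain v w where "x = frame v" "y = frame w"
    using surj_frame by (metis surjD)
  with assms have "fst v = fst w" "snd v $ 1 = snd w $ 1" "snd v $ 2 = snd w $ 2" "snd v $ 3 = snd w $ 3"
    "snd v $ 4 = snd w $ 4" "snd v $ 5 = snd w $ 5"
    by (simp_all add: frame_e)
  then show ?thesis unfolding \<open>x = frame v\<close> \<open>y = frame w\<close> frame_def by simp
qed

lemma mink_expand:
  "mink x y = - (mink x e0 * mink y e0) + mink x e1 * mink y e1 + mink x e2 * mink y e2
     + mink x e3 * mink y e3 + mink x e4 * mink y e4 + mink x e5 * mink y e5"
proof -
  obtain v w where "x = frame v" "y = frame w"
    using surj_frame by (metis surjD)
  then show ?thesis by (simp add: frame_e mink_frame) (simp add: mink_def inner_vec_def sum_5)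
qed

lemma mink_b:
  "mink x (b 0) = mink x e4" "mink x (b 1) = s1 * mink x e3 - golden / 2 * mink x e4"
  "mink x (b 2) = s2 * mink x e2 - mink x e3 / (2 * s1)"
  "mink x (b 3) = s3 * mink x e1 - mink x e2 / (2 * s2)"
  "mink x (b 4) = s4 * (- mink x e0) - mink x e1 / (2 * s3)"
  "mink x (b 5) = \<kappa> / s4 * (- mink x e0) - s5 * mink x e5"
  by (simp_all add: b_e mink_simps)


lemma all_le_4: "(\<forall>j\<le>4::nat. P j) \<longleftrightarrow> P 0 \<and> P 1 \<and> P 2 \<and> P 3 \<and> P 4"
  by (simp add: numeral_eq_Suc le_Suc_eq all_conj_distrib conj_commute conj_assoc One_nat_def)

lemma all_le_5: "(\<forall>j\<le>5::nat. P j) \<longleftrightarrow> P 0 \<and> P 1 \<and> P 2 \<and> P 3 \<and> P 4 \<and> P 5"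
  by (simp add: numeral_eq_Suc le_Suc_eq all_conj_distrib conj_commute conj_assoc One_nat_def)

definition chamber :: "vec6 set" where
  "chamber = {x. \<forall>j\<le>4. 0 \<le> mink x (b j)}"

text \<open>\<open>c1, ..., c4\<close> are the ratios of neighbouring frame coordinates on the
  facets H^4, H^3, H^2, H^1. On H^5 the ratio of height to time coordinate is the constant
  \<open>\<tau>\<close>, because \<open>b 5\<close> involves only \<open>e5\<close> and
  \<open>e0\<close>.\<close>

definition "c1 = 1 / sqrt golden"
definition "c2 = 2 * s2 * s3"
definition "c3 = 2 * s1 * s2"
definition "c4 = 2 * s1 / golden"
definition "\<tau> = \<kappa> / (s4 * s5)"

lemma c_pos: "0 < c1" "0 < c2" "0 < c3" "0 < c4" "0 < \<tau>"
  using s_pos golden_pos kappa_pos by (simp_all add: c1_def c2_def c3_def c4_def \<tau>_def)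

lemma c1_eq: "c1 = 2 * s3 * s4"
  using golden_pos by (simp add: c1_def s3_def s4_def real_div_sqrt field_simps flip: real_sqrt_mult)

text \<open>Each \<open>b j\<close> involves at most two neighbouring vectors of the frame, so the
  facets become a chain of inequalities between neighbouring coordinates. This chain is what allows
  iterated integration.\<close>

lemma chamber_iff:
  "x \<in> chamber \<longleftrightarrow> 0 \<le> mink x e4 \<and> mink x e4 \<le> c4 * mink x e3 \<and> mink x e3 \<le> c3 * mink x e2
     \<and> mink x e2 \<le> c2 * mink x e1 \<and> mink x e1 \<le> c1 * (- mink x e0)"
  using s_pos golden_pos
  by (simp add: chamber_def all_le_4 mink_b c1_eq c2_def c3_def c4_def field_simps)

lemma tau_iff: "0 \<le> mink x (b 5) \<longleftrightarrow> mink x e5 \<le> \<tau> * (- mink x e0)"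
  using s_pos by (simp add: mink_b \<tau>_def field_simps)

lemma vertex_5: "vertex b 5 = range (\<lambda>c. c *\<^sub>R e5)"
proof -
  have "x = mink x e5 *\<^sub>R e5" if x: "\<forall>j\<le>4. mink x (b j) = 0" for x
  proof -
    have 4: "mink x e4 = 0"
      using x by (auto simp: all_le_4 mink_b)
    then have 3: "mink x e3 = 0"
      using x s_pos by (auto simp: all_le_4 mink_b)
    then have 2: "mink x e2 = 0"
      using x s_pos by (auto simp: all_le_4 mink_b)
    then have 1: "mink x e1 = 0"
      using x s_pos by (auto simp: all_le_4 mink_b)
    then have 0: "mink x e0 = 0"
      using x s_pos by (auto simp: all_le_4 mink_b)
    show ?thesis
      by (rule frame_ext) (simp_all add: mink_simps 0 1 2 3 4 e_orthonormal')
  qed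
  moreover have "vertex b 5 = {x. \<forall>j\<le>4. mink x (b j) = 0}"
    unfolding vertex_def by (simp add: all_le_4 all_le_5)
  moreover have "mink (c *\<^sub>R e5) (b j) = 0" if "j \<le> 4" for c j
  proof -
    have "\<forall>j\<le>4. mink (c *\<^sub>R e5) (b j) = 0"
      by (simp add: all_le_4 mink_simps e5_b)
    then show ?thesis using that by blast
  qed
  ultimately show ?thesis by auto
qed

lemma orthoscheme_eq:
  "orthoscheme b = {P \<in> hyp5. \<exists>x\<in>P. x \<noteq> 0 \<and> x \<in> chamber \<and> 0 \<le> mink x e5 \<and> mink x e5 \<le> \<tau> * (- mink x e0)}"
proof -
  have cone: "x \<in> simplex_cone b \<longleftrightarrow> x \<in> chamber \<and> mink x e5 \<le> \<tau> * (- mink x e0)" for x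
    unfolding simplex_cone_def chamber_def mem_Collect_eq all_le_4 all_le_5 tau_iff by blast
  have "(\<forall>a \<in> vertex b 5 \<inter> simplex_cone b. mink x a \<le> 0) \<longleftrightarrow> 0 \<le> mink x e5" for x
  proof -
    \<comment> \<open>\<open>mink e5 (b 5)\<close> is negative, so the ray of A_5 in the cone
      consists of the negative multiples of \<open>e5\<close>, and the side kept by the truncation
      is \<open>0 \<le> mink x e5\<close>.\<close>
    have "c *\<^sub>R e5 \<in> simplex_cone b \<longleftrightarrow> c \<le> 0" for c
      by (simp add: cone chamber_iff mink_simps e_orthonormal')
    note cone5 = this
    have "(\<forall>a \<in> vertex b 5 \<inter> simplex_cone b. mink x a \<le> 0)
        \<longleftrightarrow> (\<forall>c. c *\<^sub>R e5 \<in> simplex_cone b \<longrightarrow> mink x (c *\<^sub>R e5) \<le> 0)"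
      unfolding vertex_5 by blast
    also have "\<dots> \<longleftrightarrow> (\<forall>c\<le>0. c * mink x e5 \<le> 0)"
      by (simp add: cone5 mink_simps)
    also have "\<dots> \<longleftrightarrow> 0 \<le> mink x e5"
    proof
      assume "\<forall>c\<le>0. c * mink x e5 \<le> 0"
      from this[rule_format, of "- 1"] show "0 \<le> mink x e5" by simp
    qed (simp add: mult_nonpos_nonneg)
    finally show ?thesis .
  qed
  then show ?thesis
    unfolding orthoscheme_def cone by blast
qed

lemma base_hyperplane_eq: "base_hyperplane b = {P \<in> hyp5. \<forall>x\<in>P. mink x e5 = 0}"
  by (force simp: base_hyperplane_def pol_def vertex_5 mink_simps mink_commute[of e5])

lemma c_sq: "c1\<^sup>2 = golden - 1" "c2\<^sup>2 = (2 - golden) / (2 + golden)" "c3\<^sup>2 = 2 - golden"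
  "c4\<^sup>2 = (3 - golden) * (2 - golden)" "\<tau>\<^sup>2 = \<kappa>\<^sup>2 / (golden + \<kappa>\<^sup>2)"
proof -
  show "c1\<^sup>2 = golden - 1"
    using golden_pos by (simp add: c1_def power_divide field_simps golden_sq)
  show "c2\<^sup>2 = (2 - golden) / (2 + golden)"
  proof -
    have "c2\<^sup>2 = 4 * (s2 * s2) * (s3 * s3)"
      by (simp add: c2_def power2_eq_square ac_simps)
    then show ?thesis using golden_pos by (simp only: s_sq) (simp add: frac_eq_eq algebra_simps)
  qed
  have "c3\<^sup>2 = (3 - golden) / (2 + golden)"
  proof -
    have "c3\<^sup>2 = (4 * (s1 * s1)) * (s2 * s2)"
      by (simp add: c3_def power2_eq_square ac_simps)
    also have "4 * (s1 * s1) = 3 - golden"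
      by (simp add: s_sq)
    finally show ?thesis by (simp add: s_sq)
  qed
  also have "\<dots> = 2 - golden"
    using golden_pos by (simp add: field_simps) (simp add: algebra_simps golden_sq)
  finally show "c3\<^sup>2 = 2 - golden" .
  have "c4\<^sup>2 = (3 - golden) / (golden * golden)"
    using s_sq(1) by (simp add: c4_def power_mult_distrib power_divide power2_eq_square)
  also have "\<dots> = (3 - golden) * (2 - golden)"
    using golden_pos unfolding golden_sq by (simp add: field_simps) (simp add: algebra_simps golden_sq golden_sq')
  finally show "c4\<^sup>2 = (3 - golden) * (2 - golden)" .
  have "\<tau>\<^sup>2 = \<kappa>\<^sup>2 / ((s4 * s4) * (s5 * s5))"
    by (simp add: \<tau>_def power_divide power2_eq_square ac_simps)
  also have "(s4 * s4) * (s5 * s5) = golden + \<kappa>\<^sup>2"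
    using golden_pos unfolding s_sq by (simp add: field_simps)
  finally show "\<tau>\<^sup>2 = \<kappa>\<^sup>2 / (golden + \<kappa>\<^sup>2)" .
qed

lemma c_sq_le: "c1\<^sup>2 \<le> 6181 / 10000" "c2\<^sup>2 \<le> 1057 / 10000" "c3\<^sup>2 \<le> 3821 / 10000" "c4\<^sup>2 \<le> 5280 / 10000"
proof -
  note g = golden_bounds
  show "c1\<^sup>2 \<le> 6181 / 10000" "c3\<^sup>2 \<le> 3821 / 10000"
    using g by (simp_all add: c_sq)
  show "c2\<^sup>2 \<le> 1057 / 10000"
    using g by (simp add: c_sq field_simps)
  have "c4\<^sup>2 = 7 - 4 * golden"
    by (simp add: c_sq algebra_simps golden_sq)
  then show "c4\<^sup>2 \<le> 5280 / 10000" using g by simp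
qed

text \<open>The four square bounds chain to c1^2 (1 + c2^2 (1 + c3^2 (1 + c4^2))) < 0.722. The
  chamber therefore meets the base hyperplane well inside the light cone.\<close>

lemma chamber_bound:
  assumes "x \<in> chamber"
  shows "0 \<le> - mink x e0"
    and "(mink x e1)\<^sup>2 + (mink x e2)\<^sup>2 + (mink x e3)\<^sup>2 + (mink x e4)\<^sup>2 \<le> 722 / 1000 * (mink x e0)\<^sup>2"
proof -
  have 4: "0 \<le> mink x e4" "mink x e4 \<le> c4 * mink x e3" and 3: "mink x e3 \<le> c3 * mink x e2"
    and 2: "mink x e2 \<le> c2 * mink x e1" and 1: "mink x e1 \<le> c1 * (- mink x e0)"
    using assms by (auto simp: chamber_iff)
  have n3: "0 \<le> mink x e3"
    using 4 c_pos(4) by (metis order_trans zero_le_mult_iff not_le)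
  have n2: "0 \<le> mink x e2"
    using 3 n3 c_pos(3) by (metis order_trans zero_le_mult_iff not_le)
  have n1: "0 \<le> mink x e1"
    using 2 n2 c_pos(2) by (metis order_trans zero_le_mult_iff not_le)
  show n0: "0 \<le> - mink x e0"
    using 1 n1 c_pos(1) by (metis order_trans zero_le_mult_iff not_le)
  have sq: "u\<^sup>2 \<le> k * v\<^sup>2" if "0 \<le> u" "u \<le> c * v" "c\<^sup>2 \<le> k" for u v c k :: real
  proof -
    have "u\<^sup>2 \<le> (c * v)\<^sup>2" using that by (intro power_mono) auto
    also have "\<dots> \<le> k * v\<^sup>2" using that by (simp add: power_mult_distrib mult_right_mono)
    finally show ?thesis .
  qed
  show "(mink x e1)\<^sup>2 + (mink x e2)\<^sup>2 + (mink x e3)\<^sup>2 + (mink x e4)\<^sup>2 \<le> 722 / 1000 * (mink x e0)\<^sup>2"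
    using sq[OF n1 1 c_sq_le(1)] sq[OF n2 2 c_sq_le(2)] sq[OF n3 3 c_sq_le(3)] sq[OF 4 c_sq_le(4)]
      zero_le_power2[of "mink x e0"]
    unfolding power2_minus by linarith
qed

lemma klein_chart_orthoscheme:
  "klein_chart {P. frame ` P \<in> orthoscheme b}
     = {y. norm y < 1 \<and> 0 \<le> y $ 5 \<and> y $ 5 \<le> \<tau> \<and> y $ 1 \<le> c1 \<and> y $ 2 \<le> c2 * y $ 1 \<and> y $ 3 \<le> c3 * y $ 2
          \<and> y $ 4 \<le> c4 * y $ 3 \<and> 0 \<le> y $ 4}"
  (is "_ = {y. _ \<and> ?S y}")
proof -
  have "frame ` span {(1, y)} \<in> orthoscheme b \<longleftrightarrow> ?S y" if y: "norm y < 1" for y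
  proof -
    have im: "frame ` span {(1, y)} = span {frame (1, y)}"
      using linear_span_image[OF linear_frame, of "{(1, y)}"] by simp
    have "mink (frame (1, y)) (frame (1, y)) < 0"
      using y by (simp add: mink_frame) (simp add: mink_def dot_square_norm abs_square_less_1)
    then have hyp: "span {frame (1, y)} \<in> hyp5"
      unfolding hyp5_def mem_Collect_eq by (intro exI[of _ "frame (1, y)"] conjI HOL.refl)
    let ?x = "frame (1, y)"
    define T where "T x \<longleftrightarrow> x \<in> chamber \<and> 0 \<le> mink x e5 \<and> mink x e5 \<le> \<tau> * (- mink x e0)" for x
    have scale: "T (c *\<^sub>R ?x) \<longleftrightarrow> T ?x" if "0 < c" for c
    proof -
      have "c * u \<le> k * (c * v) \<longleftrightarrow> u \<le> k * v" "c * u \<le> k * (- (c * v)) \<longleftrightarrow> u \<le> k * (- v)"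
        "0 \<le> c * u \<longleftrightarrow> 0 \<le> u" for u v k
        using that mult_le_cancel_left_pos[OF that, of u "k * v"] mult_le_cancel_left_pos[OF that, of u "- (k * v)"]
        by (simp_all add: ac_simps zero_le_mult_iff)
      then show ?thesis
        unfolding T_def chamber_iff mink_simps by (simp only:)
    qed
    \<comment> \<open>A point of \<open>hyp5\<close> is a whole line; its negative multiples are
      excluded because the time coordinate is nonnegative on the chamber.\<close>
    have pos: "0 < c" if "T (c *\<^sub>R ?x)" "c \<noteq> 0" for c
      using chamber_bound(1)[of "c *\<^sub>R ?x"] that by (simp add: T_def mink_simps frame_e)
    have "span {?x} \<in> orthoscheme b \<longleftrightarrow> (\<exists>c. c *\<^sub>R ?x \<noteq> 0 \<and> T (c *\<^sub>R ?x))"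
      using hyp by (auto simp: orthoscheme_eq span_singleton T_def)
    also have "\<dots> \<longleftrightarrow> T ?x"
    proof
      assume "T ?x"
      moreover have "?x \<noteq> 0" using frame_e(1)[of "(1, y)"] by (auto simp: mink_simps)
      ultimately show "\<exists>c. c *\<^sub>R ?x \<noteq> 0 \<and> T (c *\<^sub>R ?x)"
        by (intro exI[of _ 1]) simp
    qed (use pos scale in auto)
    also have "\<dots> \<longleftrightarrow> ?S y"
      by (auto simp: T_def chamber_iff frame_e)
    finally show ?thesis by (simp add: im)
  qed
  then show ?thesis by (auto simp: klein_chart_def)
qed

end

section \<open>Distances to the base hyperplane and reflection groups\<close>

lemma timelike_norm_less:
  assumes "mink x x < 0" shows "norm (snd x) < \<bar>fst x\<bar>"
proof (rule power2_less_imp_less)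
  show "(norm (snd x))\<^sup>2 < \<bar>fst x\<bar>\<^sup>2"
    using assms by (simp add: mink_def dot_square_norm power2_eq_square)
qed simp

text \<open>By Cauchy-Schwarz the product of the time coordinates dominates that of the space parts,
  so the sign of \<open>mink x y\<close> tells whether \<open>x\<close> and \<open>y\<close> lie on
  the same sheet.\<close>

lemma timelike_mink_neg_iff:
  assumes "mink x x < 0" "mink y y < 0"
  shows "mink x y < 0 \<longleftrightarrow> 0 < fst x * fst y"
proof -
  have "\<bar>snd x \<bullet> snd y\<bar> \<le> norm (snd x) * norm (snd y)" by (rule Cauchy_Schwarz_ineq2)
  also have "\<dots> < \<bar>fst x\<bar> * \<bar>fst y\<bar>"
    using timelike_norm_less assms by (intro mult_strict_mono') auto
  finally have "\<bar>snd x \<bullet> snd y\<bar> < \<bar>fst x * fst y\<bar>" by (simp add: abs_mult)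
  then show ?thesis unfolding mink_def by linarith
qed

lemma unit_timelike_mink_le:
  assumes "mink x x = - 1" "mink y y = - 1" "mink x y < 0"
  shows "mink x y \<le> - 1"
proof -
  let ?a = "norm (snd x)" and ?b = "norm (snd y)"
  have f: "(fst x)\<^sup>2 = 1 + ?a\<^sup>2" "(fst y)\<^sup>2 = 1 + ?b\<^sup>2"
    using assms by (simp_all add: mink_def dot_square_norm power2_eq_square)
  have "0 < fst x * fst y"
    using assms timelike_mink_neg_iff[of x y] by simp
  have "(1 + ?a * ?b)\<^sup>2 \<le> (1 + ?a\<^sup>2) * (1 + ?b\<^sup>2)"
    using zero_le_power2[of "?a - ?b"] by (simp add: power2_eq_square algebra_simps)
  also have "\<dots> = (fst x * fst y)\<^sup>2"
    by (simp add: f power_mult_distrib)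
  finally have "1 + ?a * ?b \<le> fst x * fst y"
    using \<open>0 < fst x * fst y\<close> by (rule power2_le_imp_le[OF _ less_imp_le])
  moreover have "snd x \<bullet> snd y \<le> ?a * ?b"
    by (rule norm_cauchy_schwarz)
  ultimately show ?thesis by (simp add: mink_def)
qed

lemma unit_rep_span:
  assumes "mink x x = - 1" "0 < fst x"
  shows "unit_rep (span {x}) = x"
  unfolding unit_rep_def
proof (rule the_equality)
  show "x \<in> span {x} \<and> mink x x = - 1 \<and> 0 < fst x"
    using assms by (simp add: span_base)
  fix y assume y: "y \<in> span {x} \<and> mink y y = - 1 \<and> 0 < fst y"
  then obtain c where c: "y = c *\<^sub>R x" by (auto simp: span_singleton)
  then have "c * c = 1" "0 < c"
    using y assms by (auto simp: mink_simps zero_less_mult_iff)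
  then have "c = 1"
    by (metis abs_of_pos abs_square_eq_1 power2_eq_square)
  then show "y = x" by (simp add: c)
qed

lemma span_in_hyp5: "mink x x < 0 \<Longrightarrow> span {x} \<in> hyp5"
  unfolding hyp5_def by blast

lemma hyp5_rep:
  assumes "P \<in> hyp5"
  obtains x where "P = span {x}" "mink x x = - 1" "0 < fst x"
proof -
  obtain y where y: "P = span {y}" "mink y y < 0"
    using assms by (auto simp: hyp5_def)
  have f: "fst y \<noteq> 0" using timelike_norm_less[OF y(2)] by auto
  define c where "c = sgn (fst y) / sqrt (- mink y y)"
  have "c \<noteq> 0" "0 < c * fst y"
    using y f by (auto simp: c_def sgn_if)
  moreover have "c * c * mink y y = - 1"
    using y f by (simp add: c_def sgn_if real_sqrt_mult_self)
  ultimately show thesis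
    using y span_singleton_eq[of c y] by (intro that[of "c *\<^sub>R y"]) (auto simp: mink_simps mult.assoc)
qed

text \<open>The distance d satisfies sinh d = |\<open>mink x e\<close>|. The nearest point is the
  normalised orthogonal projection \<open>u\<close>; for any other q in the hyperplane the component
  along \<open>e\<close> drops out, and the comparison reduces to
  \<open>mink u q \<le> - 1\<close>.\<close>

lemma hdist_set_hyperplane:
  assumes e: "mink e e = 1" and x: "mink x x = - 1"
  shows "hdist_set (span {x}) {P \<in> hyp5. \<forall>x\<in>P. mink x e = 0} = arcosh (sqrt (1 + (mink x e)\<^sup>2))"
    (is "hdist_set _ ?H = _")
proof -
  \<comment> \<open>\<open>unit_rep\<close> picks the upper sheet, so \<open>x\<close> may have to
    be replaced by its negative; only the square of \<open>mink x e\<close> enters the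
    result.\<close>
  have "\<exists>X. span {x} = span {X} \<and> mink X X = - 1 \<and> 0 < fst X \<and> (mink X e)\<^sup>2 = (mink x e)\<^sup>2"
  proof (cases "0 < fst x")
    case False
    moreover have "fst x \<noteq> 0" using timelike_norm_less[of x] x by auto
    ultimately show ?thesis
      using x span_singleton_eq[of "- 1" x] by (intro exI[of _ "- x"]) (auto simp: mink_simps)
  qed (use x in blast)
  then obtain X where X: "span {x} = span {X}" "mink X X = - 1" "0 < fst X" "(mink X e)\<^sup>2 = (mink x e)\<^sup>2"
    by blast
  define s r where "s = mink X e" and "r = sqrt (1 + s\<^sup>2)"
  have r: "1 \<le> r" "r * r = 1 + s * s"
    by (auto simp: r_def power2_eq_square)
  define u where "u = (1 / r) *\<^sub>R (X - s *\<^sub>R e)"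
  have Xu: "X = r *\<^sub>R u + s *\<^sub>R e"
    using r by (simp add: u_def)
  have "mink u u = (1 / (r * r)) * (- 1 - s * s)"
    using r by (simp add: u_def mink_simps X e mink_commute[of e X] flip: s_def)
  also have "- 1 - s * s = - (r * r)" using r by simp
  also have "(1 / (r * r)) * - (r * r) = - 1" using r(1) by simp
  finally have uu: "mink u u = - 1" .
  have ue: "mink u e = 0"
    using r by (simp add: u_def mink_simps e flip: s_def)
  have "mink X u = - r"
    by (simp add: Xu mink_simps uu ue mink_commute[of e u])
  then have uf: "0 < fst u"
    using timelike_mink_neg_iff[of X u] X uu r by (simp add: zero_less_mult_iff)
  have uH: "span {u} \<in> ?H"
    using uu ue by (simp add: span_in_hyp5) (auto simp: span_singleton mink_simps)
  have d: "hdist (span {x}) (span {q}) = arcosh (- mink X q)" if "mink q q = - 1" "0 < fst q" for q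
    using X that by (simp add: hdist_def unit_rep_span)
  have "(INF Q\<in>?H. hdist (span {x}) Q) = arcosh r"
  proof (rule cInf_eq_minimum)
    show "arcosh r \<in> hdist (span {x}) ` ?H"
      using uH d[OF uu uf] \<open>mink X u = - r\<close> by force
  next
    fix D assume "D \<in> hdist (span {x}) ` ?H"
    then obtain Q where Q: "Q \<in> ?H" "D = hdist (span {x}) Q" by blast
    then obtain q where q: "Q = span {q}" "mink q q = - 1" "0 < fst q"
      using hyp5_rep by blast
    have "mink q e = 0"
      using Q q by (auto simp: span_base)
    then have "mink X q = r * mink u q"
      by (simp add: Xu mink_simps mink_commute[of e q])
    moreover have "mink u q \<le> - 1"
      using timelike_mink_neg_iff[of u q] uu q uf by (intro unit_timelike_mink_le) auto
    then have "r * mink u q \<le> r * (- 1)"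
      using r by (intro mult_left_mono) auto
    ultimately have "r \<le> - mink X q" by simp
    then show "arcosh r \<le> D"
      using r unfolding Q(2) q(1) d[OF q(2,3)] by (cases "r = - mink X q") (auto intro!: less_imp_le simp: arcosh_less_iff_real)
  qed
  then show ?thesis
    by (simp add: hdist_set_def r_def s_def X)
qed

section \<open>Groups generated by reflections in spacelike normals\<close>

lemma linear_refl_in: "linear (refl_in n)"
  by (rule linearI) (simp_all add: refl_in_def mink_simps algebra_simps add_divide_distrib)

lemma mink_refl_in: "mink n n \<noteq> 0 \<Longrightarrow> mink (refl_in n x) (refl_in n y) = mink x y"
  by (simp add: refl_in_def mink_simps mink_commute[of n y] field_simps)

lemma refl_in_involution: "mink n n \<noteq> 0 \<Longrightarrow> refl_in n (refl_in n x) = x"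
  by (simp add: refl_in_def mink_simps algebra_simps)

lemma refl_in_timelike:
  assumes "0 < mink n n" "mink x x < 0"
  shows "0 < fst (refl_in n x) * fst x"
proof -
  have "mink (refl_in n x) x = mink x x - 2 * (mink x n)\<^sup>2 / mink n n"
    by (simp add: refl_in_def mink_simps mink_commute[of n x] power2_eq_square)
  also have "\<dots> < 0"
    using assms by (smt (verit) divide_nonneg_pos zero_le_power2)
  finally show ?thesis
    using timelike_mink_neg_iff[of "refl_in n x" x] assms mink_refl_in[of n x x] by simp
qed

lemma refl_group_comp: "g \<in> refl_group N \<Longrightarrow> h \<in> refl_group N \<Longrightarrow> g \<circ> h \<in> refl_group N"
  by (induction rule: refl_group.induct) (auto simp: comp_assoc intro: refl_group.intros)

lemma refl_in_mem: "n \<in> N \<Longrightarrow> refl_in n \<in> refl_group N"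
  using refl_group.refl[OF _ refl_group.one] by simp

locale reflections =
  fixes N :: "vec6 set"
  assumes spacelike: "\<And>n. n \<in> N \<Longrightarrow> 0 < mink n n"
begin

lemma linear_group: "g \<in> refl_group N \<Longrightarrow> linear g"
proof (induction rule: refl_group.induct)
  case one
  then show ?case by (simp add: linear_iff)
next
  case (refl n g)
  then show ?case by (intro linear_compose linear_refl_in)
qed

lemma mink_group: "g \<in> refl_group N \<Longrightarrow> mink (g x) (g y) = mink x y"
proof (induction rule: refl_group.induct)
  case (refl n g)
  then show ?case using spacelike[of n] by (simp add: mink_refl_in)
qed simp

lemma group_sheet: "g \<in> refl_group N \<Longrightarrow> mink x x < 0 \<Longrightarrow> 0 < fst (g x) * fst x"
proof (induction rule: refl_group.induct)
  case one
  then have "fst x \<noteq> 0" using timelike_norm_less[of x] by auto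
  then show ?case by (auto simp: zero_less_mult_iff linorder_neq_iff)
next
  case (refl n g)
  have "0 < fst (refl_in n (g x)) * fst (g x)"
    using refl spacelike by (intro refl_in_timelike) (auto simp: mink_group)
  then show ?case using refl by (auto simp: zero_less_mult_iff)
qed

lemma group_inverse: "g \<in> refl_group N \<Longrightarrow> \<exists>h\<in>refl_group N. (\<forall>x. g (h x) = x) \<and> (\<forall>x. h (g x) = x)"
proof (induction rule: refl_group.induct)
  case one
  then show ?case by (intro bexI[of _ id]) (auto intro: refl_group.one)
next
  case (refl n g)
  then obtain h where h: "h \<in> refl_group N" "\<And>x. g (h x) = x" "\<And>x. h (g x) = x" by blast
  have "h \<circ> refl_in n \<in> refl_group N"
    using h refl by (intro refl_group_comp refl_in_mem)
  then show ?case
    using h spacelike[of n] refl by (intro bexI[of _ "h \<circ> refl_in n"]) (auto simp: refl_in_involution)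
qed

end

section \<open>The ring Z[golden] and its Galois conjugation, sending golden to 1 - golden\<close>

definition golden_pair :: "real \<Rightarrow> real \<Rightarrow> bool" where
  "golden_pair a a' \<longleftrightarrow> (\<exists>(p :: int) (q :: int). a = p + q * golden \<and> a' = p + q * (1 - golden))"

lemma golden_pairI: "a = of_int p + of_int q * golden \<Longrightarrow> a' = of_int p + of_int q * (1 - golden) \<Longrightarrow> golden_pair a a'"
  unfolding golden_pair_def by blast

lemma golden_pair_int: "golden_pair (of_int n) (of_int n)"
  by (rule golden_pairI[of _ n 0]) auto

lemma golden_pair_diff:
  assumes "golden_pair a a'" "golden_pair c c'"
  shows "golden_pair (a - c) (a' - c')"
proof -
  obtain p q r s :: int where
    eqs: "a = p + q * golden" "a' = p + q * (1 - golden)" "c = r + s * golden" "c' = r + s * (1 - golden)"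
    using assms unfolding golden_pair_def by blast
  show ?thesis
    unfolding eqs by (rule golden_pairI[of _ "p - r" "q - s"]) (simp_all add: algebra_simps)
qed

lemma golden_pair_mult:
  assumes "golden_pair a a'" "golden_pair c c'"
  shows "golden_pair (a * c) (a' * c')"
proof -
  obtain p q r s :: int where
    eqs: "a = p + q * golden" "a' = p + q * (1 - golden)" "c = r + s * golden" "c' = r + s * (1 - golden)"
    using assms unfolding golden_pair_def by blast
  show ?thesis
    unfolding eqs by (rule golden_pairI[of _ "p * r + q * s" "p * s + q * r + q * s"])
      (simp_all add: algebra_simps golden_sq golden_sq')
qed

text \<open>Infinite descent: p^2 + p q - q^2 is odd unless p and q are both even, so a zero with q
  nonzero could be halved forever.\<close>

lemma golden_norm_eq_0:
  fixes p q :: int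
  assumes "p * p + p * q - q * q = 0"
  shows "q = 0"
  using assms
proof (induction "nat \<bar>q\<bar>" arbitrary: p q rule: less_induct)
  case less
  show ?case
  proof (rule ccontr)
    assume "q \<noteq> 0"
    have "even (p * p + p * q - q * q)" using less.prems by simp
    then have "even p" "even q" by auto
    then obtain r s where rs: "p = 2 * r" "q = 2 * s" by (auto elim!: evenE)
    then have "4 * (r * r + r * s - s * s) = 0"
      using less.prems by (simp add: algebra_simps)
    then have "r * r + r * s - s * s = 0" by simp
    then have "s = 0"
      using less.hyps[of s r] rs \<open>q \<noteq> 0\<close> by (auto simp: abs_mult)
    then show False using rs \<open>q \<noteq> 0\<close> by simp
  qed
qed

text \<open>The product \<open>a * a'\<close> is the norm p^2 + p q - q^2, an integer.\<close>

lemma golden_pair_eq_0: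
  assumes "golden_pair a a'" "\<bar>a * a'\<bar> < 1" shows "a = 0"
proof -
  obtain p q :: int where a: "a = p + q * golden" "a' = p + q * (1 - golden)"
    using assms by (auto simp: golden_pair_def)
  have "a * a' = of_int (p * p + p * q - q * q)"
    by (simp add: a algebra_simps golden_sq golden_sq')
  with assms(2) have "p * p + p * q - q * q = 0" by linarith
  then have "a * a' = 0" using \<open>a * a' = _\<close> by simp
  then have "a = 0 \<or> a' = 0" by simp
  then show ?thesis
  proof
    assume "a' = 0"
    have "q = 0"
      using \<open>p * p + p * q - q * q = 0\<close> by (rule golden_norm_eq_0)
    then show ?thesis using \<open>a' = 0\<close> by (simp add: a)
  qed simp
qed

text \<open>The pairs (a, a') form a lattice in the plane. The bound 5 K comes from sqrt 5 |q| = |a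
  - a'| <= 2 K, so |q| <= 2 K and |p| <= K + 2 |q|.\<close>

lemma finite_golden_pair: "finite {a. \<exists>a'. golden_pair a a' \<and> \<bar>a\<bar> \<le> K \<and> \<bar>a'\<bar> \<le> K}"
proof (rule finite_subset)
  let ?I = "{- \<lceil>5 * K\<rceil>..\<lceil>5 * K\<rceil>}"
  show "finite ((\<lambda>(p, q). of_int p + of_int q * golden) ` (?I \<times> ?I))" by simp
  show "{a. \<exists>a'. golden_pair a a' \<and> \<bar>a\<bar> \<le> K \<and> \<bar>a'\<bar> \<le> K} \<subseteq> (\<lambda>(p, q). of_int p + of_int q * golden) ` (?I \<times> ?I)"
  proof
    fix a assume "a \<in> {a. \<exists>a'. golden_pair a a' \<and> \<bar>a\<bar> \<le> K \<and> \<bar>a'\<bar> \<le> K}"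
    then obtain a' and p q :: int where a: "a = p + q * golden" "a' = p + q * (1 - golden)" "\<bar>a\<bar> \<le> K" "\<bar>a'\<bar> \<le> K"
      by (auto simp: golden_pair_def)
    have "of_int q * (2 * golden - 1) = a - a'" by (simp add: a algebra_simps)
    moreover have "\<bar>of_int q * (2 * golden - 1)\<bar> = \<bar>of_int q\<bar> * (2 * golden - 1)"
      using golden_pos by (simp add: abs_mult)
    ultimately have "\<bar>of_int q\<bar> * (2 * golden - 1) = \<bar>a - a'\<bar>" by simp
    then have q: "\<bar>of_int q\<bar> \<le> 2 * K"
      using a mult_left_mono[of 1 "2 * golden - 1" "\<bar>of_int q :: real\<bar>"] golden_pos by linarith
    have "\<bar>of_int q * golden\<bar> \<le> 2 * (2 * K)"
      using q golden_pos mult_mono[of "\<bar>of_int q :: real\<bar>" "2 * K" golden 2] by (simp add: abs_mult)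
    then have p: "\<bar>of_int p\<bar> \<le> 5 * K" using a by linarith
    have "0 \<le> K" using a by linarith
    have "p \<in> ?I" "q \<in> ?I" using p q \<open>0 \<le> K\<close> by (auto simp: abs_le_iff; linarith)+
    then show "a \<in> (\<lambda>(p, q). of_int p + of_int q * golden) ` (?I \<times> ?I)"
      unfolding a(1) by force
  qed
qed

section \<open>The orbit of the chamber\<close>

context coxeter_frame
begin

definition "gens = b ` {0..4} \<union> (vertex b 5 - {0})"

lemma e5_ne_0: "e5 \<noteq> 0"
  using e_orthonormal(6) by (auto simp: mink_simps)

lemma gens_cases:
  assumes "n \<in> gens"
  obtains (facet) j where "j \<le> 4" "n = b j" | (base) c where "c \<noteq> 0" "n = c *\<^sub>R e5"
  using assms by (auto simp: gens_def vertex_5)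

sublocale reflections gens
proof
  fix n assume "n \<in> gens"
  then show "0 < mink n n"
    by (cases rule: gens_cases) (auto simp: b_diag mink_simps e_orthonormal' zero_less_mult_iff)
qed

lemma b_e5: "j \<le> 4 \<Longrightarrow> mink (b j) e5 = 0"
proof -
  have "\<forall>j\<le>4. mink (b j) e5 = 0"
    by (simp add: all_le_4 mink_commute[of "b _" e5] e5_b)
  then show "j \<le> 4 \<Longrightarrow> mink (b j) e5 = 0" by blast
qed

lemma refl_base: "c \<noteq> 0 \<Longrightarrow> refl_in (c *\<^sub>R e5) x = x - (2 * mink x e5) *\<^sub>R e5"
  by (simp add: refl_in_def mink_simps e_orthonormal')

lemma group_e5: "g \<in> refl_group gens \<Longrightarrow> g e5 = e5 \<or> g e5 = - e5"
proof (induction rule: refl_group.induct)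
  case (refl n g)
  have lin: "refl_in n (- e5) = - refl_in n e5"
    using linear_neg[OF linear_refl_in] .
  from refl(1) have "refl_in n e5 = e5 \<or> refl_in n e5 = - e5"
  proof (cases rule: gens_cases)
    case (facet j)
    then show ?thesis by (simp add: refl_in_def mink_commute[of e5] b_e5)
  next
    case (base c)
    then show ?thesis by (simp add: refl_base e_orthonormal' scaleR_2)
  qed
  then show ?case using refl.IH lin by auto
qed simp

text \<open>
  The conjugate golden ratio \<open>1 - golden\<close> turns the Gram matrix of \<open>b 0, \<dots>, b 4\<close> into a positive
  definite one, which is realised by \<open>b'\<close>.  This makes the group orbits below discrete.
\<close>

type_synonym vec5 = "real \<times> real \<times> real \<times> real \<times> real"

text \<open>The squares are the Galois conjugates of the Gram-Schmidt pivots of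
  \<open>b 1, ..., b 4\<close>. The single negative pivot - golden becomes golden - 1 = 1 / golden,
  which is why the conjugate form is definite.\<close>

definition "t1 = sqrt ((2 + golden) / 4)"
definition "t2 = sqrt (1 / (3 - golden))"
definition "t3 = sqrt ((1 + golden) / 4)"
definition "t4 = sqrt (1 / golden)"

lemma t_pos: "0 < t1" "0 < t2" "0 < t3" "0 < t4"
  using golden_pos by (auto simp: t1_def t2_def t3_def t4_def)

lemma t_sq: "t1 * t1 = (2 + golden) / 4" "t2 * t2 = 1 / (3 - golden)" "t3 * t3 = (1 + golden) / 4" "t4 * t4 = 1 / golden"
  using golden_pos by (auto simp: t1_def t2_def t3_def t4_def)

definition b' :: "nat \<Rightarrow> vec5" where
  "b' j = (if j = 0 then (1, 0, 0, 0, 0) else if j = 1 then ((golden - 1) / 2, t1, 0, 0, 0)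
     else if j = 2 then (0, - 1 / (2 * t1), t2, 0, 0) else if j = 3 then (0, 0, - 1 / (2 * t2), t3, 0)
     else (0, 0, 0, - 1 / (2 * t3), t4))"

lemma b'_gram:
  "b' 0 \<bullet> b' 0 = 1" "b' 1 \<bullet> b' 1 = 1" "b' 2 \<bullet> b' 2 = 1" "b' 3 \<bullet> b' 3 = 1" "b' 4 \<bullet> b' 4 = 1"
  "b' 0 \<bullet> b' 1 = (golden - 1) / 2" "b' 1 \<bullet> b' 2 = - 1 / 2" "b' 2 \<bullet> b' 3 = - 1 / 2" "b' 3 \<bullet> b' 4 = - 1 / 2"
  "b' 0 \<bullet> b' 2 = 0" "b' 0 \<bullet> b' 3 = 0" "b' 0 \<bullet> b' 4 = 0" "b' 1 \<bullet> b' 3 = 0" "b' 1 \<bullet> b' 4 = 0" "b' 2 \<bullet> b' 4 = 0"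
proof -
  have q: "1 / (2 * t) * (1 / (2 * t)) = 1 / (4 * (t * t))" for t :: real by simp
  have "(golden - 1) / 2 * ((golden - 1) / 2) + t1 * t1 = 1"
    unfolding t_sq by (simp add: field_simps golden_sq)
  then show "b' 1 \<bullet> b' 1 = 1" by (simp add: b'_def)
  have "1 / (2 * t1) * (1 / (2 * t1)) + t2 * t2 = 1"
    using golden_pos unfolding q t_sq by (simp add: field_simps) (simp add: algebra_simps golden_sq golden_sq')
  then show "b' 2 \<bullet> b' 2 = 1" by (simp add: b'_def)
  have "1 / (2 * t2) * (1 / (2 * t2)) + t3 * t3 = 1"
    using golden_pos unfolding q t_sq by (simp add: field_simps)
  then show "b' 3 \<bullet> b' 3 = 1" by (simp add: b'_def)
  have "1 / (2 * t3) * (1 / (2 * t3)) + t4 * t4 = 1"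
    using golden_pos unfolding q t_sq by (simp add: field_simps) (simp add: algebra_simps golden_sq golden_sq')
  then show "b' 4 \<bullet> b' 4 = 1" by (simp add: b'_def)
qed (use t_pos in \<open>simp_all add: b'_def\<close>)

text \<open>The factor 2 clears the denominators of the Gram entries, and it is the factor with
  which they enter a reflection.\<close>

lemma gram_pair:
  assumes "i \<le> 4" "j \<le> 4"
  shows "golden_pair (2 * mink (b i) (b j)) (2 * (b' i \<bullet> b' j))"
proof -
  have "golden_pair 2 2" "golden_pair (- 1) (- 1)" "golden_pair 0 0"
    using golden_pair_int[of 2] golden_pair_int[of "- 1"] golden_pair_int[of 0] by simp_all
  moreover have "golden_pair (- golden) (golden - 1)"
    by (rule golden_pairI[of _ 0 "- 1"]) auto
  moreover have "golden_pair (- golden) ((2 * golden - 2) / 2)"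
    by (rule golden_pairI[of _ 0 "- 1"]) auto
  ultimately have "\<forall>i\<le>4. \<forall>j\<le>4. golden_pair (2 * mink (b i) (b j)) (2 * (b' i \<bullet> b' j))"
    by (simp add: all_le_4 b_gram b'_gram inner_commute[of "b' 1" "b' 0"] inner_commute[of "b' 2" "b' 0"]
        inner_commute[of "b' 2" "b' 1"] inner_commute[of "b' 3" "b' 0"] inner_commute[of "b' 3" "b' 1"]
        inner_commute[of "b' 3" "b' 2"] inner_commute[of "b' 4" "b' 0"] inner_commute[of "b' 4" "b' 1"]
        inner_commute[of "b' 4" "b' 2"] inner_commute[of "b' 4" "b' 3"])
  then show ?thesis using assms by blast
qed

text \<open>\<open>w'\<close> plays the Galois conjugate of \<open>w\<close>; it is fixed only
  through its products with \<open>b'\<close>, since conjugation is not real linear. The condition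
  on \<open>e5\<close> keeps \<open>w\<close> in the span of \<open>b 0, ..., b 4\<close>, to which
  the conjugate form belongs.\<close>

definition conj_state :: "vec6 \<Rightarrow> vec5 \<Rightarrow> bool" where
  "conj_state w w' \<longleftrightarrow> mink w e5 = 0 \<and> (\<forall>j\<le>4. golden_pair (mink w (b j)) (w' \<bullet> b' j))"

text \<open>Reflections in \<open>b i\<close> and \<open>b' i\<close> act in parallel. On the
  conjugate side they are Euclidean isometries, so the norm stays constant, and this bounds the
  conjugate coordinates along an infinite orbit. The last clause says that the products with a fixed
  integral vector \<open>om\<close> and its conjugate change by twice a conjugate pair.\<close>

lemma orbit_conj:
  assumes "g \<in> refl_group gens" and w: "conj_state w w'"
    and om: "\<And>j. j \<le> 4 \<Longrightarrow> golden_pair (mink om (b j)) (om' \<bullet> b' j)"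
  shows "\<exists>v'. norm v' = norm w' \<and> conj_state (g w) v' \<and>
    (\<exists>m m'. golden_pair m m' \<and> mink (g w) om = mink w om + 2 * m \<and> v' \<bullet> om' = w' \<bullet> om' + 2 * m')"
  using assms(1)
proof (induction rule: refl_group.induct)
  case one
  show ?case
    using w golden_pair_int[of 0] by (intro exI[of _ w'] conjI exI[of _ 0]) auto
next
  case (refl n g)
  then obtain v' m m' where v': "norm v' = norm w'" "conj_state (g w) v'"
    and m: "golden_pair m m'" "mink (g w) om = mink w om + 2 * m" "v' \<bullet> om' = w' \<bullet> om' + 2 * m'"
    by blast
  let ?v = "g w"
  from refl(1) show ?case
  proof (cases rule: gens_cases)
    case (base c)
    then have eq: "(refl_in n \<circ> g) w = ?v"
      using v' by (simp add: refl_base conj_state_def)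
    show ?thesis unfolding eq using v' m by blast
  next
    case (facet i)
    let ?u' = "v' - (2 * (v' \<bullet> b' i)) *\<^sub>R b' i"
    have r: "(refl_in n \<circ> g) w = ?v - (2 * mink ?v (b i)) *\<^sub>R b i"
      using facet by (simp add: refl_in_def b_diag)
    have bi: "b' i \<bullet> b' i = 1"
    proof -
      have "\<forall>i\<le>4. b' i \<bullet> b' i = 1" by (simp add: all_le_4 b'_gram)
      then show ?thesis using facet by blast
    qed
    have x: "golden_pair (mink ?v (b i)) (v' \<bullet> b' i)"
      using v' facet by (simp add: conj_state_def)
    have "?u' \<bullet> ?u' = v' \<bullet> v'"
      using bi by (simp add: inner_simps inner_commute[of "b' i" v'])
    then have "norm ?u' = norm w'" using v'(1) by (simp add: norm_eq_sqrt_inner)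
    moreover have "conj_state ((refl_in n \<circ> g) w) ?u'"
      unfolding conj_state_def r
    proof (intro conjI allI impI)
      show "mink (?v - (2 * mink ?v (b i)) *\<^sub>R b i) e5 = 0"
        using v' facet by (simp add: conj_state_def mink_simps b_e5)
      fix j :: nat assume j: "j \<le> 4"
      have "golden_pair (mink ?v (b j) - mink ?v (b i) * (2 * mink (b i) (b j)))
          (v' \<bullet> b' j - (v' \<bullet> b' i) * (2 * (b' i \<bullet> b' j)))"
        using v'(2) j golden_pair_diff[OF _ golden_pair_mult[OF x gram_pair[OF facet(1) j]]]
        unfolding conj_state_def by blast
      then show "golden_pair (mink (?v - (2 * mink ?v (b i)) *\<^sub>R b i) (b j)) (?u' \<bullet> b' j)"
        by (simp add: mink_simps inner_simps ac_simps)
    qed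
    moreover have "golden_pair (m - mink ?v (b i) * mink om (b i)) (m' - (v' \<bullet> b' i) * (om' \<bullet> b' i))"
      using m x om facet by (intro golden_pair_diff golden_pair_mult) auto
    moreover have "mink ((refl_in n \<circ> g) w) om = mink w om + 2 * (m - mink ?v (b i) * mink om (b i))"
      unfolding r using m by (simp add: mink_simps mink_commute[of "b i" om] algebra_simps)
    moreover have "?u' \<bullet> om' = w' \<bullet> om' + 2 * (m' - (v' \<bullet> b' i) * (om' \<bullet> b' i))"
      using m by (simp add: inner_simps inner_commute[of "b' i" om'] algebra_simps)
    ultimately show ?thesis by blast
  qed
qed

text \<open>\<open>om\<close> is the fundamental weight dual to \<open>b 4\<close>, a multiple of
  \<open>e0\<close>. For an image in the chamber, T = cosh of its distance from P_4 is at most 1.9,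
  which makes m = - (T - 1) / (2 golden) small, while Cauchy-Schwarz on the definite side gives |m'|
  <= golden. The norm of m is then below one in modulus, so m = 0 and T = 1.\<close>

lemma chamber_orbit_center:
  assumes g: "g \<in> refl_group gens" and ch: "g e0 \<in> chamber"
  shows "g e0 = e0"
proof -
  define om om' where "om = (1 / s4) *\<^sub>R e0" and "om' = ((0, 0, 0, 0, 1 / t4) :: vec5)"
  have "\<forall>j\<le>4. mink om (b j) = (if j = 4 then 1 else 0) \<and> om' \<bullet> b' j = (if j = 4 then 1 else 0)"
    using s_pos t_pos by (simp add: all_le_4 om_def om'_def b'_def mink_simps e0_b)
  then have om: "golden_pair (mink om (b j)) (om' \<bullet> b' j)" if "j \<le> 4" for j
    using that golden_pair_int[of 0] golden_pair_int[of 1] by auto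
  have "conj_state om om'"
    using om by (simp add: conj_state_def om_def mink_simps e_orthonormal')
  from orbit_conj[OF g this om] obtain v' m m' where
    v': "norm v' = norm om'" "conj_state (g om) v'" and m: "golden_pair m m'"
    and m1: "mink (g om) om = mink om om + 2 * m" and m2: "v' \<bullet> om' = om' \<bullet> om' + 2 * m'"
    by blast
  define w where "w = g e0"
  have gom: "g om = (1 / s4) *\<^sub>R w"
    unfolding om_def w_def by (rule linear_cmul[OF linear_group[OF g]])
  have w5: "mink w e5 = 0"
    using v' s_pos by (simp add: conj_state_def gom mink_simps)
  define T where "T = - mink w e0"
  have "mink w w = - 1"
    unfolding w_def by (simp add: mink_group[OF g] e_orthonormal)
  then have T1: "T\<^sup>2 = 1 + ((mink w e1)\<^sup>2 + (mink w e2)\<^sup>2 + (mink w e3)\<^sup>2 + (mink w e4)\<^sup>2)"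
    using mink_expand[of w w] w5 by (simp add: T_def power2_eq_square)
  have "0 \<le> T" and "(mink w e1)\<^sup>2 + (mink w e2)\<^sup>2 + (mink w e3)\<^sup>2 + (mink w e4)\<^sup>2 \<le> 722 / 1000 * T\<^sup>2"
    using chamber_bound[of w] ch by (simp_all add: w_def T_def)
  \<comment> \<open>From T^2 <= 1 + 0.722 T^2 follows T^2 <= 1 / 0.278 < 3.61.\<close>
  with T1 have "T\<^sup>2 \<le> (19 / 10)\<^sup>2" "1\<^sup>2 \<le> T\<^sup>2" by (simp_all add: power2_eq_square)
  then have T: "T \<le> 19 / 10" "1 \<le> T"
    using \<open>0 \<le> T\<close> by (auto intro: power2_le_imp_le)
  have "mink (g om) om = mink w e0 / (s4 * s4)"
    by (simp only: gom) (simp add: om_def mink_simps)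
  moreover have "mink om om = mink e0 e0 / (s4 * s4)"
    by (simp add: om_def mink_simps)
  ultimately have "mink (g om) om = - T / golden" "mink om om = - 1 / golden"
    by (simp_all add: s_sq e_orthonormal T_def)
  then have mT: "m = - ((T - 1) / (2 * golden))"
  proof -
    have "m = (- T / golden - - 1 / golden) / 2"
      using m1 \<open>mink (g om) om = - T / golden\<close> \<open>mink om om = - 1 / golden\<close> by simp
    also have "\<dots> = - ((T - 1) / (2 * golden))"
      using golden_pos by (simp add: field_simps)
    finally show ?thesis .
  qed
  have oo: "om' \<bullet> om' = golden"
    using t_sq(4) golden_pos by (simp add: om'_def)
  have "\<bar>v' \<bullet> om'\<bar> \<le> norm v' * norm om'" by (rule Cauchy_Schwarz_ineq2)
  also have "\<dots> = golden"
    using v'(1) oo golden_pos by (simp add: norm_eq_sqrt_inner)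
  finally have m': "\<bar>m'\<bar> \<le> golden"
    using m2 oo by linarith
  have "\<bar>m * m'\<bar> \<le> (T - 1) / (2 * golden) * golden"
    unfolding abs_mult using m' T golden_pos by (intro mult_mono) (auto simp: mT)
  also have "\<dots> < 1" using T golden_pos by simp
  finally have "m = 0" by (rule golden_pair_eq_0[OF m])
  then have "T = 1" using mT golden_pos by simp
  then have "mink w e1 = 0 \<and> mink w e2 = 0 \<and> mink w e3 = 0 \<and> mink w e4 = 0"
    using T1 by (simp add: add_nonneg_eq_0_iff)
  then have "w = e0"
    using w5 \<open>T = 1\<close> by (intro frame_ext) (auto simp: e_orthonormal' T_def)
  then show ?thesis by (simp add: w_def)
qed


text \<open>Back-substitution in two triangular systems. All products are prescribed to be 1, which
  is its own conjugate, so the two solutions are conjugate to each other.\<close>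

lemma ex_interior_state:
  obtains z z' where "\<And>j. j \<le> 4 \<Longrightarrow> mink z (b j) = 1" "conj_state z z'"
proof -
  define z3 where "z3 = (1 + golden / 2) / s1"
  define z2 where "z2 = (1 + z3 / (2 * s1)) / s2"
  define z1 where "z1 = (1 + z2 / (2 * s2)) / s3"
  define z0 where "z0 = (1 + z1 / (2 * s3)) / s4"
  define z where "z = z0 *\<^sub>R e0 + z1 *\<^sub>R e1 + z2 *\<^sub>R e2 + z3 *\<^sub>R e3 + e4"
  have e: "mink z e0 = - z0" "mink z e1 = z1" "mink z e2 = z2" "mink z e3 = z3" "mink z e4 = 1" "mink z e5 = 0"
    by (simp_all add: z_def mink_simps e_orthonormal')
  have "\<forall>j\<le>4. mink z (b j) = 1"
    using s_pos by (simp add: all_le_4 mink_b e z0_def z1_def z2_def z3_def)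
  then have zb: "mink z (b j) = 1" if "j \<le> 4" for j using that by blast
  define y1 where "y1 = (1 - (golden - 1) / 2) / t1"
  define y2 where "y2 = (1 + y1 / (2 * t1)) / t2"
  define y3 where "y3 = (1 + y2 / (2 * t2)) / t3"
  define y4 where "y4 = (1 + y3 / (2 * t3)) / t4"
  define z' :: vec5 where "z' = (1, y1, y2, y3, y4)"
  have "z' \<bullet> b' 0 = 1" by (simp add: z'_def b'_def)
  moreover have "z' \<bullet> b' 1 = 1" using t_pos by (simp add: z'_def b'_def y1_def)
  moreover have "z' \<bullet> b' 2 = 1" using t_pos by (simp add: z'_def b'_def y2_def)
  moreover have "z' \<bullet> b' 3 = 1" using t_pos by (simp add: z'_def b'_def y3_def)
  moreover have "z' \<bullet> b' 4 = 1" using t_pos by (simp add: z'_def b'_def y4_def)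
  ultimately have "\<forall>j\<le>4. z' \<bullet> b' j = 1" by (simp add: all_le_4)
  then have "conj_state z z'"
    using zb e golden_pair_int[of 1] by (simp add: conj_state_def)
  with zb show thesis by (rule that)
qed

text \<open>Because \<open>x\<close> lies strictly inside the light cone, \<open>- mink x w\<close>
  controls \<open>fst w\<close> and thereby every \<open>mink w (b j)\<close>. The conjugates of
  these products are bounded by the constant norm of the conjugate orbit, so
  \<open>finite_golden_pair\<close> applies to each of them.\<close>

lemma finite_low_orbit:
  assumes z: "conj_state z z'" "mink z z < 0" and x: "mink x x < 0" "mink x z < 0"
  shows "finite {w. (\<exists>g\<in>refl_group gens. w = g z) \<and> - mink x w \<le> K}"
proof -
  let ?A = "{w. (\<exists>g\<in>refl_group gens. w = g z) \<and> - mink x w \<le> K}"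
  define d where "d = \<bar>fst x\<bar> - norm (snd x)"
  have d: "0 < d" using timelike_norm_less[OF x(1)] by (simp add: d_def)
  define M where "M j = max (K / d * (\<bar>fst (b j)\<bar> + norm (snd (b j)))) (norm z' * norm (b' j))" for j
  define F where "F j = {a. \<exists>a'. golden_pair a a' \<and> \<bar>a\<bar> \<le> M j \<and> \<bar>a'\<bar> \<le> M j}" for j
  have fst_pos: "0 < fst x * fst z"
    using timelike_mink_neg_iff[OF x(1) z(2)] x by simp
  have mem: "mink w (b j) \<in> F j" if w: "w \<in> ?A" and j: "j \<le> 4" for w j
  proof -
    obtain g where g: "g \<in> refl_group gens" "w = g z" using w by blast
    have om0: "golden_pair (mink 0 (b j)) (0 \<bullet> b' j)" for j
      using golden_pair_int[of 0] by (simp add: mink_simps)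
    obtain v' where v': "norm v' = norm z'" "conj_state w v'"
      using orbit_conj[OF g(1) z(1) om0] g(2) by blast
    have "0 < fst w * fst z"
      using group_sheet[OF g(1) z(2)] g(2) by simp
    then have pos: "0 < fst x * fst w"
      using fst_pos by (auto simp: zero_less_mult_iff)
    have ww: "mink w w < 0" using z(2) by (simp add: g mink_group)
    have sw: "norm (snd w) \<le> \<bar>fst w\<bar>" using timelike_norm_less[OF ww] by simp
    have "d * \<bar>fst w\<bar> = \<bar>fst x\<bar> * \<bar>fst w\<bar> - norm (snd x) * \<bar>fst w\<bar>"
      by (simp add: d_def algebra_simps)
    also have "\<dots> \<le> fst x * fst w - norm (snd x) * norm (snd w)"
      using pos sw by (simp add: mult_left_mono flip: abs_mult)
    also have "\<dots> \<le> - mink x w"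
      using norm_cauchy_schwarz[of "snd x" "snd w"] by (simp add: mink_def)
    also have "\<dots> \<le> K" using w by simp
    finally have fw: "\<bar>fst w\<bar> \<le> K / d" using d by (simp add: field_simps)
    have "\<bar>mink w (b j)\<bar> \<le> \<bar>fst w\<bar> * \<bar>fst (b j)\<bar> + norm (snd w) * norm (snd (b j))"
      using Cauchy_Schwarz_ineq2[of "snd w" "snd (b j)"] by (simp add: mink_def flip: abs_mult)
    also have "\<dots> \<le> \<bar>fst w\<bar> * (\<bar>fst (b j)\<bar> + norm (snd (b j)))"
      using sw by (simp add: distrib_left mult_right_mono)
    also have "\<dots> \<le> K / d * (\<bar>fst (b j)\<bar> + norm (snd (b j)))"
      using fw by (intro mult_right_mono) auto
    finally have "\<bar>mink w (b j)\<bar> \<le> M j" by (simp add: M_def)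
    moreover have "\<bar>v' \<bullet> b' j\<bar> \<le> M j"
      using Cauchy_Schwarz_ineq2[of v' "b' j"] v'(1) by (simp add: M_def)
    ultimately show ?thesis
      using v'(2) j unfolding F_def conj_state_def by blast
  qed
  define D where "D w = (mink w (b 0), mink w (b 1), mink w (b 2), mink w (b 3), mink w (b 4))" for w
  have "D ` ?A \<subseteq> F 0 \<times> F 1 \<times> F 2 \<times> F 3 \<times> F 4"
    unfolding D_def using mem by (intro image_subsetI SigmaI) auto
  moreover have "finite (F 0 \<times> F 1 \<times> F 2 \<times> F 3 \<times> F 4)"
    unfolding F_def by (intro finite_cartesian_product finite_golden_pair)
  ultimately have "finite (D ` ?A)" by (rule finite_subset)
  moreover have "inj_on D ?A"
  proof (rule inj_onI)
    fix v w assume "v \<in> ?A" "w \<in> ?A" and D: "D v = D w"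
    have 5: "mink u e5 = 0" if "u \<in> ?A" for u
    proof -
      obtain g where g: "g \<in> refl_group gens" "u = g z" using \<open>u \<in> ?A\<close> by blast
      have om0: "golden_pair (mink 0 (b j)) (0 \<bullet> b' j)" for j
        using golden_pair_int[of 0] by (simp add: mink_simps)
      show ?thesis using orbit_conj[OF g(1) z(1) om0] g(2) unfolding conj_state_def by blast
    qed
    have 4: "mink v e4 = mink w e4" using D by (simp add: D_def mink_b)
    then have 3: "mink v e3 = mink w e3" using D s_pos by (simp add: D_def mink_b)
    then have 2: "mink v e2 = mink w e2" using D s_pos by (simp add: D_def mink_b)
    then have 1: "mink v e1 = mink w e1" using D s_pos by (simp add: D_def mink_b)
    then have 0: "mink v e0 = mink w e0" using D s_pos by (simp add: D_def mink_b)
    show "v = w"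
      using 0 1 2 3 4 5[OF \<open>v \<in> ?A\<close>] 5[OF \<open>w \<in> ?A\<close>] by (intro frame_ext) auto
  qed
  ultimately show ?thesis by (rule finite_imageD)
qed

lemma timelike_chamber:
  assumes "x \<in> chamber" "mink x e5 = 0" "mink x e0 \<noteq> 0"
  shows "mink x x < 0"
proof -
  have "mink x x \<le> - (278 / 1000 * (mink x e0)\<^sup>2)"
    using chamber_bound(2)[OF assms(1)] mink_expand[of x x] assms(2) by (simp add: power2_eq_square)
  moreover have "0 < (mink x e0)\<^sup>2" using assms(3) by simp
  ultimately show ?thesis by linarith
qed

text \<open>Let w = g z be the image of the interior point z nearest to y. If y lay beyond the wall
  with normal g (b j), the mirror image of w in that wall would be nearer; hence the inverse of g
  takes y into the chamber. The sign c is needed because \<open>x\<close> may lie on the other sheet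
  than z.\<close>

lemma chamber_cover:
  assumes x: "mink x x < 0"
  obtains g x' c where "g \<in> refl_group gens" "c = 1 \<or> c = - 1" "g x' = c *\<^sub>R x" "x' \<in> chamber" "0 \<le> mink x' e5"
    "(mink x' e5)\<^sup>2 = (mink x e5)\<^sup>2"
proof -
  obtain z z' where z1: "\<And>j. j \<le> 4 \<Longrightarrow> mink z (b j) = 1" and zz: "conj_state z z'"
    using ex_interior_state by blast
  have zc: "z \<in> chamber" using z1 by (simp add: chamber_def)
  have z5: "mink z e5 = 0" using zz by (simp add: conj_state_def)
  have "mink z e0 \<noteq> 0"
  proof
    assume 0: "mink z e0 = 0"
    have "(mink z e1)\<^sup>2 \<le> 722 / 1000 * (mink z e0)\<^sup>2"
      using chamber_bound(2)[OF zc] zero_le_power2[of "mink z e2"] zero_le_power2[of "mink z e3"]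
        zero_le_power2[of "mink z e4"] by linarith
    then have "mink z e1 = 0" using 0 by simp
    then show False using z1[of 4] 0 by (simp add: mink_b)
  qed
  then have zt: "mink z z < 0" using timelike_chamber zc z5 by blast
  have "\<exists>c. (c = 1 \<or> c = - 1) \<and> mink (c *\<^sub>R x) z < 0"
  proof (cases "mink x z < 0")
    case True
    then show ?thesis by (intro exI[of _ 1]) auto
  next
    case False
    have "\<not> 0 < fst x * fst z" using False timelike_mink_neg_iff[OF x zt] by blast
    moreover have "fst x \<noteq> 0" "fst z \<noteq> 0" using timelike_norm_less[OF x] timelike_norm_less[OF zt] by auto
    then have "fst x * fst z \<noteq> 0" by (simp only: mult_eq_0_iff simp_thms)
    ultimately have "fst x * fst z < 0" by (meson linorder_neqE_linordered_idom)
    then have "0 < fst (- x) * fst z" by simp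
    moreover have "mink (- x) (- x) < 0" using x by (simp add: mink_simps)
    ultimately have "mink (- x) z < 0" using timelike_mink_neg_iff[of "- x" z] zt by blast
    then show ?thesis by (intro exI[of _ "- 1"]) auto
  qed
  then obtain c where c: "c = 1 \<or> c = - 1" "mink (c *\<^sub>R x) z < 0" by blast
  define y where "y = c *\<^sub>R x"
  have y: "mink y y < 0" "mink y z < 0" "(mink y e5)\<^sup>2 = (mink x e5)\<^sup>2"
  proof -
    show "mink y z < 0" using c(2) by (simp add: y_def)
    show "mink y y < 0" "(mink y e5)\<^sup>2 = (mink x e5)\<^sup>2"
      using c(1) x by (elim disjE; simp add: y_def mink_simps)+
  qed
  let ?A = "{w. (\<exists>g\<in>refl_group gens. w = g z) \<and> - mink y w \<le> - mink y z}"
  have fin: "finite ?A" by (rule finite_low_orbit[OF zz zt y(1,2)])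
  have zA: "z \<in> ?A" using refl_group.one[of gens] by (auto intro!: bexI[of _ id])
  define w where "w = arg_min_on (\<lambda>w. - mink y w) ?A"
  have wA: "w \<in> ?A" and wmin: "\<And>v. v \<in> ?A \<Longrightarrow> - mink y w \<le> - mink y v"
  proof -
    have ne: "?A \<noteq> {}" using zA by blast
    show "w \<in> ?A"
      unfolding w_def by (rule arg_min_if_finite(1)[OF fin ne])
    show "- mink y w \<le> - mink y v" if "v \<in> ?A" for v
      unfolding w_def by (rule arg_min_least[OF fin ne that])
  qed
  then obtain g where g: "g \<in> refl_group gens" "w = g z" by blast
  obtain h where h: "h \<in> refl_group gens" "\<And>x. g (h x) = x" "\<And>x. h (g x) = x"
    using group_inverse[OF g(1)] by blast
  have nonneg: "0 \<le> mink (h y) (b j)" if j: "j \<le> 4" for j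
  proof -
    have bj: "b j \<in> gens" using j by (simp add: gens_def)
    have "g \<circ> refl_in (b j) \<in> refl_group gens"
      using g(1) refl_in_mem[OF bj] by (rule refl_group_comp)
    note gr = this
    have r: "(g \<circ> refl_in (b j)) z = w - 2 *\<^sub>R g (b j)"
    proof -
      have "refl_in (b j) z = z - 2 *\<^sub>R b j" using j z1 by (simp add: refl_in_def b_diag)
      then show ?thesis
        by (simp add: g(2) linear_diff[OF linear_group[OF g(1)]] linear_cmul[OF linear_group[OF g(1)]])
    qed
    have "- mink y w \<le> - mink y (w - 2 *\<^sub>R g (b j))"
    \<comment> \<open>A mirror image outside \<open>?A\<close> is farther from y than z and thus
      farther than w, so minimality over the finite set suffices.\<close>
    proof (cases "- mink y (w - 2 *\<^sub>R g (b j)) \<le> - mink y z")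
      case True
      moreover have "\<exists>h\<in>refl_group gens. w - 2 *\<^sub>R g (b j) = h z"
        by (rule bexI[OF _ gr]) (rule r[symmetric])
      ultimately have "w - 2 *\<^sub>R g (b j) \<in> ?A" by blast
      then show ?thesis by (rule wmin)
    next
      case False
      then show ?thesis using wA by auto
    qed
    then have "0 \<le> mink y (g (b j))" by (simp add: mink_simps)
    also have "mink y (g (b j)) = mink (g (h y)) (g (b j))" by (simp add: h)
    also have "\<dots> = mink (h y) (b j)" by (rule mink_group[OF g(1)])
    finally show ?thesis .
  qed
  have hc: "h y \<in> chamber" using nonneg by (simp add: chamber_def)
  have "mink (h y) e5 = mink y (g e5)"
    using mink_group[OF g(1), of "h y" e5] by (simp add: h)
  then have h5: "(mink (h y) e5)\<^sup>2 = (mink x e5)\<^sup>2"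
    using group_e5[OF g(1)] unfolding y(3)[symmetric] by (elim disjE; simp add: mink_simps)
  show thesis
  proof (cases "0 \<le> mink (h y) e5")
    case True
    have "g (h y) = c *\<^sub>R x" unfolding h(2) y_def by (rule HOL.refl)
    then show thesis by (rule that[OF g(1) c(1) _ hc True h5])
  next
    case False
    \<comment> \<open>The reflection in the base hyperplane changes the sign of the height and
      leaves all products with \<open>b 0, ..., b 4\<close> alone.\<close>
    let ?r = "refl_in e5"
    have e5: "e5 \<in> gens"
    proof -
      have "e5 \<in> range (\<lambda>c. c *\<^sub>R e5)" by (rule range_eqI[of _ _ 1]) simp
      then show ?thesis using e5_ne_0 by (simp add: gens_def vertex_5)
    qed
    have r: "?r u = u - (2 * mink u e5) *\<^sub>R e5" for u
      using refl_base[of 1 u] by simp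
    have r5: "mink (?r (h y)) e5 = - mink (h y) e5"
      by (simp add: r mink_simps e_orthonormal)
    have rb: "mink (?r (h y)) (b j) = mink (h y) (b j)" if "j \<le> 4" for j
      using that by (simp add: r mink_simps b_e5 mink_commute[of e5])
    have "?r (?r (h y)) = h y"
      by (rule refl_in_involution) (simp add: e_orthonormal)
    then have gr: "(g \<circ> ?r) (?r (h y)) = c *\<^sub>R x"
      by (simp add: h(2)) (simp add: y_def)
    have "g \<circ> ?r \<in> refl_group gens"
      using g(1) refl_in_mem[OF e5] by (rule refl_group_comp)
    moreover have "?r (h y) \<in> chamber"
      using rb nonneg by (simp add: chamber_def)
    moreover have "0 \<le> mink (?r (h y)) e5" "(mink (?r (h y)) e5)\<^sup>2 = (mink x e5)\<^sup>2"
      using False h5 by (simp_all add: r5)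
    ultimately show thesis using gr c(1) by (intro that[of "g \<circ> ?r" c "?r (h y)"])
  qed
qed

end

section \<open>The height of the optimal hyperball\<close>

lemma tanh_artanh_real:
  fixes x :: real assumes "\<bar>x\<bar> < 1" shows "tanh (artanh x) = x"
proof -
  define r where "r = (1 + x) / (1 - x)"
  have x: "0 < 1 + x" "0 < 1 - x" using assms by (simp_all add: abs_less_iff)
  then have r: "0 < r" by (simp add: r_def)
  have "- 2 * artanh x = - ln r" by (simp add: artanh_def r_def)
  then have "exp (- 2 * artanh x) = 1 / r"
    using r by (simp only: exp_minus exp_ln inverse_eq_divide)
  then have "tanh (artanh x) = (1 - 1 / r) / (1 + 1 / r)"
    by (simp only: tanh_real_altdef)
  also have "\<dots> = (r - 1) / (r + 1)"
    using r by (simp add: divide_simps)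
  also have "r - 1 = 2 * x / (1 - x)"
    using x by (simp add: r_def divide_simps)
  also have "r + 1 = 2 / (1 - x)"
    using x by (simp add: r_def divide_simps)
  also have "(2 * x / (1 - x)) / (2 / (1 - x)) = x"
    using x by simp
  finally show ?thesis .
qed

text \<open>With |s| = sinh v the left side says v <= artanh u, that is tanh v <= u.\<close>

lemma arcosh_le_artanh_iff:
  fixes s u :: real assumes "0 \<le> u" "u < 1"
  shows "arcosh (sqrt (1 + s\<^sup>2)) \<le> artanh u \<longleftrightarrow> s\<^sup>2 \<le> u\<^sup>2 * (1 + s\<^sup>2)"
proof -
  define v where "v = arsinh \<bar>s\<bar>"
  have sv: "sinh v = \<bar>s\<bar>" and cv: "cosh v = sqrt (1 + s\<^sup>2)"
    by (simp_all add: v_def cosh_arsinh_real add.commute)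
  have "0 \<le> v" using sv abs_ge_zero[of s] unfolding sv[symmetric] by simp
  then have "arcosh (sqrt (1 + s\<^sup>2)) = v"
    using arcosh_cosh_real[of v] cv by simp
  then have "arcosh (sqrt (1 + s\<^sup>2)) \<le> artanh u \<longleftrightarrow> tanh v \<le> u"
    using tanh_real_le_iff[of v "artanh u"] tanh_artanh_real[of u] assms by simp
  also have "\<dots> \<longleftrightarrow> \<bar>s\<bar> \<le> u * sqrt (1 + s\<^sup>2)"
    by (simp add: tanh_def sv cv divide_le_eq add_pos_nonneg)
  also have "\<dots> \<longleftrightarrow> s\<^sup>2 \<le> (u * sqrt (1 + s\<^sup>2))\<^sup>2"
  proof -
    have "0 \<le> u * sqrt (1 + s\<^sup>2)" using assms by simp
    then show ?thesis using abs_le_square_iff[of s "u * sqrt (1 + s\<^sup>2)"] by (simp only: abs_of_nonneg)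
  qed
  also have "\<dots> \<longleftrightarrow> s\<^sup>2 \<le> u\<^sup>2 * (1 + s\<^sup>2)"
    by (simp add: power_mult_distrib add_nonneg_nonneg)
  finally show ?thesis .
qed

context coxeter_frame
begin

lemma tau_less_1: "\<tau> < 1"
proof -
  have "\<tau>\<^sup>2 < 1"
    using golden_pos kappa_pos by (simp add: c_sq add_pos_pos)
  then show ?thesis using c_pos(5) by (simp add: abs_square_less_1)
qed

lemma hyperball_iff:
  assumes "mink x x = - 1"
  shows "span {x} \<in> hyperball (base_hyperplane b) h \<longleftrightarrow> arcosh (sqrt (1 + (mink x e5)\<^sup>2)) \<le> h"
proof -
  have "span {x} \<in> hyp5" using assms by (intro span_in_hyp5) simp
  then show ?thesis
    unfolding hyperball_def base_hyperplane_eq mem_Collect_eq hdist_set_hyperplane[OF e_orthonormal(6) assms]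
    by (simp only: simp_thms)
qed

lemma prism_eq: "prism_polyhedron b = (\<Union>g\<in>refl_group gens. (\<lambda>P. g ` P) ` orthoscheme b)"
  by (simp only: prism_polyhedron_def gens_def)

text \<open>In the chamber the height s and the time coordinate T satisfy 1 + s^2 <= T^2, the
  remaining squares being nonnegative. The distance bound s^2 <= tau^2 (1 + s^2) therefore yields s
  <= tau T, the inner side of H^5.\<close>

lemma hyperball_subset_prism: "hyperball (base_hyperplane b) (artanh \<tau>) \<subseteq> prism_polyhedron b"
proof
  fix P assume P: "P \<in> hyperball (base_hyperplane b) (artanh \<tau>)"
  then have "P \<in> hyp5" by (simp add: hyperball_def)
  then obtain x where x: "P = span {x}" "mink x x = - 1" using hyp5_rep by blast
  have s: "(mink x e5)\<^sup>2 \<le> \<tau>\<^sup>2 * (1 + (mink x e5)\<^sup>2)"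
    using P arcosh_le_artanh_iff[of \<tau> "mink x e5"] c_pos(5) tau_less_1
    unfolding x(1) hyperball_iff[OF x(2)] by simp
  have "mink x x < 0" using x by simp
  then obtain g x' c where g: "g \<in> refl_group gens" "c = 1 \<or> c = - 1" "g x' = c *\<^sub>R x"
    "x' \<in> chamber" "0 \<le> mink x' e5" "(mink x' e5)\<^sup>2 = (mink x e5)\<^sup>2"
    by (rule chamber_cover)
  have "mink x' x' = mink (g x') (g x')" by (simp add: mink_group[OF g(1)])
  also have "\<dots> = - 1" using g(2) x(2) by (auto simp: g(3) mink_simps)
  finally have x'1: "mink x' x' = - 1" .
  define T where "T = - mink x' e0"
  have T0: "0 \<le> T" using chamber_bound(1)[OF g(4)] by (simp add: T_def)
  have "1 + (mink x' e5)\<^sup>2 \<le> T\<^sup>2"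
    using mink_expand[of x' x'] x'1 zero_le_square[of "mink x' e1"] zero_le_square[of "mink x' e2"]
      zero_le_square[of "mink x' e3"] zero_le_square[of "mink x' e4"]
    unfolding T_def power2_eq_square minus_mult_minus by linarith
  then have "\<tau>\<^sup>2 * (1 + (mink x' e5)\<^sup>2) \<le> \<tau>\<^sup>2 * T\<^sup>2"
    by (rule mult_left_mono) simp
  then have "(mink x' e5)\<^sup>2 \<le> (\<tau> * T)\<^sup>2"
    using s by (simp add: g(6) power_mult_distrib)
  then have "mink x' e5 \<le> \<tau> * T"
    by (rule power2_le_imp_le) (use T0 c_pos(5) in simp)
  then have "span {x'} \<in> orthoscheme b"
    unfolding orthoscheme_eq mem_Collect_eq using x'1 g(4,5) span_in_hyp5[of x']
    by (intro conjI bexI[of _ x']) (auto simp: T_def mink_simps span_base)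
  moreover have "P = g ` span {x'}"
  proof -
    have "g ` span {x'} = span {g x'}"
      using linear_span_image[OF linear_group[OF g(1)], of "{x'}"] by simp
    also have "\<dots> = P" unfolding g(3) x(1) by (rule span_singleton_eq) (use g(2) in auto)
    finally show ?thesis by simp
  qed
  ultimately show "P \<in> prism_polyhedron b"
    unfolding prism_eq by (intro UN_I[OF g(1)] image_eqI)
qed

text \<open>The witness lies at distance h above P_4, beyond A_4 on the same perpendicular. If an
  image of the orthoscheme contained it, the inverse element k would carry P_4 into the chamber,
  hence fix it by \<open>chamber_orbit_center\<close>, and the witness would lie beyond H^5.\<close>

lemma hyperball_not_subset_prism:
  assumes h: "artanh \<tau> < h"
  shows "\<not> hyperball (base_hyperplane b) h \<subseteq> prism_polyhedron b"
proof
  assume sub: "hyperball (base_hyperplane b) h \<subseteq> prism_polyhedron b"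
  define x where "x = cosh h *\<^sub>R e0 + sinh h *\<^sub>R e5"
  have tt: "\<tau> < tanh h"
    using tanh_real_less_iff[of "artanh \<tau>" h] tanh_artanh_real[of \<tau>] c_pos(5) tau_less_1 h by simp
  then have "0 < tanh h" using c_pos(5) by linarith
  then have h0: "0 < h" by simp
  have xx: "mink x x = - 1"
    using cosh_square_eq[of h] by (simp add: x_def mink_simps e_orthonormal' power2_eq_square)
  have "mink x e5 = sinh h" by (simp add: x_def mink_simps e_orthonormal')
  moreover have "sqrt (1 + (sinh h)\<^sup>2) = cosh h"
  proof -
    have "1 + (sinh h)\<^sup>2 = (cosh h)\<^sup>2" using cosh_square_eq[of h] by simp
    then show ?thesis by (simp only: real_sqrt_abs abs_of_nonneg[OF cosh_real_nonneg])
  qed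
  ultimately have "span {x} \<in> hyperball (base_hyperplane b) h"
    using h0 by (simp add: hyperball_iff[OF xx] arcosh_cosh_real)
  with sub obtain g Q where g: "g \<in> refl_group gens" and Q: "Q \<in> orthoscheme b" "span {x} = g ` Q"
    unfolding prism_eq by blast
  then obtain q where q: "q \<in> Q" "q \<noteq> 0" "q \<in> chamber" "0 \<le> mink q e5" "mink q e5 \<le> \<tau> * (- mink q e0)"
    unfolding orthoscheme_eq by blast
  have "g q \<in> span {x}" using q(1) Q(2) by blast
  then obtain c where c: "g q = c *\<^sub>R x" by (auto simp: span_singleton)
  obtain k where k: "k \<in> refl_group gens" "\<And>x. g (k x) = x" "\<And>x. k (g x) = x"
    using group_inverse[OF g] by blast
  note lin = linear_group[OF k(1)]
  have "q = k (g q)" by (simp add: k)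
  also have "\<dots> = c *\<^sub>R (cosh h *\<^sub>R k e0 + sinh h *\<^sub>R k e5)"
    unfolding c x_def by (simp add: linear_add[OF lin] linear_cmul[OF lin])
  finally have q_eq: "q = c *\<^sub>R (cosh h *\<^sub>R k e0 + sinh h *\<^sub>R k e5)" .
  have "c \<noteq> 0" using q(2) q_eq by auto
  from group_e5[OF k(1)] obtain d where d: "d = 1 \<or> d = - 1" "k e5 = d *\<^sub>R e5" by force
  have w5: "mink (k e0) e5 = 0"
  proof -
    have "mink (k e0) (k e5) = 0" by (simp add: mink_group[OF k(1)] e_orthonormal)
    then show ?thesis using d by (auto simp: mink_simps)
  qed
  have "0 < fst (k e0) * fst e0"
    using group_sheet[OF k(1), of e0] by (simp add: e_orthonormal)
  then have w0: "mink (k e0) e0 < 0"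
    using timelike_mink_neg_iff[of "k e0" e0] by (simp add: e_orthonormal mink_group[OF k(1)])
  have "0 \<le> - mink q e0" by (rule chamber_bound(1)[OF q(3)])
  moreover have qe0: "- mink q e0 = c * (cosh h * (- mink (k e0) e0))"
    by (simp add: q_eq d(2) mink_simps e_orthonormal')
  moreover have "0 < cosh h * (- mink (k e0) e0)" using w0 by (intro mult_pos_pos) auto
  ultimately have "0 \<le> c" unfolding qe0 using mult_neg_pos[of c] by (simp only: not_less[symmetric]) blast
  with \<open>c \<noteq> 0\<close> have "0 < c" by simp
  have "k e0 \<in> chamber"
  proof -
    have "0 \<le> mink (k e0) (b j)" if "j \<le> 4" for j
    proof -
      have "0 \<le> mink q (b j)" using q(3) that by (simp add: chamber_def)
      also have "mink q (b j) = (c * cosh h) * mink (k e0) (b j)"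
        using that by (simp add: q_eq d(2) mink_simps mink_commute[of e5 "b j"] b_e5)
      finally show ?thesis
        using \<open>0 < c\<close> mult_pos_neg[of "c * cosh h" "mink (k e0) (b j)"]
        by (simp only: not_less[symmetric] mult_pos_pos cosh_real_pos) blast
    qed
    then show ?thesis by (simp add: chamber_def)
  qed
  then have ke0: "k e0 = e0" by (rule chamber_orbit_center[OF k(1)])
  have qe5: "mink q e5 = c * sinh h * d"
    by (simp add: q_eq d(2) mink_simps e_orthonormal' ke0)
  have "0 < sinh h" using h0 by simp
  then have "d = 1"
    using d(1) q(4) \<open>0 < c\<close> by (auto simp: qe5 mult_le_0_iff)
  then have "c * sinh h \<le> c * (\<tau> * cosh h)"
    using q(5) unfolding qe5 qe0 by (simp add: ke0 e_orthonormal ac_simps)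
  then have "sinh h \<le> \<tau> * cosh h" using \<open>0 < c\<close> by simp
  then have "tanh h \<le> \<tau>" by (simp add: tanh_def divide_le_eq)
  then show False using tt by simp
qed

lemma opt_height_eq: "opt_height b = artanh \<tau>"
  unfolding opt_height_def
proof (rule Greatest_equality)
  fix h assume sub: "hyperball (base_hyperplane b) h \<subseteq> prism_polyhedron b"
  show "h \<le> artanh \<tau>"
  proof (rule ccontr)
    assume "\<not> h \<le> artanh \<tau>"
    then show False using hyperball_not_subset_prism[of h] sub by (simp only: not_le)
  qed
qed (rule hyperball_subset_prism)

text \<open>Clearing the denominator 1 - |y|^2 cancels y5 on the right, so the height allowed over a
  base point depends on that point alone.\<close>

lemma klein_chart_opt_hyperball:
  "klein_chart {P. frame ` P \<in> opt_hyperball b \<inter> orthoscheme b}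
     = klein_chart {P. frame ` P \<in> orthoscheme b} \<inter>
       {y. (y $ 5)\<^sup>2 \<le> \<tau>\<^sup>2 * (1 - ((y $ 1)\<^sup>2 + (y $ 2)\<^sup>2 + (y $ 3)\<^sup>2 + (y $ 4)\<^sup>2))}"
proof -
  have "frame ` span {(1, y)} \<in> opt_hyperball b \<longleftrightarrow>
      (y $ 5)\<^sup>2 \<le> \<tau>\<^sup>2 * (1 - ((y $ 1)\<^sup>2 + (y $ 2)\<^sup>2 + (y $ 3)\<^sup>2 + (y $ 4)\<^sup>2))" if y: "norm y < 1" for y
  proof -
    define d where "d = 1 - (norm y)\<^sup>2"
    have d: "0 < d" using y by (simp add: d_def abs_square_less_1)
    have ny: "(norm y)\<^sup>2 = (y $ 1)\<^sup>2 + (y $ 2)\<^sup>2 + (y $ 3)\<^sup>2 + (y $ 4)\<^sup>2 + (y $ 5)\<^sup>2"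
      unfolding dot_square_norm[symmetric] by (simp add: inner_vec_def sum_5 power2_eq_square)
    let ?x = "(1 / sqrt d) *\<^sub>R frame (1, y)"
    have im: "frame ` span {(1, y)} = span {?x}"
      using linear_span_image[OF linear_frame, of "{(1, y)}"] span_singleton_eq[of "1 / sqrt d" "frame (1, y)"] d by simp
    have "mink (frame (1, y)) (frame (1, y)) = - d"
      by (simp add: mink_frame) (simp add: mink_def dot_square_norm d_def)
    then have mx: "mink ?x ?x = - 1"
      using d by (simp add: mink_simps)
    have e: "(mink ?x e5)\<^sup>2 = (y $ 5)\<^sup>2 / d"
      using d by (simp add: mink_simps frame_e power_divide)
    have "frame ` span {(1, y)} \<in> opt_hyperball b \<longleftrightarrow> arcosh (sqrt (1 + (mink ?x e5)\<^sup>2)) \<le> artanh \<tau>"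
      unfolding im opt_hyperball_def opt_height_eq by (rule hyperball_iff[OF mx])
    also have "\<dots> \<longleftrightarrow> (mink ?x e5)\<^sup>2 \<le> \<tau>\<^sup>2 * (1 + (mink ?x e5)\<^sup>2)"
      using c_pos(5) tau_less_1 by (intro arcosh_le_artanh_iff) simp_all
    also have "\<dots> \<longleftrightarrow> (y $ 5)\<^sup>2 \<le> \<tau>\<^sup>2 * (d + (y $ 5)\<^sup>2)"
      unfolding e using d by (simp add: field_simps)
    also have "d + (y $ 5)\<^sup>2 = 1 - ((y $ 1)\<^sup>2 + (y $ 2)\<^sup>2 + (y $ 3)\<^sup>2 + (y $ 4)\<^sup>2)"
      by (simp add: d_def ny)
    finally show ?thesis .
  qed
  note * = this
  show ?thesis
    unfolding klein_chart_def mem_Collect_eq Int_iff set_eq_iff using * by blast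
qed

end

section \<open>Series for the volumes\<close>

text \<open>The polynomials \<open>iter_poly\<close> form a family closed under replacing B by B +
  x^2 and integrating y from 0 to c x. The factorials turn the binomial expansion into a
  convolution, so that such a step acts on the coefficients alone; that action is
  \<open>iter_coeff\<close>.\<close>

definition iter_coeff :: "real \<Rightarrow> nat \<Rightarrow> (nat \<Rightarrow> real) \<Rightarrow> nat \<Rightarrow> real" where
  "iter_coeff c d a n = c ^ (2 * n + d + 1) / real (2 * n + d + 1) * (\<Sum>m\<le>n. a m / fact (n - m))"

definition iter_poly :: "(nat \<Rightarrow> real) \<Rightarrow> nat \<Rightarrow> nat \<Rightarrow> real \<Rightarrow> real \<Rightarrow> real" where
  "iter_poly a d k B y = (\<Sum>m\<le>k. (B + y\<^sup>2) ^ (k - m) / fact (k - m) * (a m * y ^ (2 * m + d)))"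

lemma binomial_div_fact:
  "(B + z) ^ k / fact k = (\<Sum>j\<le>k. B ^ (k - j) / fact (k - j) * (z ^ j / fact j))" for B z :: real
proof -
  have "(B + z) ^ k = (\<Sum>j\<le>k. of_nat (k choose j) * z ^ j * B ^ (k - j))"
    by (subst add.commute) (rule binomial_ring)
  also have "\<dots> / fact k = (\<Sum>j\<le>k. B ^ (k - j) / fact (k - j) * (z ^ j / fact j))"
    unfolding sum_divide_distrib by (intro sum.cong) (auto simp: binomial_fact ac_simps)
  finally show ?thesis .
qed

lemma DERIV_power_Suc_divide: "DERIV (\<lambda>y. y ^ Suc m / real (Suc m)) y :> y ^ m"
proof -
  have "DERIV (\<lambda>y. y ^ Suc m / real (Suc m)) y :> real (Suc m) * y ^ (Suc m - Suc 0) / real (Suc m)"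
    by (intro DERIV_cdivide DERIV_pow)
  then show ?thesis by (simp del: of_nat_Suc)
qed

lemma iter_poly_expand:
  "iter_poly a d k B y = (\<Sum>n\<le>k. B ^ (k - n) / fact (k - n) * (\<Sum>m\<le>n. a m / fact (n - m)) * y ^ (2 * n + d))"
proof -
  let ?g = "\<lambda>m j. B ^ (k - (m + j)) / fact (k - (m + j)) * (a m / fact j) * y ^ (2 * (m + j) + d)"
  have "iter_poly a d k B y = (\<Sum>m\<le>k. \<Sum>j\<le>k - m. ?g m j)"
    unfolding iter_poly_def binomial_div_fact[of B "y\<^sup>2"] sum_distrib_right
    by (intro sum.cong) (auto simp: power_add power_mult[symmetric] algebra_simps)
  also have "\<dots> = (\<Sum>(m, j)\<in>(SIGMA m:{..k}. {..k - m}). ?g m j)"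
    by (rule sum.Sigma) auto
  also have "(SIGMA m:{..k}. {..k - m}) = {(m, j). m + j \<le> k}"
    by auto
  also have "(\<Sum>(m, j)\<in>{(m, j). m + j \<le> k}. ?g m j) = (\<Sum>n\<le>k. \<Sum>m\<le>n. ?g m (n - m))"
    by (rule sum.triangle_reindex_eq)
  also have "\<dots> = (\<Sum>n\<le>k. B ^ (k - n) / fact (k - n) * (\<Sum>m\<le>n. a m / fact (n - m)) * y ^ (2 * n + d))"
    unfolding sum_distrib_left sum_distrib_right by (intro sum.cong) auto
  finally show ?thesis .
qed

lemma nn_integral_iter_poly:
  assumes c: "0 \<le> c" "0 \<le> x" and B: "0 \<le> B" and a: "\<And>m. 0 \<le> a m"
  shows "(\<integral>\<^sup>+y. ennreal (iter_poly a d k (B + x\<^sup>2) y) * indicator {0..c * x} y \<partial>lborel)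
     = ennreal (iter_poly (iter_coeff c d a) (d + 1) k B x)"
proof -
  let ?s = "\<lambda>n. (B + x\<^sup>2) ^ (k - n) / fact (k - n) * (\<Sum>m\<le>n. a m / fact (n - m))"
  define F where "F y = (\<Sum>n\<le>k. ?s n * (y ^ (2 * n + d + 1) / real (2 * n + d + 1)))" for y
  have D: "DERIV F y :> iter_poly a d k (B + x\<^sup>2) y" for y
    unfolding F_def iter_poly_expand
  proof (rule DERIV_sum)
    fix n assume "n \<in> {..k}"
    have "DERIV (\<lambda>y. y ^ (2 * n + d + 1) / real (2 * n + d + 1)) y :> y ^ (2 * n + d)"
      using DERIV_power_Suc_divide[of "2 * n + d" y] by simp
    then show "DERIV (\<lambda>y. ?s n * (y ^ (2 * n + d + 1) / real (2 * n + d + 1))) y :> ?s n * y ^ (2 * n + d)"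
      by (rule DERIV_cmult)
  qed
  have nn: "0 \<le> iter_poly a d k (B + x\<^sup>2) y" if "0 \<le> y" for y
    unfolding iter_poly_def using that a B by (intro sum_nonneg) auto
  have "iter_poly a d k (B + x\<^sup>2) \<in> borel_measurable borel"
    unfolding iter_poly_def[abs_def] by measurable
  then have "(\<integral>\<^sup>+y. ennreal (iter_poly a d k (B + x\<^sup>2) y) * indicator {0..c * x} y \<partial>lborel) = ennreal (F (c * x) - F 0)"
    using nn D c by (intro nn_integral_FTC_Icc) auto
  also have "F 0 = 0" by (simp add: F_def)
  also have "F (c * x) - 0 = iter_poly (iter_coeff c d a) (d + 1) k B x"
    unfolding F_def iter_poly_def iter_coeff_def
    by (simp add: power_mult_distrib mult_ac)
  finally show ?thesis .
qed

lemma iter_coeff_nonneg: "0 \<le> c \<Longrightarrow> (\<And>m. 0 \<le> a m) \<Longrightarrow> 0 \<le> iter_coeff c d a n"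
  unfolding iter_coeff_def by (intro mult_nonneg_nonneg sum_nonneg) auto

text \<open>The integral of (y2^2 + y3^2 + y4^2)^k over the slice y1 = 1 of the base simplex cone,
  built by three integration steps from the innermost variable outwards.\<close>

definition moment :: "real \<Rightarrow> real \<Rightarrow> real \<Rightarrow> nat \<Rightarrow> real" where
  "moment c2 c3 c4 k = fact k * iter_coeff c2 2 (iter_coeff c3 1 (iter_coeff c4 0 (\<lambda>m. if m = 0 then 1 else 0))) k"

lemma moment_nonneg: "0 \<le> c2 \<Longrightarrow> 0 \<le> c3 \<Longrightarrow> 0 \<le> c4 \<Longrightarrow> 0 \<le> moment c2 c3 c4 k"
  unfolding moment_def by (intro mult_nonneg_nonneg iter_coeff_nonneg) auto

lemma nn_integral_moment:
  assumes "0 \<le> c2" "0 \<le> c3" "0 \<le> c4" "0 \<le> x"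
  shows "(\<integral>\<^sup>+u. (\<integral>\<^sup>+v. (\<integral>\<^sup>+w. ennreal ((u\<^sup>2 + v\<^sup>2 + w\<^sup>2) ^ k) * indicator {0..c4 * v} w \<partial>lborel)
      * indicator {0..c3 * u} v \<partial>lborel) * indicator {0..c2 * x} u \<partial>lborel)
    = ennreal (moment c2 c3 c4 k * x ^ (2 * k + 3))"
proof -
  let ?a0 = "\<lambda>m::nat. if m = 0 then 1 else (0::real)"
  let ?a1 = "iter_coeff c4 0 ?a0"
  let ?a2 = "iter_coeff c3 1 ?a1"
  let ?a3 = "iter_coeff c2 2 ?a2"
  have a1: "0 \<le> ?a1 m" and a2: "0 \<le> ?a2 m" for m
    using assms by (auto intro!: iter_coeff_nonneg)
  have w: "(\<integral>\<^sup>+w. ennreal ((u\<^sup>2 + v\<^sup>2 + w\<^sup>2) ^ k) * indicator {0..c4 * v} w \<partial>lborel)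
      = ennreal (fact k) * ennreal (iter_poly ?a1 1 k (u\<^sup>2) v)" if "0 \<le> v" for u v
  proof -
    have P: "iter_poly ?a0 0 k (u\<^sup>2 + v\<^sup>2) w = (u\<^sup>2 + v\<^sup>2 + w\<^sup>2) ^ k / fact k" for w
    proof -
      have "iter_poly ?a0 0 k (u\<^sup>2 + v\<^sup>2) w = (\<Sum>m\<le>k. if m = 0 then (u\<^sup>2 + v\<^sup>2 + w\<^sup>2) ^ k / fact k else 0)"
        unfolding iter_poly_def by (intro sum.cong) auto
      then show ?thesis by simp
    qed
    have "(\<integral>\<^sup>+w. ennreal ((u\<^sup>2 + v\<^sup>2 + w\<^sup>2) ^ k) * indicator {0..c4 * v} w \<partial>lborel)
       = (\<integral>\<^sup>+w. ennreal (fact k) * (ennreal (iter_poly ?a0 0 k (u\<^sup>2 + v\<^sup>2) w) * indicator {0..c4 * v} w) \<partial>lborel)"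
      unfolding P by (intro nn_integral_cong) (auto split: split_indicator simp flip: ennreal_mult)
    also have "\<dots> = ennreal (fact k) * (\<integral>\<^sup>+w. ennreal (iter_poly ?a0 0 k (u\<^sup>2 + v\<^sup>2) w) * indicator {0..c4 * v} w \<partial>lborel)"
      unfolding iter_poly_def by (intro nn_integral_cmult) measurable
    also have "\<dots> = ennreal (fact k) * ennreal (iter_poly ?a1 (0 + 1) k (u\<^sup>2) v)"
      using assms that by (subst nn_integral_iter_poly) auto
    finally show ?thesis by simp
  qed
  have v: "(\<integral>\<^sup>+v. (\<integral>\<^sup>+w. ennreal ((u\<^sup>2 + v\<^sup>2 + w\<^sup>2) ^ k) * indicator {0..c4 * v} w \<partial>lborel)
      * indicator {0..c3 * u} v \<partial>lborel) = ennreal (fact k) * ennreal (iter_poly ?a2 2 k 0 u)" if "0 \<le> u" for u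
  proof -
    have "(\<integral>\<^sup>+v. (\<integral>\<^sup>+w. ennreal ((u\<^sup>2 + v\<^sup>2 + w\<^sup>2) ^ k) * indicator {0..c4 * v} w \<partial>lborel)
      * indicator {0..c3 * u} v \<partial>lborel)
      = (\<integral>\<^sup>+v. ennreal (fact k) * (ennreal (iter_poly ?a1 1 k (0 + u\<^sup>2) v) * indicator {0..c3 * u} v) \<partial>lborel)"
      by (intro nn_integral_cong) (auto split: split_indicator simp: w)
    also have "\<dots> = ennreal (fact k) * (\<integral>\<^sup>+v. ennreal (iter_poly ?a1 1 k (0 + u\<^sup>2) v) * indicator {0..c3 * u} v \<partial>lborel)"
      unfolding iter_poly_def by (intro nn_integral_cmult) measurable
    also have "\<dots> = ennreal (fact k) * ennreal (iter_poly ?a2 (1 + 1) k 0 u)"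
      using assms that a1 by (subst nn_integral_iter_poly) auto
    finally show ?thesis by (simp add: one_add_one del: One_nat_def)
  qed
  have e: "iter_poly ?a2 2 k 0 u = (\<Sum>m\<le>k. ?a2 m / fact (k - m)) * u ^ (2 * k + 2)" for u
  proof -
    have "iter_poly ?a2 2 k 0 u = (\<Sum>n\<le>k. if n = k then (\<Sum>m\<le>k. ?a2 m / fact (k - m)) * u ^ (2 * k + 2) else 0)"
      unfolding iter_poly_expand by (intro sum.cong) auto
    then show ?thesis by simp
  qed
  let ?S = "\<Sum>m\<le>k. ?a2 m / fact (k - m)"
  have S: "0 \<le> ?S" using a2 by (intro sum_nonneg) auto
  have D: "DERIV (\<lambda>u. ?S * (u ^ (2 * k + 3) / real (2 * k + 3))) u :> ?S * u ^ (2 * k + 2)" for u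
  proof -
    have "DERIV (\<lambda>u. u ^ (2 * k + 3) / real (2 * k + 3)) u :> u ^ (2 * k + 2)"
      using DERIV_power_Suc_divide[of "2 * k + 2" u] by (simp add: eval_nat_numeral)
    then show ?thesis by (rule DERIV_cmult)
  qed
  have "(\<integral>\<^sup>+u. (\<integral>\<^sup>+v. (\<integral>\<^sup>+w. ennreal ((u\<^sup>2 + v\<^sup>2 + w\<^sup>2) ^ k) * indicator {0..c4 * v} w \<partial>lborel)
      * indicator {0..c3 * u} v \<partial>lborel) * indicator {0..c2 * x} u \<partial>lborel)
    = (\<integral>\<^sup>+u. ennreal (fact k) * (ennreal (?S * u ^ (2 * k + 2)) * indicator {0..c2 * x} u) \<partial>lborel)"
    unfolding e[symmetric] by (intro nn_integral_cong) (auto split: split_indicator simp: v)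
  also have "\<dots> = ennreal (fact k) * (\<integral>\<^sup>+u. ennreal (?S * u ^ (2 * k + 2)) * indicator {0..c2 * x} u \<partial>lborel)"
    by (intro nn_integral_cmult) measurable
  also have "(\<integral>\<^sup>+u. ennreal (?S * u ^ (2 * k + 2)) * indicator {0..c2 * x} u \<partial>lborel)
      = ennreal (?S * ((c2 * x) ^ (2 * k + 3) / real (2 * k + 3)))"
  proof -
    have "(\<integral>\<^sup>+u. ennreal (?S * u ^ (2 * k + 2)) * indicator {0..c2 * x} u \<partial>lborel)
      = ennreal (?S * ((c2 * x) ^ (2 * k + 3) / real (2 * k + 3)) - ?S * (0 ^ (2 * k + 3) / real (2 * k + 3)))"
      using S assms D by (intro nn_integral_FTC_Icc) auto
    moreover have "(0::real) ^ (2 * k + 3) = 0" by simp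
    ultimately show ?thesis by (simp only: div_0 mult_zero_right diff_zero)
  qed
  also have "ennreal (fact k) * \<dots> = ennreal (fact k * (?S * ((c2 * x) ^ (2 * k + 3) / real (2 * k + 3))))"
    using S assms by (intro ennreal_mult[symmetric]) auto
  also have "fact k * (?S * ((c2 * x) ^ (2 * k + 3) / real (2 * k + 3))) = moment c2 c3 c4 k * x ^ (2 * k + 3)"
    unfolding moment_def iter_coeff_def[of c2 2] by (simp add: power_mult_distrib eval_nat_numeral mult_ac)
  finally show ?thesis .
qed

section \<open>The binomial series with a one-term bound for its tail\<close>

definition rising :: "real \<Rightarrow> nat \<Rightarrow> real" where
  "rising s k = pochhammer s k / fact k"

lemma rising_Suc: "rising s (Suc k) = rising s k * ((s + real k) / real (Suc k))"
  by (simp add: rising_def pochhammer_Suc)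

lemma rising_nonneg: "0 \<le> s \<Longrightarrow> 0 \<le> rising s k"
  by (induction k) (auto simp: rising_Suc, simp add: rising_def)

text \<open>For s >= 1 the growth factors (s + j) / (1 + j) decrease in j. As a consequence a tail
  of the series is at most its first term times the whole series.\<close>

lemma rising_add_le:
  assumes "1 \<le> s" shows "rising s (n + j) \<le> rising s n * rising s j"
proof (induction j)
  case 0
  then show ?case by (simp add: rising_def)
next
  case (Suc j)
  have "(s + real (n + j)) / real (Suc (n + j)) \<le> (s + real j) / real (Suc j)"
  proof -
    have "(s + real (n + j)) * real (Suc j) \<le> (s + real j) * real (Suc (n + j))"
      using assms mult_left_mono[of 1 s "real n"] by (simp add: algebra_simps)
    then show ?thesis by (simp add: divide_le_eq le_divide_eq del: of_nat_Suc)
  qed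
  then have "rising s (n + j) * ((s + real (n + j)) / real (Suc (n + j))) \<le> (rising s n * rising s j) * ((s + real j) / real (Suc j))"
    using Suc assms by (intro mult_mono) (auto intro!: mult_nonneg_nonneg rising_nonneg)
  then show ?case by (simp only: add_Suc_right rising_Suc mult.assoc)
qed

lemma one_minus_powr_bounds:
  assumes s: "1 \<le> s" and x: "0 \<le> x" "x < 1"
  shows "(\<Sum>k<n. rising s k * x ^ k) \<le> (1 - x) powr (- s)"
    and "(1 - x) powr (- s) \<le> (\<Sum>k<n. rising s k * x ^ k) + rising s n * x ^ n * (1 - x) powr (- s)"
proof -
  have term_eq: "((- s) gchoose k) * (- x) ^ k = rising s k * x ^ k" for k
  proof -
    have "((- s) gchoose k) = (- 1) ^ k * rising s k"
      by (simp add: gbinomial_pochhammer rising_def)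
    moreover have "(- x) ^ k = (- 1) ^ k * x ^ k"
      by (rule power_minus)
    ultimately have "((- s) gchoose k) * (- x) ^ k = ((- 1) ^ k * (- 1) ^ k) * (rising s k * x ^ k)"
      by simp
    then show ?thesis by (simp flip: power_mult_distrib)
  qed
  have "(\<lambda>k. ((- s) gchoose k) * (- x) ^ k) sums (1 + (- x)) powr (- s)"
    using x by (intro gen_binomial_real) auto
  then have sums: "(\<lambda>k. rising s k * x ^ k) sums (1 - x) powr (- s)"
    unfolding term_eq by simp
  then have summ: "summable (\<lambda>k. rising s k * x ^ k)" and val: "(\<Sum>k. rising s k * x ^ k) = (1 - x) powr (- s)"
    by (auto simp: sums_iff)
  have nn: "0 \<le> rising s k * x ^ k" for k
    using s x by (intro mult_nonneg_nonneg rising_nonneg) auto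
  show "(\<Sum>k<n. rising s k * x ^ k) \<le> (1 - x) powr (- s)"
    unfolding val[symmetric] using nn by (intro sum_le_suminf summ) auto
  have "(1 - x) powr (- s) = (\<Sum>k. rising s (k + n) * x ^ (k + n)) + (\<Sum>k<n. rising s k * x ^ k)"
    unfolding val[symmetric] by (rule suminf_split_initial_segment[OF summ])
  also have "(\<Sum>k. rising s (k + n) * x ^ (k + n)) \<le> (\<Sum>k. rising s n * x ^ n * (rising s k * x ^ k))"
  proof (rule suminf_le)
    show "summable (\<lambda>k. rising s (k + n) * x ^ (k + n))"
      using summ by (subst summable_iff_shift)
    show "summable (\<lambda>k. rising s n * x ^ n * (rising s k * x ^ k))"
      by (rule summable_mult[OF summ])
    fix k
    have "rising s (n + k) * x ^ (n + k) \<le> (rising s n * rising s k) * x ^ (n + k)"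
      using rising_add_le[OF s] x by (intro mult_right_mono) auto
    then show "rising s (k + n) * x ^ (k + n) \<le> rising s n * x ^ n * (rising s k * x ^ k)"
      by (simp add: power_add ac_simps)
  qed
  also have "(\<Sum>k. rising s n * x ^ n * (rising s k * x ^ k)) = rising s n * x ^ n * (1 - x) powr (- s)"
    unfolding val[symmetric] by (rule suminf_mult[OF summ])
  finally show "(1 - x) powr (- s) \<le> (\<Sum>k<n. rising s k * x ^ k) + rising s n * x ^ n * (1 - x) powr (- s)"
    by simp
qed

text \<open>The preceding bounds for x = z / a, made homogeneous. Since \<open>\<rho>\<close> bounds
  x uniformly, the remainder is a constant times the next term and can be integrated like the other
  terms.\<close>

lemma diff_powr_bounds:
  assumes s: "1 \<le> s" and a: "0 < a" and z: "0 \<le> z" "z \<le> \<rho> * a" and \<rho>: "\<rho> < 1"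
  shows "(\<Sum>k<n. rising s k * a powr (- s - real k) * z ^ k) \<le> (a - z) powr (- s)"
    and "(a - z) powr (- s) \<le> (\<Sum>k<n. rising s k * a powr (- s - real k) * z ^ k)
           + rising s n * (1 - \<rho>) powr (- s) * a powr (- s - real n) * z ^ n"
proof -
  define x where "x = z / a"
  have x: "0 \<le> x" "x \<le> \<rho>"
    using a z by (auto simp: x_def field_simps)
  then have "x < 1" using \<rho> by simp
  note x = x this
  have az: "(a - z) powr (- s) = a powr (- s) * (1 - x) powr (- s)"
  proof -
    have "a - z = a * (1 - x)" using a by (simp add: x_def field_simps)
    then show ?thesis using a x by (simp add: powr_mult)
  qed
  have ak: "a powr (- s - real k) * z ^ k = a powr (- s) * x ^ k" for k
    using a by (simp add: x_def powr_diff powr_realpow power_divide)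
  have sum_eq: "(\<Sum>k<n. rising s k * a powr (- s - real k) * z ^ k) = a powr (- s) * (\<Sum>k<n. rising s k * x ^ k)"
    unfolding sum_distrib_left by (rule sum.cong[OF HOL.refl]) (simp only: mult.assoc ak, simp add: ac_simps)
  show "(\<Sum>k<n. rising s k * a powr (- s - real k) * z ^ k) \<le> (a - z) powr (- s)"
    unfolding sum_eq az using one_minus_powr_bounds(1)[OF s x(1,3)] by (intro mult_left_mono) auto
  have "(1 - x) powr (- s) \<le> (1 - \<rho>) powr (- s)"
    using x \<rho> s by (intro powr_mono2') auto
  then have "rising s n * x ^ n * (1 - x) powr (- s) \<le> rising s n * x ^ n * (1 - \<rho>) powr (- s)"
    using x s rising_nonneg[of s n] by (intro mult_left_mono) auto
  with one_minus_powr_bounds(2)[OF s x(1,3), of n]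
  have "(1 - x) powr (- s) \<le> (\<Sum>k<n. rising s k * x ^ k) + rising s n * x ^ n * (1 - \<rho>) powr (- s)" by linarith
  then have "a powr (- s) * (1 - x) powr (- s) \<le> a powr (- s) * ((\<Sum>k<n. rising s k * x ^ k) + rising s n * x ^ n * (1 - \<rho>) powr (- s))"
    by (intro mult_left_mono) auto
  also have "\<dots> = (\<Sum>k<n. rising s k * a powr (- s - real k) * z ^ k) + rising s n * (1 - \<rho>) powr (- s) * (a powr (- s) * x ^ n)"
    unfolding sum_eq by (simp add: algebra_simps)
  finally show "(a - z) powr (- s) \<le> (\<Sum>k<n. rising s k * a powr (- s - real k) * z ^ k)
           + rising s n * (1 - \<rho>) powr (- s) * a powr (- s - real n) * z ^ n"
    unfolding az ak[symmetric] by (simp add: mult.assoc)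
qed

section \<open>Iterated integration over the base simplex\<close>

type_synonym real4 = "real \<times> real \<times> real \<times> real"

text \<open>The height y5 is put first, as the outer variable; the other four coordinates describe
  the base simplex.\<close>

definition coords5 :: "real \<times> real4 \<Rightarrow> real^5" where
  "coords5 = (\<lambda>(y5, y1, y2, y3, y4). \<chi> i. if i = 1 then y1 else if i = 2 then y2 else if i = 3 then y3 else if i = 4 then y4 else y5)"

lemma coords5_nth:
  "coords5 (y5, y1, y2, y3, y4) $ 1 = y1" "coords5 (y5, y1, y2, y3, y4) $ 2 = y2"
  "coords5 (y5, y1, y2, y3, y4) $ 3 = y3" "coords5 (y5, y1, y2, y3, y4) $ 4 = y4"
  "coords5 (y5, y1, y2, y3, y4) $ 5 = y5"
  by (simp_all add: coords5_def)

lemma linear_coords5: "linear coords5"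
  by (rule linearI) (auto simp: coords5_def vec_eq_iff)

lemma distr_coords5: "distr lborel borel coords5 = lborel"
proof (rule distr_lborel_basis[OF linear_coords5])
  have ax: "coords5 (1, 0) = axis 5 1" "coords5 (0, 1, 0) = axis 1 1" "coords5 (0, 0, 1, 0) = axis 2 1"
    "coords5 (0, 0, 0, 1, 0) = axis 3 1" "coords5 (0, 0, 0, 0, 1) = axis 4 1"
    using exhaust_5 by (auto simp: coords5_def axis_def vec_eq_iff zero_prod_def)
  have B: "Basis = {(1, 0), (0, 1, 0), (0, 0, 1, 0), (0, 0, 0, 1, 0), (0, 0, 0, 0, 1) :: real \<times> real4}"
    by (auto simp: Basis_prod_def)
  have "coords5 ` Basis = {axis 5 1, axis 1 1, axis 2 1, axis 3 1, axis 4 1}"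
    by (simp only: B image_insert image_empty ax)
  also have "\<dots> = Basis"
    by (auto simp: Basis_vec_def UNIV_5)
  finally have "coords5 ` Basis = Basis" .
  moreover have "inj_on coords5 Basis"
    by (rule eq_card_imp_inj_on) (simp_all add: calculation)
  ultimately show "bij_betw coords5 Basis Basis"
    by (simp add: bij_betw_def)
qed

lemma nn_integral_lborel_prod:
  fixes f :: "'a::euclidean_space \<times> 'b::euclidean_space \<Rightarrow> ennreal"
  assumes "f \<in> borel_measurable borel"
  shows "(\<integral>\<^sup>+z. f z \<partial>lborel) = (\<integral>\<^sup>+x. \<integral>\<^sup>+y. f (x, y) \<partial>lborel \<partial>lborel)"
proof -
  have "f \<in> borel_measurable (lborel \<Otimes>\<^sub>M lborel)" using assms by (simp add: lborel_prod)
  from lborel.nn_integral_fst[OF this] show ?thesis by (simp add: lborel_prod)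
qed

lemma nn_integral_coords5:
  assumes [measurable]: "f \<in> borel_measurable borel"
  shows "(\<integral>\<^sup>+y. f y \<partial>lborel) = (\<integral>\<^sup>+t. \<integral>\<^sup>+z. f (coords5 (t, z)) \<partial>lborel \<partial>lborel)"
proof -
  have [measurable]: "coords5 \<in> borel_measurable borel"
    using linear_coords5 by (intro borel_measurable_continuous_onI linear_continuous_on) (simp add: linear_conv_bounded_linear)
  have "(\<integral>\<^sup>+y. f y \<partial>lborel) = (\<integral>\<^sup>+y. f y \<partial>distr lborel borel coords5)"
    by (simp add: distr_coords5)
  also have "\<dots> = (\<integral>\<^sup>+z. f (coords5 z) \<partial>lborel)"
    by (rule nn_integral_distr) auto
  also have "\<dots> = (\<integral>\<^sup>+t. \<integral>\<^sup>+z. f (coords5 (t, z)) \<partial>lborel \<partial>lborel)"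
    by (rule nn_integral_lborel_prod) measurable
  finally show ?thesis .
qed


definition simplex4 :: "real \<Rightarrow> real \<Rightarrow> real \<Rightarrow> real \<Rightarrow> real4 set" where
  "simplex4 c1 c2 c3 c4 = {(y1, y2, y3, y4). y1 \<le> c1 \<and> y2 \<le> c2 * y1 \<and> y3 \<le> c3 * y2 \<and> y4 \<le> c4 * y3 \<and> 0 \<le> y4}"

definition tail_sq :: "real4 \<Rightarrow> real" where
  "tail_sq = (\<lambda>(y1, y2, y3, y4). y2\<^sup>2 + y3\<^sup>2 + y4\<^sup>2)"

lemma tail_sq_nonneg: "0 \<le> tail_sq z"
  by (auto simp: tail_sq_def split: prod.split)

lemma borel_simplex4 [measurable]: "simplex4 c1 c2 c3 c4 \<in> sets borel"
proof -
  have "simplex4 c1 c2 c3 c4 = {z \<in> space borel. fst z \<le> c1 \<and> fst (snd z) \<le> c2 * fst z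
     \<and> fst (snd (snd z)) \<le> c3 * fst (snd z) \<and> snd (snd (snd z)) \<le> c4 * fst (snd (snd z)) \<and> 0 \<le> snd (snd (snd z))}"
    by (auto simp: simplex4_def)
  also have "\<dots> \<in> sets borel"
    unfolding borel_prod[symmetric] by measurable
  finally show ?thesis .
qed

lemma borel_tail_sq [measurable]: "tail_sq \<in> borel_measurable borel"
  unfolding tail_sq_def split_def borel_prod[symmetric] by measurable

lemma borel_measurable_indicator_Icc [measurable (raw)]:
  fixes f h :: "'a \<Rightarrow> real"
  assumes [measurable]: "f \<in> borel_measurable M" "h \<in> borel_measurable M"
  shows "(\<lambda>x. indicator {0..h x} (f x) :: ennreal) \<in> borel_measurable M"
  unfolding indicator_def atLeastAtMost_iff by measurable

lemma nn_integral_simplex4: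
  assumes c: "0 < c1" "0 < c2" "0 < c3" "0 < c4" and [measurable]: "g \<in> borel_measurable borel"
  shows "(\<integral>\<^sup>+z. g (fst z) * ennreal (tail_sq z ^ k) * indicator (simplex4 c1 c2 c3 c4) z \<partial>lborel)
    = (\<integral>\<^sup>+y. g y * ennreal (moment c2 c3 c4 k * y ^ (2 * k + 3)) * indicator {0..c1} y \<partial>lborel)"
proof -
  define f where "f z = g (fst z) * ennreal (tail_sq z ^ k) * indicator (simplex4 c1 c2 c3 c4) z" for z
  have [measurable]: "f \<in> borel_measurable borel"
    unfolding f_def[abs_def] borel_prod[symmetric] using borel_tail_sq borel_simplex4 unfolding borel_prod[symmetric] by measurable
  have ind: "indicator (simplex4 c1 c2 c3 c4) (y1, y2, y3, y4)
      = (indicator {0..c1} y1 * indicator {0..c2 * y1} y2 * indicator {0..c3 * y2} y3 * indicator {0..c4 * y3} y4 :: ennreal)"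
    for y1 y2 y3 y4
  proof (cases "(y1, y2, y3, y4) \<in> simplex4 c1 c2 c3 c4")
    case True
    then have 4: "0 \<le> y4" "y4 \<le> c4 * y3" "y3 \<le> c3 * y2" "y2 \<le> c2 * y1" "y1 \<le> c1" by (auto simp: simplex4_def)
    have "0 \<le> c4 * y3" using 4 by linarith
    then have y3: "0 \<le> y3" using c by (simp add: zero_le_mult_iff)
    then have "0 \<le> c3 * y2" using 4 by linarith
    then have y2: "0 \<le> y2" using c by (simp add: zero_le_mult_iff)
    then have "0 \<le> c2 * y1" using 4 by linarith
    then have "0 \<le> y1" using c by (simp add: zero_le_mult_iff)
    then show ?thesis using True 4 y3 y2 by simp
  next
    case False
    then show ?thesis by (auto simp: simplex4_def split: split_indicator)
  qed
  have "(\<integral>\<^sup>+z. f z \<partial>lborel) = (\<integral>\<^sup>+y1. \<integral>\<^sup>+y2. \<integral>\<^sup>+y3. \<integral>\<^sup>+y4. f (y1, y2, y3, y4) \<partial>lborel \<partial>lborel \<partial>lborel \<partial>lborel)"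
  proof -
    have "(\<lambda>z. f (y1, z)) \<in> borel_measurable borel" "(\<lambda>z. f (y1, y2, z)) \<in> borel_measurable borel" for y1 y2
      by measurable
    then show ?thesis by (simp add: nn_integral_lborel_prod)
  qed
  also have "\<dots> = (\<integral>\<^sup>+y. g y * ennreal (moment c2 c3 c4 k * y ^ (2 * k + 3)) * indicator {0..c1} y \<partial>lborel)"
  proof (rule nn_integral_cong)
    fix y1
    show "(\<integral>\<^sup>+y2. \<integral>\<^sup>+y3. \<integral>\<^sup>+y4. f (y1, y2, y3, y4) \<partial>lborel \<partial>lborel \<partial>lborel)
      = g y1 * ennreal (moment c2 c3 c4 k * y1 ^ (2 * k + 3)) * indicator {0..c1} y1"
    proof (cases "y1 \<in> {0..c1}")
      case False
      then show ?thesis by (simp add: f_def ind)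
    next
      case True
      have "(\<integral>\<^sup>+y2. \<integral>\<^sup>+y3. \<integral>\<^sup>+y4. f (y1, y2, y3, y4) \<partial>lborel \<partial>lborel \<partial>lborel)
        = (\<integral>\<^sup>+u. (\<integral>\<^sup>+v. (\<integral>\<^sup>+w. g y1 * (ennreal ((u\<^sup>2 + v\<^sup>2 + w\<^sup>2) ^ k) * indicator {0..c4 * v} w) \<partial>lborel)
           * indicator {0..c3 * u} v \<partial>lborel) * indicator {0..c2 * y1} u \<partial>lborel)"
      proof (rule nn_integral_cong)
        fix u
        have "(\<integral>\<^sup>+y4. f (y1, u, v, y4) \<partial>lborel)
          = (\<integral>\<^sup>+w. g y1 * (ennreal ((u\<^sup>2 + v\<^sup>2 + w\<^sup>2) ^ k) * indicator {0..c4 * v} w) \<partial>lborel) * indicator {0..c3 * u} v"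
          if "u \<in> {0..c2 * y1}" for v
          using True that by (cases "v \<in> {0..c3 * u}") (simp_all add: f_def ind tail_sq_def mult_ac)
        then show "(\<integral>\<^sup>+y3. \<integral>\<^sup>+y4. f (y1, u, y3, y4) \<partial>lborel \<partial>lborel)
          = (\<integral>\<^sup>+v. (\<integral>\<^sup>+w. g y1 * (ennreal ((u\<^sup>2 + v\<^sup>2 + w\<^sup>2) ^ k) * indicator {0..c4 * v} w) \<partial>lborel)
             * indicator {0..c3 * u} v \<partial>lborel) * indicator {0..c2 * y1} u"
          by (cases "u \<in> {0..c2 * y1}") (simp_all add: f_def ind)
      qed
      also have "\<dots> = (\<integral>\<^sup>+u. (\<integral>\<^sup>+v. g y1 * ((\<integral>\<^sup>+w. ennreal ((u\<^sup>2 + v\<^sup>2 + w\<^sup>2) ^ k) * indicator {0..c4 * v} w \<partial>lborel)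
           * indicator {0..c3 * u} v) \<partial>lborel) * indicator {0..c2 * y1} u \<partial>lborel)"
        by (subst nn_integral_cmult) (simp_all add: mult.assoc)
      also have "\<dots> = (\<integral>\<^sup>+u. g y1 * ((\<integral>\<^sup>+v. ((\<integral>\<^sup>+w. ennreal ((u\<^sup>2 + v\<^sup>2 + w\<^sup>2) ^ k) * indicator {0..c4 * v} w \<partial>lborel)
           * indicator {0..c3 * u} v) \<partial>lborel) * indicator {0..c2 * y1} u) \<partial>lborel)"
        by (subst nn_integral_cmult, measurable) (simp_all add: mult.assoc)
      also have "\<dots> = g y1 * (\<integral>\<^sup>+u. (\<integral>\<^sup>+v. ((\<integral>\<^sup>+w. ennreal ((u\<^sup>2 + v\<^sup>2 + w\<^sup>2) ^ k) * indicator {0..c4 * v} w \<partial>lborel)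
           * indicator {0..c3 * u} v) \<partial>lborel) * indicator {0..c2 * y1} u \<partial>lborel)"
        by (rule nn_integral_cmult) measurable
      also have "\<dots> = g y1 * ennreal (moment c2 c3 c4 k * y1 ^ (2 * k + 3))"
        using nn_integral_moment[of c2 c3 c4 y1 k] c True by simp
      finally show ?thesis using True by simp
    qed
  qed
  finally show ?thesis by (simp add: f_def)
qed

text \<open>The value of \<open>tail_sq\<close> at y1 = 1 when every further coordinate attains its
  upper bound, hence its maximum on that slice.\<close>

definition spread :: "real \<Rightarrow> real \<Rightarrow> real \<Rightarrow> real" where
  "spread c2 c3 c4 = c2\<^sup>2 * (1 + c3\<^sup>2 * (1 + c4\<^sup>2))"

lemma simplex4_bounds:
  assumes c: "0 < c2" "0 < c3" "0 < c4" and z: "(y1, y2, y3, y4) \<in> simplex4 c1 c2 c3 c4"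
  shows "0 \<le> y1" "y1 \<le> c1" "tail_sq (y1, y2, y3, y4) \<le> spread c2 c3 c4 * y1\<^sup>2"
proof -
  have 4: "0 \<le> y4" "y4 \<le> c4 * y3" "y3 \<le> c3 * y2" "y2 \<le> c2 * y1" and 1: "y1 \<le> c1"
    using z by (auto simp: simplex4_def)
  have "0 \<le> c4 * y3" using 4 by linarith
  then have y3: "0 \<le> y3" using c by (simp add: zero_le_mult_iff)
  then have "0 \<le> c3 * y2" using 4 by linarith
  then have y2: "0 \<le> y2" using c by (simp add: zero_le_mult_iff)
  then have "0 \<le> c2 * y1" using 4 by linarith
  then show "0 \<le> y1" using c by (simp add: zero_le_mult_iff)
  show "y1 \<le> c1" by (rule 1)
  have "y4\<^sup>2 \<le> c4\<^sup>2 * y3\<^sup>2" "y3\<^sup>2 \<le> c3\<^sup>2 * y2\<^sup>2" "y2\<^sup>2 \<le> c2\<^sup>2 * y1\<^sup>2"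
    using 4 y3 y2 power_mono[of _ _ 2] by (auto simp flip: power_mult_distrib)
  note sq = this
  have "y3\<^sup>2 + y4\<^sup>2 \<le> (1 + c4\<^sup>2) * y3\<^sup>2"
    using sq by (simp add: distrib_right)
  also have "\<dots> \<le> (1 + c4\<^sup>2) * (c3\<^sup>2 * y2\<^sup>2)"
    using sq by (intro mult_left_mono) auto
  finally have "tail_sq (y1, y2, y3, y4) \<le> y2\<^sup>2 + (1 + c4\<^sup>2) * (c3\<^sup>2 * y2\<^sup>2)"
    by (simp add: tail_sq_def)
  also have "\<dots> = (1 + c3\<^sup>2 * (1 + c4\<^sup>2)) * y2\<^sup>2"
    by (simp add: algebra_simps)
  also have "\<dots> \<le> (1 + c3\<^sup>2 * (1 + c4\<^sup>2)) * (c2\<^sup>2 * y1\<^sup>2)"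
    using sq(3) by (intro mult_left_mono) auto
  finally show "tail_sq (y1, y2, y3, y4) \<le> spread c2 c3 c4 * y1\<^sup>2"
    by (simp add: spread_def algebra_simps)
qed

text \<open>The weights let one statement serve the partial sum below the integral and the sum above
  it, whose last term carries the remainder constant.\<close>

lemma nn_integral_weighted_simplex4:
  assumes c: "0 < c1" "0 < c2" "0 < c3" "0 < c4" and K: "finite K"
    and w: "\<And>k. k \<in> K \<Longrightarrow> 0 \<le> w k" and Y0: "\<And>k. k \<in> K \<Longrightarrow> 0 \<le> Y k"
    and Y: "\<And>k. k \<in> K \<Longrightarrow>
      (\<integral>\<^sup>+y. ennreal ((A - y\<^sup>2) powr (- s - real k) * y ^ (2 * k + 3)) * indicator {0..c1} y \<partial>lborel) = ennreal (Y k)"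
  shows "(\<integral>\<^sup>+z. ennreal (\<Sum>k\<in>K. w k * (A - (fst z)\<^sup>2) powr (- s - real k) * tail_sq z ^ k) * indicator (simplex4 c1 c2 c3 c4) z \<partial>lborel)
    = ennreal (\<Sum>k\<in>K. w k * moment c2 c3 c4 k * Y k)"
proof -
  define g where "g k y = ennreal (w k * (A - y\<^sup>2) powr (- s - real k))" for k y
  have [measurable]: "g k \<in> borel_measurable borel" for k
    unfolding g_def[abs_def] by measurable
  have f1: "(\<lambda>z::real4. fst z) \<in> borel_measurable borel"
    unfolding borel_prod[symmetric] by measurable
  have [measurable]: "(\<lambda>z. g k (fst z) * ennreal (tail_sq z ^ k) * indicator (simplex4 c1 c2 c3 c4) z) \<in> borel_measurable lborel" for k
  proof -
    have [measurable]: "(\<lambda>z::real4. g k (fst z)) \<in> borel_measurable lborel"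
      using measurable_compose[OF f1, of "g k" borel] by simp
    show ?thesis by measurable
  qed
  have "(\<integral>\<^sup>+z. ennreal (\<Sum>k\<in>K. w k * (A - (fst z)\<^sup>2) powr (- s - real k) * tail_sq z ^ k) * indicator (simplex4 c1 c2 c3 c4) z \<partial>lborel)
    = (\<integral>\<^sup>+z. (\<Sum>k\<in>K. g k (fst z) * ennreal (tail_sq z ^ k) * indicator (simplex4 c1 c2 c3 c4) z) \<partial>lborel)"
  proof (rule nn_integral_cong)
    fix z
    have "ennreal (\<Sum>k\<in>K. w k * (A - (fst z)\<^sup>2) powr (- s - real k) * tail_sq z ^ k)
      = (\<Sum>k\<in>K. ennreal (w k * (A - (fst z)\<^sup>2) powr (- s - real k) * tail_sq z ^ k))"
      using w tail_sq_nonneg by (intro sum_ennreal[symmetric]) auto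
    also have "\<dots> = (\<Sum>k\<in>K. g k (fst z) * ennreal (tail_sq z ^ k))"
      using w tail_sq_nonneg unfolding g_def by (intro sum.cong) (auto simp: ennreal_mult)
    finally show "ennreal (\<Sum>k\<in>K. w k * (A - (fst z)\<^sup>2) powr (- s - real k) * tail_sq z ^ k) * indicator (simplex4 c1 c2 c3 c4) z
      = (\<Sum>k\<in>K. g k (fst z) * ennreal (tail_sq z ^ k) * indicator (simplex4 c1 c2 c3 c4) z)"
      by (simp add: sum_distrib_right)
  qed
  also have "\<dots> = (\<Sum>k\<in>K. \<integral>\<^sup>+z. g k (fst z) * ennreal (tail_sq z ^ k) * indicator (simplex4 c1 c2 c3 c4) z \<partial>lborel)"
    by (rule nn_integral_sum) measurable
  also have "\<dots> = (\<Sum>k\<in>K. ennreal (w k * moment c2 c3 c4 k * Y k))"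
  proof (rule sum.cong[OF HOL.refl])
    fix k assume k: "k \<in> K"
    have m: "0 \<le> moment c2 c3 c4 k" using c by (intro moment_nonneg) auto
    have "(\<integral>\<^sup>+z. g k (fst z) * ennreal (tail_sq z ^ k) * indicator (simplex4 c1 c2 c3 c4) z \<partial>lborel)
      = (\<integral>\<^sup>+y. g k y * ennreal (moment c2 c3 c4 k * y ^ (2 * k + 3)) * indicator {0..c1} y \<partial>lborel)"
      using c by (intro nn_integral_simplex4) auto
    also have "\<dots> = (\<integral>\<^sup>+y. ennreal (w k * moment c2 c3 c4 k) *
        (ennreal ((A - y\<^sup>2) powr (- s - real k) * y ^ (2 * k + 3)) * indicator {0..c1} y) \<partial>lborel)"
    proof (rule nn_integral_cong)
      fix y
      let ?P = "(A - y\<^sup>2) powr (- s - real k)" and ?y = "y ^ (2 * k + 3)" and ?m = "moment c2 c3 c4 k"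
      have "g k y * ennreal (?m * ?y) = ennreal (w k * ?m) * ennreal (?P * ?y)" if "0 \<le> y"
      proof -
        have "g k y * ennreal (?m * ?y) = ennreal (w k * ?P * (?m * ?y))"
          unfolding g_def by (rule ennreal_mult[symmetric]) (use that w[OF k] m in auto)
        also have "w k * ?P * (?m * ?y) = w k * ?m * (?P * ?y)"
          by (simp only: ac_simps)
        also have "ennreal (w k * ?m * (?P * ?y)) = ennreal (w k * ?m) * ennreal (?P * ?y)"
          by (rule ennreal_mult) (use that w[OF k] m in auto)
        finally show ?thesis .
      qed
      then show "g k y * ennreal (?m * ?y) * indicator {0..c1} y
          = ennreal (w k * ?m) * (ennreal (?P * ?y) * indicator {0..c1} y)"
        by (cases "y \<in> {0..c1}") simp_all
    qed
    also have "\<dots> = ennreal (w k * moment c2 c3 c4 k) * ennreal (Y k)"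
      unfolding Y[OF k, symmetric] by (rule nn_integral_cmult) measurable
    also have "\<dots> = ennreal (w k * moment c2 c3 c4 k * Y k)"
      using w[OF k] m Y0[OF k] by (intro ennreal_mult[symmetric]) auto
    finally show "(\<integral>\<^sup>+z. g k (fst z) * ennreal (tail_sq z ^ k) * indicator (simplex4 c1 c2 c3 c4) z \<partial>lborel)
      = ennreal (w k * moment c2 c3 c4 k * Y k)" .
  qed
  also have "\<dots> = ennreal (\<Sum>k\<in>K. w k * moment c2 c3 c4 k * Y k)"
    using w Y0 c by (intro sum_ennreal mult_nonneg_nonneg moment_nonneg) auto
  finally show ?thesis .
qed

text \<open>The expansion is in \<open>tail_sq\<close> only, with A - y1^2 kept whole; the ratio of
  the two is worst at y1 = c1, where \<open>\<rho>\<close> is required. The cases of interest are A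
  = 1 - t^2, s = 3 for the orthoscheme at height t, and A = 1, s = 5/2 for the base simplex.\<close>

lemma nn_integral_powr_simplex4:
  assumes c: "0 < c1" "0 < c2" "0 < c3" "0 < c4" and s: "1 \<le> s"
    and \<rho>: "\<rho> < 1" "spread c2 c3 c4 * c1\<^sup>2 \<le> \<rho> * (A - c1\<^sup>2)" and A: "c1\<^sup>2 < A"
    and Y0: "\<And>k. 0 \<le> Y k"
    and Y: "\<And>k. (\<integral>\<^sup>+y. ennreal ((A - y\<^sup>2) powr (- s - real k) * y ^ (2 * k + 3)) * indicator {0..c1} y \<partial>lborel) = ennreal (Y k)"
  defines "X \<equiv> \<integral>\<^sup>+z. ennreal ((A - (fst z)\<^sup>2 - tail_sq z) powr (- s)) * indicator (simplex4 c1 c2 c3 c4) z \<partial>lborel"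
  shows "ennreal (\<Sum>k<n. rising s k * moment c2 c3 c4 k * Y k) \<le> X"
    and "X \<le> ennreal ((\<Sum>k<n. rising s k * moment c2 c3 c4 k * Y k) + rising s n * (1 - \<rho>) powr (- s) * moment c2 c3 c4 n * Y n)"
proof -
  let ?S = "simplex4 c1 c2 c3 c4"
  have pos: "0 < A - (fst z)\<^sup>2" "tail_sq z \<le> \<rho> * (A - (fst z)\<^sup>2)" if z: "z \<in> ?S" for z
  proof -
    obtain y1 y2 y3 y4 where zz: "z = (y1, y2, y3, y4)" by (cases z)
    note b = simplex4_bounds[OF c(2-4) z[unfolded zz]]
    have y: "y1\<^sup>2 \<le> c1\<^sup>2" using b by (intro power_mono) auto
    then show "0 < A - (fst z)\<^sup>2" using A by (simp add: zz)
    have sp: "0 \<le> spread c2 c3 c4" by (simp add: spread_def)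
    have "0 \<le> spread c2 c3 c4 * c1\<^sup>2" using sp by simp
    then have "0 \<le> \<rho> * (A - c1\<^sup>2)" using \<rho> by linarith
    then have "0 \<le> \<rho>" using A by (auto simp: zero_le_mult_iff)
    have "tail_sq z \<le> spread c2 c3 c4 * y1\<^sup>2" using b by (simp add: zz)
    also have "\<dots> \<le> spread c2 c3 c4 * c1\<^sup>2" using y sp by (intro mult_left_mono) auto
    also have "\<dots> \<le> \<rho> * (A - c1\<^sup>2)" by (rule \<rho>)
    also have "\<dots> \<le> \<rho> * (A - (fst z)\<^sup>2)" using y \<open>0 \<le> \<rho>\<close> by (intro mult_left_mono) (auto simp: zz)
    finally show "tail_sq z \<le> \<rho> * (A - (fst z)\<^sup>2)" .
  qed
  note bounds = diff_powr_bounds[OF s pos(1) tail_sq_nonneg pos(2) \<rho>(1)]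
  have "ennreal (\<Sum>k\<in>{..<n}. rising s k * moment c2 c3 c4 k * Y k)
    = (\<integral>\<^sup>+z. ennreal (\<Sum>k\<in>{..<n}. rising s k * (A - (fst z)\<^sup>2) powr (- s - real k) * tail_sq z ^ k) * indicator ?S z \<partial>lborel)"
    using s by (intro nn_integral_weighted_simplex4[OF c _ _ Y0 Y, symmetric] rising_nonneg) auto
  also have "\<dots> \<le> X"
    unfolding X_def using bounds(1) by (intro nn_integral_mono) (auto split: split_indicator intro!: ennreal_leI)
  finally show "ennreal (\<Sum>k<n. rising s k * moment c2 c3 c4 k * Y k) \<le> X" .
  define w where "w k = rising s k * (if k = n then (1 - \<rho>) powr (- s) else 1)" for k
  have split: "(\<Sum>k\<in>{..n}. w k * h k) = (\<Sum>k<n. rising s k * h k) + rising s n * (1 - \<rho>) powr (- s) * h n" for h :: "nat \<Rightarrow> real"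
    unfolding lessThan_Suc_atMost[symmetric] sum.lessThan_Suc by (simp add: w_def)
  have "X \<le> (\<integral>\<^sup>+z. ennreal (\<Sum>k\<in>{..n}. w k * (A - (fst z)\<^sup>2) powr (- s - real k) * tail_sq z ^ k) * indicator ?S z \<partial>lborel)"
    unfolding X_def
  proof (rule nn_integral_mono)
    fix z :: real4
    show "ennreal ((A - (fst z)\<^sup>2 - tail_sq z) powr (- s)) * indicator ?S z
      \<le> ennreal (\<Sum>k\<in>{..n}. w k * (A - (fst z)\<^sup>2) powr (- s - real k) * tail_sq z ^ k) * indicator ?S z"
    proof (cases "z \<in> ?S")
      case True
      then show ?thesis
        using bounds(2)[OF True, of n] unfolding mult.assoc split by (simp add: ennreal_leI mult.assoc)
    qed simp
  qed
  also have "\<dots> = ennreal (\<Sum>k\<in>{..n}. w k * moment c2 c3 c4 k * Y k)"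
    using s \<rho> by (intro nn_integral_weighted_simplex4[OF c _ _ Y0 Y]) (auto simp: w_def intro!: mult_nonneg_nonneg rising_nonneg)
  also have "(\<Sum>k\<in>{..n}. w k * moment c2 c3 c4 k * Y k)
    = (\<Sum>k<n. rising s k * moment c2 c3 c4 k * Y k) + rising s n * (1 - \<rho>) powr (- s) * moment c2 c3 c4 n * Y n"
    unfolding mult.assoc split by simp
  finally show "X \<le> ennreal ((\<Sum>k<n. rising s k * moment c2 c3 c4 k * Y k) + rising s n * (1 - \<rho>) powr (- s) * moment c2 c3 c4 n * Y n)" .
qed

section \<open>Closed forms and recursions for the one-dimensional integrals\<close>

lemma quotient_rule_numerator:
  fixes m :: real
  shows "m * p * (m * (A * (q * u))) - (p * y) * (m * (A * - (m * (y * q)))) = (m * m * A * p * q) * (u + y\<^sup>2)"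
  by (simp add: algebra_simps power2_eq_square)

text \<open>The exponents happen to match: in the quotient rule the numerator collapses through (A -
  y^2) + y^2 = A, so the antiderivative is a single quotient.\<close>

lemma nn_integral_radial_cube:
  assumes c: "0 \<le> c" "c\<^sup>2 < A"
  shows "(\<integral>\<^sup>+y. ennreal ((A - y\<^sup>2) powr (- 3 - real k) * y ^ (2 * k + 3)) * indicator {0..c} y \<partial>lborel)
    = ennreal (c ^ (2 * k + 4) / (real (2 * k + 4) * (A * (A - c\<^sup>2) ^ (k + 2))))"
proof -
  have A: "0 < A" using c zero_le_power2[of c] by linarith
  have pos: "0 < A - y\<^sup>2" if "0 \<le> y" "y \<le> c" for y
  proof -
    have "y\<^sup>2 \<le> c\<^sup>2" using that by (intro power_mono) auto
    then show ?thesis using c by simp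
  qed
  define F where "F y = y ^ (2 * k + 4) / (real (2 * k + 4) * (A * (A - y\<^sup>2) ^ (k + 2)))" for y
  have D: "DERIV F y :> (A - y\<^sup>2) powr (- 3 - real k) * y ^ (2 * k + 3)" if y: "0 \<le> y" "y \<le> c" for y
  proof -
    let ?u = "A - y\<^sup>2" and ?m = "real (2 * k + 4)"
    note u = pos[OF y]
    have 1: "DERIV (\<lambda>y. y ^ (2 * k + 4)) y :> ?m * y ^ (2 * k + 3)"
      using DERIV_pow[of "2 * k + 4" y] by (simp add: eval_nat_numeral)
    have "DERIV (\<lambda>y. A - y\<^sup>2) y :> - (2 * y)"
      by (auto intro!: derivative_eq_intros)
    from DERIV_power[OF this, of "k + 2"]
    have "DERIV (\<lambda>y. (A - y\<^sup>2) ^ (k + 2)) y :> real (k + 2) * (- (2 * y) * ?u ^ (k + 1))"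
      by simp
    also have "real (k + 2) * (- (2 * y) * ?u ^ (k + 1)) = - (?m * (y * ?u ^ (k + 1)))"
      by (simp add: distrib_right del: power_Suc)
    finally have 2: "DERIV (\<lambda>y. (A - y\<^sup>2) ^ (k + 2)) y :> - (?m * (y * ?u ^ (k + 1)))" .
    have 3: "DERIV (\<lambda>y. ?m * (A * (A - y\<^sup>2) ^ (k + 2))) y :> ?m * (A * - (?m * (y * ?u ^ (k + 1))))"
      by (intro DERIV_cmult 2)
    have nz: "?m * (A * ?u ^ (k + 2)) \<noteq> 0" using u A by simp
    have "DERIV F y :> (?m * y ^ (2 * k + 3) * (?m * (A * ?u ^ (k + 2))) - y ^ (2 * k + 4) * (?m * (A * - (?m * (y * ?u ^ (k + 1))))))
        / ((?m * (A * ?u ^ (k + 2))) * (?m * (A * ?u ^ (k + 2))))"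
      unfolding F_def by (rule DERIV_divide[OF 1 3 nz])
    also have "(?m * y ^ (2 * k + 3) * (?m * (A * ?u ^ (k + 2))) - y ^ (2 * k + 4) * (?m * (A * - (?m * (y * ?u ^ (k + 1))))))
      = (?m * ?m * A * y ^ (2 * k + 3) * ?u ^ (k + 1)) * (?u + y\<^sup>2)"
    proof -
      have 1: "?u ^ (k + 2) = ?u ^ (k + 1) * ?u" by simp
      have 2: "y ^ (2 * k + 4) = y ^ (2 * k + 3) * y" by (simp add: eval_nat_numeral)
      show ?thesis
        unfolding 1 2 by (rule quotient_rule_numerator)
    qed
    also have "?u + y\<^sup>2 = A" by simp
    also have "(?m * ?m * A * y ^ (2 * k + 3) * ?u ^ (k + 1)) * A = (?m * ?m * A * A * ?u ^ (k + 1)) * y ^ (2 * k + 3)"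
      by (simp only: ac_simps)
    also have "(?m * (A * ?u ^ (k + 2))) * (?m * (A * ?u ^ (k + 2))) = (?m * ?m * A * A * ?u ^ (k + 1)) * ?u ^ (k + 3)"
    proof -
      have "?u ^ (k + 2) * ?u ^ (k + 2) = ?u ^ (k + 1) * ?u ^ (k + 3)"
        unfolding power_add[symmetric] by (rule arg_cong[where f = "power ?u"]) simp
      then show ?thesis by (simp only: ac_simps)
    qed
    also have "(?m * ?m * A * A * ?u ^ (k + 1)) * y ^ (2 * k + 3) / ((?m * ?m * A * A * ?u ^ (k + 1)) * ?u ^ (k + 3))
       = y ^ (2 * k + 3) / ?u ^ (k + 3)"
      using A u by (intro mult_divide_mult_cancel_left) simp
    also have "\<dots> = ?u powr (- 3 - real k) * y ^ (2 * k + 3)"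
    proof -
      have "- 3 - real k = - real (k + 3)" by simp
      then have "?u powr (- 3 - real k) = ?u powr (- real (k + 3))" by (simp only:)
      also have "\<dots> = 1 / ?u ^ (k + 3)" unfolding powr_minus powr_realpow[OF u] by (simp add: inverse_eq_divide)
      finally show ?thesis by simp
    qed
    finally show ?thesis .
  qed
  have "(\<integral>\<^sup>+y. ennreal ((A - y\<^sup>2) powr (- 3 - real k) * y ^ (2 * k + 3)) * indicator {0..c} y \<partial>lborel) = ennreal (F c - F 0)"
    using c D by (intro nn_integral_FTC_Icc) auto
  moreover have "F 0 = 0" by (simp add: F_def power_0_left)
  ultimately show ?thesis by (simp only: diff_zero F_def)
qed

text \<open>The antiderivative of (x^2 - 1)^n that vanishes at 1, obtained by integration by parts.
  At x = cosh r it is the integral of sinh^(2n + 1) from 0 to r.\<close>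

fun sinh_poly :: "nat \<Rightarrow> real \<Rightarrow> real" where
  "sinh_poly 0 x = x - 1"
| "sinh_poly (Suc n) x = (x * (x\<^sup>2 - 1) ^ Suc n - 2 * real (Suc n) * sinh_poly n x) / (2 * real n + 3)"

lemma DERIV_sinh_poly: "DERIV (sinh_poly n) x :> (x\<^sup>2 - 1) ^ n"
proof (induction n)
  case 0
  have "sinh_poly 0 = (\<lambda>x. x - 1)" by (rule ext) simp
  moreover have "DERIV (\<lambda>x. x - 1) x :> (1 :: real)" by (auto intro!: derivative_eq_intros)
  ultimately show ?case by (simp only: power_0)
next
  case (Suc n)
  let ?u = "x\<^sup>2 - 1"
  have "DERIV (\<lambda>x. x\<^sup>2 - 1) x :> 2 * x"
    by (auto intro!: derivative_eq_intros)
  from DERIV_power[OF this, of "Suc n"]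
  have "DERIV (\<lambda>x. (x\<^sup>2 - 1) ^ Suc n) x :> real (Suc n) * (2 * x * ?u ^ n)"
    by (simp only: diff_Suc_Suc diff_zero)
  then have "DERIV (\<lambda>x. x * (x\<^sup>2 - 1) ^ Suc n) x :> 1 * ?u ^ Suc n + real (Suc n) * (2 * x * ?u ^ n) * x"
    by (rule DERIV_mult[OF DERIV_ident])
  then have "DERIV (\<lambda>x. (x * (x\<^sup>2 - 1) ^ Suc n - 2 * real (Suc n) * sinh_poly n x) / (2 * real n + 3)) x
     :> (1 * ?u ^ Suc n + real (Suc n) * (2 * x * ?u ^ n) * x - 2 * real (Suc n) * ?u ^ n) / (2 * real n + 3)"
    by (intro DERIV_cdivide DERIV_diff DERIV_cmult Suc)
  moreover have "1 * ?u ^ Suc n + real (Suc n) * (2 * x * ?u ^ n) * x - 2 * real (Suc n) * ?u ^ n = (2 * real n + 3) * ?u ^ Suc n"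
    by (simp add: algebra_simps power2_eq_square)
  moreover have "sinh_poly (Suc n) = (\<lambda>x. (x * (x\<^sup>2 - 1) ^ Suc n - 2 * real (Suc n) * sinh_poly n x) / (2 * real n + 3))"
    by (rule ext) (rule sinh_poly.simps)
  moreover have "(2 * real n + 3) * ?u ^ Suc n / (2 * real n + 3) = ?u ^ Suc n" by simp
  ultimately show ?case by (simp only:)
qed

lemma sinh_poly_1: "sinh_poly n 1 = 0"
  by (induction n) auto

declare sinh_poly.simps(2) [simp del]

lemma inverse_sqrt_sq_minus_1: "0 < u \<Longrightarrow> (1 / sqrt u)\<^sup>2 - 1 = (1 - u) / u"
  by (simp add: power_divide diff_divide_distrib)

lemma powr_minus_half_odd:
  assumes "0 < u" shows "u powr (- (5 / 2) - real k) = 1 / (u ^ (k + 2) * sqrt u)"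
proof -
  have "- (5 / 2) - real k = - (real (k + 2) + 1 / 2)" by simp
  then have "u powr (- (5 / 2) - real k) = 1 / (u powr real (k + 2) * u powr (1 / 2))"
    by (simp only: powr_minus powr_add inverse_eq_divide)
  then show ?thesis
    using powr_realpow[OF assms, of "k + 2"] powr_half_sqrt[of u] assms by simp
qed

lemma DERIV_inverse_sqrt_one_minus_sq:
  fixes y :: real assumes "0 < 1 - y\<^sup>2"
  shows "DERIV (\<lambda>y. 1 / sqrt (1 - y\<^sup>2)) y :> y * (1 / ((1 - y\<^sup>2) * sqrt (1 - y\<^sup>2)))"
proof -
  have d1: "DERIV (\<lambda>y. 1 - y\<^sup>2) y :> - (2 * y)"
    by (auto intro!: derivative_eq_intros)
  have d2: "DERIV (\<lambda>u. inverse (sqrt u)) u :> - (inverse (sqrt u) * (inverse (sqrt u) / 2) * inverse (sqrt u))"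
    if "0 < u" for u :: real
    by (rule DERIV_inverse'[OF DERIV_real_sqrt[OF that]]) (use that in simp)
  have d3: "- (inverse (sqrt u) * (inverse (sqrt u) / 2) * inverse (sqrt u)) * - (2 * y) = y * (1 / (u * sqrt u))"
    if "0 < u" for u
  proof -
    have "sqrt u * sqrt u = u" using that by simp
    then have "inverse (sqrt u) * inverse (sqrt u) = inverse u"
      by (metis inverse_mult_distrib)
    then show ?thesis by (simp add: inverse_eq_divide)
  qed
  show ?thesis
    using DERIV_chain2[OF d2[OF assms] d1] unfolding d3[OF assms] by (simp only: inverse_eq_divide)
qed

lemma power_quotient_collect:
  "(q / u) ^ Suc k * (y * (1 / (u * r))) = (q ^ Suc k * y) * (1 / (u ^ (k + 2) * r))" for u :: real
  by (simp add: power_divide)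

text \<open>Substitution x = 1 / sqrt(1 - y^2), for which x^2 - 1 = y^2 / (1 - y^2) and dx = y (1 -
  y^2)^(-3/2) dy.\<close>

lemma nn_integral_radial_half:
  assumes c: "0 \<le> c" "c\<^sup>2 < 1"
  shows "(\<integral>\<^sup>+y. ennreal ((1 - y\<^sup>2) powr (- (5 / 2) - real k) * y ^ (2 * k + 3)) * indicator {0..c} y \<partial>lborel)
    = ennreal (sinh_poly (Suc k) (1 / sqrt (1 - c\<^sup>2)))"
proof -
  have pos: "0 < 1 - y\<^sup>2" if "0 \<le> y" "y \<le> c" for y
  proof -
    have "y\<^sup>2 \<le> c\<^sup>2" using that by (intro power_mono) auto
    then show ?thesis using c by simp
  qed
  have D: "DERIV (\<lambda>y. sinh_poly (Suc k) (1 / sqrt (1 - y\<^sup>2))) y :> (1 - y\<^sup>2) powr (- (5 / 2) - real k) * y ^ (2 * k + 3)"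
    if y: "0 \<le> y" "y \<le> c" for y
  proof -
    let ?u = "1 - y\<^sup>2"
    note u = pos[OF y]
    have yp: "(y\<^sup>2) ^ Suc k * y = y ^ (2 * k + 3)"
    proof -
      have "(y\<^sup>2) ^ Suc k * y = y ^ (2 * Suc k + 1)"
        by (simp only: power_mult power_add power_one_right)
      also have "2 * Suc k + 1 = 2 * k + 3" by simp
      finally show ?thesis .
    qed
    have e: "((1 / sqrt ?u)\<^sup>2 - 1) ^ Suc k * (y * (1 / (?u * sqrt ?u))) = ?u powr (- (5 / 2) - real k) * y ^ (2 * k + 3)"
    proof -
      have "1 - ?u = y\<^sup>2" by simp
      then have "((1 / sqrt ?u)\<^sup>2 - 1) ^ Suc k * (y * (1 / (?u * sqrt ?u))) = (y\<^sup>2 / ?u) ^ Suc k * (y * (1 / (?u * sqrt ?u)))"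
        by (simp only: inverse_sqrt_sq_minus_1[OF u])
      also have "\<dots> = y ^ (2 * k + 3) * (1 / (?u ^ (k + 2) * sqrt ?u))"
        unfolding power_quotient_collect yp ..
      finally show ?thesis
        unfolding powr_minus_half_odd[OF u] by (simp only: mult.commute)
    qed
    show ?thesis
      unfolding e[symmetric] by (rule DERIV_chain2[OF DERIV_sinh_poly DERIV_inverse_sqrt_one_minus_sq[OF u]])
  qed
  have "(\<integral>\<^sup>+y. ennreal ((1 - y\<^sup>2) powr (- (5 / 2) - real k) * y ^ (2 * k + 3)) * indicator {0..c} y \<partial>lborel)
    = ennreal (sinh_poly (Suc k) (1 / sqrt (1 - c\<^sup>2)) - sinh_poly (Suc k) (1 / sqrt (1 - 0\<^sup>2)))"
  proof (rule nn_integral_FTC_Icc)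
    show "(\<lambda>y. (1 - y\<^sup>2) powr (- (5 / 2) - real k) * y ^ (2 * k + 3)) \<in> borel_measurable borel"
      by measurable
    show "0 \<le> c" by (rule c)
    fix y assume "y \<in> {0..c}"
    then have y: "0 \<le> y" "y \<le> c" by simp_all
    show "DERIV (\<lambda>y. sinh_poly (Suc k) (1 / sqrt (1 - y\<^sup>2))) y :> (1 - y\<^sup>2) powr (- (5 / 2) - real k) * y ^ (2 * k + 3)"
      by (rule D[OF y])
    show "0 \<le> (1 - y\<^sup>2) powr (- (5 / 2) - real k) * y ^ (2 * k + 3)"
      by (intro mult_nonneg_nonneg zero_le_power powr_ge_zero y)
  qed
  moreover have "1 / sqrt (1 - 0\<^sup>2) = (1 :: real)" by simp
  ultimately show ?thesis by (simp only: sinh_poly_1 diff_zero)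
qed

lemma nn_integral_continuous_Icc:
  fixes f :: "real \<Rightarrow> real"
  assumes cont: "continuous_on {a..b} f" and nn: "\<And>x. x \<in> {a..b} \<Longrightarrow> 0 \<le> f x"
  shows "(\<integral>\<^sup>+x. ennreal (f x) * indicator {a..b} x \<partial>lborel) = ennreal (integral {a..b} f)"
proof -
  let ?g = "\<lambda>x. indicator {a..b} x *\<^sub>R f x"
  have [measurable]: "?g \<in> borel_measurable borel"
    using cont by (intro borel_measurable_continuous_on_indicator) auto
  have "(f has_integral integral {a..b} f) {a..b}"
    using cont by (intro integrable_integral integrable_continuous_real)
  moreover have eq: "(\<lambda>x. if x \<in> {a..b} then f x else 0) = ?g"
    by (auto simp: indicator_def fun_eq_iff)
  ultimately have h: "(?g has_integral integral {a..b} f) UNIV"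
    unfolding eq[symmetric] has_integral_restrict_UNIV by simp
  have "(\<integral>\<^sup>+x. ennreal (?g x) \<partial>lborel) = ennreal (integral {a..b} f)"
  proof (rule nn_integral_has_integral_lborel[OF _ _ h])
    show "?g \<in> borel_measurable borel" by measurable
    show "0 \<le> ?g x" for x using nn by (auto split: split_indicator)
  qed
  moreover have "(\<integral>\<^sup>+x. ennreal (?g x) \<partial>lborel) = (\<integral>\<^sup>+x. ennreal (f x) * indicator {a..b} x \<partial>lborel)"
    by (intro nn_integral_cong) (auto split: split_indicator)
  ultimately show ?thesis by simp
qed

text \<open>The integral over the height that remains after the y1-integration, with B = 1 - c1^2
  and T = tau. The volume needs i = 1 and k >= 2; these values are reached recursively from two
  values of artanh.\<close>

definition radial_J :: "real \<Rightarrow> real \<Rightarrow> nat \<Rightarrow> nat \<Rightarrow> real" where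
  "radial_J B T i k = integral {0..T} (\<lambda>t. 1 / ((1 - t\<^sup>2) ^ i * (B - t\<^sup>2) ^ k))"

locale radial =
  fixes B T :: real
  assumes B: "B < 1" and T: "0 < T" "T\<^sup>2 < B"
begin

lemma radial_pos: "t \<in> {0..T} \<Longrightarrow> 0 < B - t\<^sup>2" "t \<in> {0..T} \<Longrightarrow> 0 < 1 - t\<^sup>2"
proof -
  assume t: "t \<in> {0..T}"
  then have "t\<^sup>2 \<le> T\<^sup>2" by (intro power_mono) auto
  then show "0 < B - t\<^sup>2" "0 < 1 - t\<^sup>2" using B T by auto
qed

lemma radial_continuous: "continuous_on {0..T} (\<lambda>t. 1 / ((1 - t\<^sup>2) ^ i * (B - t\<^sup>2) ^ k))"
proof (intro continuous_intros ballI)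
  fix t assume "t \<in> {0..T}"
  from radial_pos[OF this] show "(1 - t\<^sup>2) ^ i * (B - t\<^sup>2) ^ k \<noteq> 0" by auto
qed

lemma radial_has_integral: "((\<lambda>t. 1 / ((1 - t\<^sup>2) ^ i * (B - t\<^sup>2) ^ k)) has_integral radial_J B T i k) {0..T}"
  unfolding radial_J_def by (intro integrable_integral integrable_continuous_real radial_continuous)

lemma radial_J_nonneg: "0 \<le> radial_J B T i k"
  unfolding radial_J_def
proof (rule Henstock_Kurzweil_Integration.integral_nonneg)
  show "(\<lambda>t. 1 / ((1 - t\<^sup>2) ^ i * (B - t\<^sup>2) ^ k)) integrable_on {0..T}"
    by (intro integrable_continuous_real radial_continuous)
  fix t assume "t \<in> {0..T}"
  from radial_pos[OF this] show "0 \<le> 1 / ((1 - t\<^sup>2) ^ i * (B - t\<^sup>2) ^ k)" by auto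
qed

text \<open>Partial fractions, from (1 - t^2) - (B - t^2) = 1 - B.\<close>

lemma radial_J_step: "(1 - B) * radial_J B T 1 (Suc k) = radial_J B T 0 (Suc k) - radial_J B T 1 k"
proof (rule has_integral_unique)
  show "((\<lambda>t. (1 - B) * (1 / ((1 - t\<^sup>2) ^ 1 * (B - t\<^sup>2) ^ Suc k))) has_integral (1 - B) * radial_J B T 1 (Suc k)) {0..T}"
    by (rule has_integral_mult_right[OF radial_has_integral])
  have "((\<lambda>t. 1 / ((1 - t\<^sup>2) ^ 0 * (B - t\<^sup>2) ^ Suc k) - 1 / ((1 - t\<^sup>2) ^ 1 * (B - t\<^sup>2) ^ k))
      has_integral radial_J B T 0 (Suc k) - radial_J B T 1 k) {0..T}"
    by (rule has_integral_diff[OF radial_has_integral radial_has_integral])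
  then show "((\<lambda>t. (1 - B) * (1 / ((1 - t\<^sup>2) ^ 1 * (B - t\<^sup>2) ^ Suc k)))
      has_integral radial_J B T 0 (Suc k) - radial_J B T 1 k) {0..T}"
  proof (rule has_integral_eq[rotated])
    fix t assume t: "t \<in> {0..T}"
    have "1 / (p * q) - 1 / (r * p) = (r - q) * (1 / (r * (q * p)))" if "p \<noteq> 0" "q \<noteq> 0" "r \<noteq> 0" for p q r :: real
      using that by (simp add: field_simps)
    from this[of "(B - t\<^sup>2) ^ k" "B - t\<^sup>2" "1 - t\<^sup>2"] radial_pos[OF t]
    show "1 / ((1 - t\<^sup>2) ^ 0 * (B - t\<^sup>2) ^ Suc k) - 1 / ((1 - t\<^sup>2) ^ 1 * (B - t\<^sup>2) ^ k)
      = (1 - B) * (1 / ((1 - t\<^sup>2) ^ 1 * (B - t\<^sup>2) ^ Suc k))"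
      by (simp add: mult.commute[of "B - t\<^sup>2"])
  qed
qed

text \<open>The derivative of t / (B - t^2)^(j + 1) is a combination of the two neighbouring
  integrands.\<close>

lemma radial_J_reduction:
  "2 * real (Suc j) * B * radial_J B T 0 (Suc (Suc j)) = T / (B - T\<^sup>2) ^ Suc j + (2 * real (Suc j) - 1) * radial_J B T 0 (Suc j)"
proof -
  let ?n = "real (Suc j)"
  have "((\<lambda>t. 2 * ?n * B * (1 / ((1 - t\<^sup>2) ^ 0 * (B - t\<^sup>2) ^ Suc (Suc j))) - (2 * ?n - 1) * (1 / ((1 - t\<^sup>2) ^ 0 * (B - t\<^sup>2) ^ Suc j)))
    has_integral T / (B - T\<^sup>2) ^ Suc j - 0 / (B - 0\<^sup>2) ^ Suc j) {0..T}"
  proof (rule fundamental_theorem_of_calculus)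
    show "0 \<le> T" using T by simp
    fix t assume t: "t \<in> {0..T}"
    have nz: "(B - t\<^sup>2) ^ Suc j \<noteq> 0" using radial_pos[OF t] by simp
    have "DERIV (\<lambda>t. B - t\<^sup>2) t :> - (2 * t)"
      by (auto intro!: derivative_eq_intros)
    from DERIV_power[OF this, of "Suc j"]
    have d: "DERIV (\<lambda>t. (B - t\<^sup>2) ^ Suc j) t :> ?n * (- (2 * t) * (B - t\<^sup>2) ^ j)"
      by (simp only: diff_Suc_Suc diff_zero)
    have "DERIV (\<lambda>t. t / (B - t\<^sup>2) ^ Suc j) t :> (1 * (B - t\<^sup>2) ^ Suc j - t * (?n * (- (2 * t) * (B - t\<^sup>2) ^ j))) / ((B - t\<^sup>2) ^ Suc j * (B - t\<^sup>2) ^ Suc j)"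
      by (rule DERIV_divide[OF DERIV_ident d nz])
    also have "(1 * (B - t\<^sup>2) ^ Suc j - t * (?n * (- (2 * t) * (B - t\<^sup>2) ^ j))) / ((B - t\<^sup>2) ^ Suc j * (B - t\<^sup>2) ^ Suc j)
      = 2 * ?n * B * (1 / ((1 - t\<^sup>2) ^ 0 * (B - t\<^sup>2) ^ Suc (Suc j))) - (2 * ?n - 1) * (1 / ((1 - t\<^sup>2) ^ 0 * (B - t\<^sup>2) ^ Suc j))"
    proof -
      have "(1 * (u * p) - t * (n * (- (2 * t) * p))) / ((u * p) * (u * p))
        = 2 * n * (u + t\<^sup>2) * (1 / (1 * (u * (u * p)))) - (2 * n - 1) * (1 / (1 * (u * p)))"
        if "p \<noteq> 0" "u \<noteq> 0" for n p u :: real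
        using that by (simp add: field_simps power2_eq_square)
      from this[of "(B - t\<^sup>2) ^ j" "B - t\<^sup>2" ?n] radial_pos[OF t]
      show ?thesis by (simp only: power_Suc power_0 diff_add_cancel) auto
    qed
    finally show "((\<lambda>t. t / (B - t\<^sup>2) ^ Suc j) has_vector_derivative
       2 * ?n * B * (1 / ((1 - t\<^sup>2) ^ 0 * (B - t\<^sup>2) ^ Suc (Suc j))) - (2 * ?n - 1) * (1 / ((1 - t\<^sup>2) ^ 0 * (B - t\<^sup>2) ^ Suc j)))
       (at t within {0..T})"
      unfolding has_real_derivative_iff_has_vector_derivative by (rule has_vector_derivative_at_within)
  qed
  moreover have "((\<lambda>t. 2 * ?n * B * (1 / ((1 - t\<^sup>2) ^ 0 * (B - t\<^sup>2) ^ Suc (Suc j))) - (2 * ?n - 1) * (1 / ((1 - t\<^sup>2) ^ 0 * (B - t\<^sup>2) ^ Suc j)))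
    has_integral 2 * ?n * B * radial_J B T 0 (Suc (Suc j)) - (2 * ?n - 1) * radial_J B T 0 (Suc j)) {0..T}"
    by (intro has_integral_diff has_integral_mult_right radial_has_integral)
  ultimately have "2 * ?n * B * radial_J B T 0 (Suc (Suc j)) - (2 * ?n - 1) * radial_J B T 0 (Suc j) = T / (B - T\<^sup>2) ^ Suc j - 0 / (B - 0\<^sup>2) ^ Suc j"
    by (rule has_integral_unique[rotated])
  then show ?thesis by simp
qed

lemma DERIV_artanh_scaled:
  fixes t r :: real assumes "0 < r" "\<bar>t\<bar> < r"
  shows "DERIV (\<lambda>t. artanh (t / r) / r) t :> 1 / (r\<^sup>2 - t\<^sup>2)"
proof -
  have lt: "\<bar>t / r\<bar> < 1" using assms by simp
  have "DERIV (\<lambda>t. artanh (t / r)) t :> 1 / (1 - (t / r)\<^sup>2) * (1 / r)"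
    by (rule DERIV_chain2[OF artanh_real_has_field_derivative]) (use lt assms in \<open>auto intro!: derivative_eq_intros\<close>)
  then have "DERIV (\<lambda>t. artanh (t / r) / r) t :> 1 / (1 - (t / r)\<^sup>2) * (1 / r) / r"
    by (rule DERIV_cdivide)
  also have "1 / (1 - (t / r)\<^sup>2) * (1 / r) / r = 1 / (r\<^sup>2 * (1 - (t / r)\<^sup>2))"
    by (simp add: power2_eq_square)
  also have "r\<^sup>2 * (1 - (t / r)\<^sup>2) = r\<^sup>2 - t\<^sup>2"
    using assms by (simp add: right_diff_distrib power_divide)
  finally show ?thesis .
qed

lemma radial_J_0_1:
  assumes r: "0 < r" "r\<^sup>2 = B" shows "radial_J B T 0 1 = artanh (T / r) / r"
proof -
  have Tr: "T < r" using T r by (intro power2_less_imp_less[of T r]) auto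
  have "((\<lambda>t. 1 / ((1 - t\<^sup>2) ^ 0 * (B - t\<^sup>2) ^ 1)) has_integral artanh (T / r) / r - artanh (0 / r) / r) {0..T}"
  proof (rule fundamental_theorem_of_calculus)
    fix t assume "t \<in> {0..T}"
    then have "DERIV (\<lambda>t. artanh (t / r) / r) t :> 1 / (r\<^sup>2 - t\<^sup>2)"
      using Tr r by (intro DERIV_artanh_scaled) auto
    then show "((\<lambda>t. artanh (t / r) / r) has_vector_derivative 1 / ((1 - t\<^sup>2) ^ 0 * (B - t\<^sup>2) ^ 1)) (at t within {0..T})"
      unfolding has_real_derivative_iff_has_vector_derivative r(2) power_0 power_one_right mult_1_left
      by (rule has_vector_derivative_at_within)
  qed (use T in simp)
  from has_integral_unique[OF radial_has_integral this] show ?thesis by simp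
qed

lemma radial_J_1_0: "radial_J B T 1 0 = artanh T"
proof -
  have T1: "T < 1" using T B power2_less_imp_less[of T 1] by simp
  have "((\<lambda>t. 1 / ((1 - t\<^sup>2) ^ 1 * (B - t\<^sup>2) ^ 0)) has_integral artanh (T / 1) / 1 - artanh (0 / 1) / 1) {0..T}"
  proof (rule fundamental_theorem_of_calculus)
    fix t assume "t \<in> {0..T}"
    then have "DERIV (\<lambda>t. artanh (t / 1) / 1) t :> 1 / (1\<^sup>2 - t\<^sup>2)"
      using T1 by (intro DERIV_artanh_scaled) auto
    then show "((\<lambda>t. artanh (t / 1) / 1) has_vector_derivative 1 / ((1 - t\<^sup>2) ^ 1 * (B - t\<^sup>2) ^ 0)) (at t within {0..T})"
      unfolding has_real_derivative_iff_has_vector_derivative power_0 power_one_right mult_1_right power_one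
      by (rule has_vector_derivative_at_within)
  qed (use T in simp)
  from has_integral_unique[OF radial_has_integral this] show ?thesis by simp
qed

end

text \<open>The antiderivative of (1 - w^2)^(-3) that vanishes at 0. At w = tanh h it is the
  integral of cosh^4 from 0 to h, the classical ratio between the volume of a hyperball piece and
  that of its base.\<close>

definition hyper_ball_profile :: "real \<Rightarrow> real" where
  "hyper_ball_profile w = w / (4 * (1 - w\<^sup>2)\<^sup>2) + 3 * w / (8 * (1 - w\<^sup>2)) + 3 / 8 * artanh w"

lemma DERIV_hyper_ball_profile:
  assumes "\<bar>w\<bar> < 1"
  shows "DERIV hyper_ball_profile w :> 1 / (1 - w\<^sup>2) ^ 3"
proof -
  let ?u = "1 - w\<^sup>2"
  have u: "?u \<noteq> 0" using assms abs_square_less_1[of w] by simp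
  have du: "DERIV (\<lambda>w. 1 - w\<^sup>2) w :> - (2 * w)"
    by (auto intro!: derivative_eq_intros)
  from DERIV_power[OF du, of 2] have du2: "DERIV (\<lambda>w. (1 - w\<^sup>2)\<^sup>2) w :> 2 * (- (2 * w) * ?u)" by simp
  have d1: "DERIV (\<lambda>w. w / (4 * (1 - w\<^sup>2)\<^sup>2)) w :> (1 * (4 * ?u\<^sup>2) - w * (4 * (2 * (- (2 * w) * ?u)))) / ((4 * ?u\<^sup>2) * (4 * ?u\<^sup>2))"
    by (rule DERIV_divide[OF DERIV_ident DERIV_cmult[OF du2]]) (use u in simp)
  have d2: "DERIV (\<lambda>w. 3 * w / (8 * (1 - w\<^sup>2))) w :> (3 * 1 * (8 * ?u) - 3 * w * (8 * - (2 * w))) / ((8 * ?u) * (8 * ?u))"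
    by (rule DERIV_divide[OF DERIV_cmult[OF DERIV_ident] DERIV_cmult[OF du]]) (use u in simp)
  have d3: "DERIV (\<lambda>w. 3 / 8 * artanh w) w :> 3 / 8 * (1 / ?u)"
    by (rule DERIV_cmult) (rule artanh_real_has_field_derivative[OF assms])
  have e: "(1 * (4 * u\<^sup>2) - w * (4 * (2 * (- (2 * w) * u)))) / ((4 * u\<^sup>2) * (4 * u\<^sup>2))
      + (3 * 1 * (8 * u) - 3 * w * (8 * - (2 * w))) / ((8 * u) * (8 * u)) + 3 / 8 * (1 / u) = 1 / u ^ 3"
    if "u \<noteq> 0" "w\<^sup>2 = 1 - u" for u :: real
  proof -
    have "1 * (4 * u\<^sup>2) - w * (4 * (2 * (- (2 * w) * u))) = 4 * u\<^sup>2 + 16 * w\<^sup>2 * u"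
      "3 * 1 * (8 * u) - 3 * w * (8 * - (2 * w)) = 24 * u + 48 * w\<^sup>2"
      by (simp_all add: power2_eq_square)
    then have n: "1 * (4 * u\<^sup>2) - w * (4 * (2 * (- (2 * w) * u))) = 4 * u\<^sup>2 + 16 * (1 - u) * u"
      "3 * 1 * (8 * u) - 3 * w * (8 * - (2 * w)) = 24 * u + 48 * (1 - u)"
      by (simp_all only: that(2))
    show ?thesis
      unfolding n using that(1) by (simp add: field_simps power2_eq_square power3_eq_cube)
  qed
  have "hyper_ball_profile = (\<lambda>w. w / (4 * (1 - w\<^sup>2)\<^sup>2) + 3 * w / (8 * (1 - w\<^sup>2)) + 3 / 8 * artanh w)"
    by (rule ext) (rule hyper_ball_profile_def)
  moreover have "DERIV (\<lambda>w. w / (4 * (1 - w\<^sup>2)\<^sup>2) + 3 * w / (8 * (1 - w\<^sup>2)) + 3 / 8 * artanh w) w :>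
     (1 * (4 * ?u\<^sup>2) - w * (4 * (2 * (- (2 * w) * ?u)))) / ((4 * ?u\<^sup>2) * (4 * ?u\<^sup>2))
      + (3 * 1 * (8 * ?u) - 3 * w * (8 * - (2 * w))) / ((8 * ?u) * (8 * ?u)) + 3 / 8 * (1 / ?u)"
    by (intro DERIV_add d1 d2 d3)
  ultimately show ?thesis
    using e[of ?u] u by simp
qed

text \<open>The scaling t = w sqrt q makes the range of w independent of the base point; the power
  of q left over is the density of the 4-dimensional Klein model.\<close>

lemma nn_integral_hyper_ball_fibre:
  assumes q: "0 < q" and T: "0 \<le> T" "T < 1"
  shows "(\<integral>\<^sup>+t. ennreal (1 / (q - t\<^sup>2) ^ 3) * indicator {0..T * sqrt q} t \<partial>lborel)
    = ennreal (hyper_ball_profile T * q powr (- (5 / 2)))"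
proof -
  define r where "r = sqrt q"
  have r: "0 < r" "r\<^sup>2 = q" using q by (simp_all add: r_def)
  have qp: "q powr (- (5 / 2)) = 1 / r ^ 5"
  proof -
    have "q powr (- (5 / 2)) = 1 / (q ^ 2 * r)"
      using powr_minus_half_odd[OF q, of 0] by (simp add: r_def power2_eq_square)
    also have "q ^ 2 * r = r ^ 5" unfolding r(2)[symmetric] by (simp add: eval_nat_numeral)
    finally show ?thesis .
  qed
  have lt: "t\<^sup>2 < q" "\<bar>t / r\<bar> < 1" if "t \<in> {0..T * r}" for t
  proof -
    have "T * r < 1 * r" using T r by (intro mult_strict_right_mono) auto
    then have tr: "0 \<le> t" "t < r" using that by auto
    then have "t\<^sup>2 < r\<^sup>2" by (intro power_strict_mono) auto
    then show "t\<^sup>2 < q" using r by simp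
    show "\<bar>t / r\<bar> < 1" using tr by simp
  qed
  have D: "DERIV (\<lambda>t. hyper_ball_profile (t / r) * (1 / r ^ 5)) t :> 1 / (q - t\<^sup>2) ^ 3" if t: "t \<in> {0..T * r}" for t
  proof -
    have "DERIV (\<lambda>t. hyper_ball_profile (t / r)) t :> 1 / (1 - (t / r)\<^sup>2) ^ 3 * (1 / r)"
      by (rule DERIV_chain2[where f = hyper_ball_profile and g = "\<lambda>t. t / r", OF DERIV_hyper_ball_profile[OF lt(2)[OF t]]]) (use r in \<open>auto intro!: derivative_eq_intros\<close>)
    then have "DERIV (\<lambda>t. hyper_ball_profile (t / r) * (1 / r ^ 5)) t :> 1 / (1 - (t / r)\<^sup>2) ^ 3 * (1 / r) * (1 / r ^ 5)"
      by (rule DERIV_cmult_right)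
    also have "1 / (1 - (t / r)\<^sup>2) ^ 3 * (1 / r) * (1 / r ^ 5) = 1 / (r\<^sup>2 * (1 - (t / r)\<^sup>2)) ^ 3"
      by (simp add: power_mult_distrib eval_nat_numeral)
    also have "r\<^sup>2 * (1 - (t / r)\<^sup>2) = q - t\<^sup>2"
      using r q by (simp add: right_diff_distrib power_divide)
    finally show ?thesis .
  qed
  have "(\<integral>\<^sup>+t. ennreal (1 / (q - t\<^sup>2) ^ 3) * indicator {0..T * r} t \<partial>lborel)
    = ennreal (hyper_ball_profile (T * r / r) * (1 / r ^ 5) - hyper_ball_profile (0 / r) * (1 / r ^ 5))"
  proof (rule nn_integral_FTC_Icc)
    show "(\<lambda>t. 1 / (q - t\<^sup>2) ^ 3) \<in> borel_measurable borel" by measurable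
    show "0 \<le> T * r" using T r by simp
    fix t assume t: "t \<in> {0..T * r}"
    show "DERIV (\<lambda>t. hyper_ball_profile (t / r) * (1 / r ^ 5)) t :> 1 / (q - t\<^sup>2) ^ 3" by (rule D[OF t])
    show "0 \<le> 1 / (q - t\<^sup>2) ^ 3" using lt[OF t] by simp
  qed
  moreover have "hyper_ball_profile (0 / r) = 0" by (simp add: hyper_ball_profile_def)
  moreover have "T * r / r = T" using r by simp
  ultimately show ?thesis by (simp only: r_def[symmetric] qp mult_zero_left diff_zero)
qed

lemma enn2real_bounds:
  assumes "ennreal l \<le> X" "X \<le> ennreal u" "0 \<le> u"
  shows "l \<le> enn2real X" "enn2real X \<le> u"
proof -
  show "enn2real X \<le> u" using enn2real_mono[OF assms(2)] assms(3) by simp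
  have "X < top" using assms(2) by (simp add: le_less_trans)
  then have "ennreal (enn2real X) = X" by simp
  with assms(1) have "ennreal l \<le> ennreal (enn2real X)" by simp
  then show "l \<le> enn2real X" by (simp add: ennreal_le_iff)
qed

lemma sinh_poly_nonneg:
  assumes "1 \<le> x" shows "0 \<le> sinh_poly (Suc k) x"
proof -
  have "sinh_poly (Suc k) 1 \<le> sinh_poly (Suc k) x"
  proof (rule DERIV_nonneg_imp_nondecreasing[OF assms, of "sinh_poly (Suc k)"])
    fix y :: real assume "1 \<le> y"
    then have "0 \<le> (y\<^sup>2 - 1) ^ Suc k" by (intro zero_le_power) simp
    then show "\<exists>d. DERIV (sinh_poly (Suc k)) y :> d \<and> 0 \<le> d"
      using DERIV_sinh_poly[of "Suc k" y] by blast
  qed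
  then show ?thesis by (simp add: sinh_poly_1)
qed

section \<open>Two-sided bounds for the volumes of the orthoscheme and of the hyperball
  piece\<close>

context coxeter_frame
begin

definition "cell = simplex4 c1 c2 c3 c4"
definition "gap = 2 - golden"

lemma c1_sq: "1 - c1\<^sup>2 = gap"
  by (simp add: c_sq gap_def)

lemma spread_le: "spread c2 c3 c4 * c1\<^sup>2 \<le> 10349 / 100000"
proof -
  have "c3\<^sup>2 * (1 + c4\<^sup>2) \<le> 3821 / 10000 * (15280 / 10000)"
    using c_sq_le by (intro mult_mono) auto
  then have "spread c2 c3 c4 \<le> 1057 / 10000 * (1 + 3821 / 10000 * (15280 / 10000))"
    unfolding spread_def using c_sq_le by (intro mult_mono) auto
  then have "spread c2 c3 c4 * c1\<^sup>2 \<le> 1057 / 10000 * (1 + 3821 / 10000 * (15280 / 10000)) * (6181 / 10000)"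
    using c_sq_le by (intro mult_mono) auto
  then show ?thesis by simp
qed

lemma sq_coords5: "(norm (coords5 (t, z)))\<^sup>2 = t\<^sup>2 + (fst z)\<^sup>2 + tail_sq z"
proof -
  obtain y1 y2 y3 y4 where z: "z = (y1, y2, y3, y4)" by (cases z)
  show ?thesis
    unfolding z dot_square_norm[symmetric] by (simp add: inner_vec_def sum_5 coords5_nth tail_sq_def power2_eq_square)
qed

lemma cell_sq: "z \<in> cell \<Longrightarrow> (fst z)\<^sup>2 + tail_sq z \<le> 722 / 1000"
proof -
  assume z: "z \<in> cell"
  obtain y1 y2 y3 y4 where zz: "z = (y1, y2, y3, y4)" by (cases z)
  note b = simplex4_bounds[OF c_pos(2-4) z[unfolded cell_def zz]]
  have y: "y1\<^sup>2 \<le> c1\<^sup>2" using b by (intro power_mono) auto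
  have "spread c2 c3 c4 * y1\<^sup>2 \<le> spread c2 c3 c4 * c1\<^sup>2"
    using y by (intro mult_left_mono) (auto simp: spread_def)
  then have "tail_sq z \<le> 10349 / 100000"
    using b(3) spread_le by (simp add: zz)
  then show ?thesis using y c_sq_le(1) by (simp add: zz)
qed

definition kleinK :: "(real^5) set" where
  "kleinK = klein_chart {P. frame ` P \<in> orthoscheme b}"

text \<open>The values of \<open>\<kappa>\<close> squared are 1/4 and 1/2. The bound keeps tau^2
  below 1 - 0.722, so the truncated orthoscheme stays inside the ball, and below \<open>gap\<close>,
  so no denominator of the height integrals vanishes.\<close>

context
  assumes kappa: "\<kappa>\<^sup>2 \<le> 1 / 2"
begin

lemma tau_sq_le: "\<tau>\<^sup>2 \<le> 2361 / 10000"
proof -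
  have "7639 * \<kappa>\<^sup>2 \<le> 2361 * golden"
  proof -
    have "1618 / 1000 < golden" using golden_bounds(1) by simp
    then show ?thesis using kappa by linarith
  qed
  then show ?thesis
    using golden_pos zero_le_power2[of \<kappa>] by (simp add: c_sq divide_le_eq add_pos_nonneg)
qed

lemma tau_sq_less: "\<tau>\<^sup>2 < gap"
  using tau_sq_le golden_bounds by (simp add: gap_def)

lemma prism_sq: "t \<in> {0..\<tau>} \<Longrightarrow> z \<in> cell \<Longrightarrow> t\<^sup>2 + (fst z)\<^sup>2 + tail_sq z < 1"
proof -
  assume "t \<in> {0..\<tau>}" "z \<in> cell"
  moreover from this have "t\<^sup>2 \<le> \<tau>\<^sup>2" by (intro power_mono) auto
  ultimately show ?thesis using cell_sq[of z] tau_sq_le by linarith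
qed

lemma coords5_kleinK: "coords5 (t, z) \<in> kleinK \<longleftrightarrow> t \<in> {0..\<tau>} \<and> z \<in> cell"
proof -
  obtain y1 y2 y3 y4 where z: "z = (y1, y2, y3, y4)" by (cases z)
  have "norm (coords5 (t, z)) < 1" if "t \<in> {0..\<tau>}" "z \<in> cell"
    using prism_sq[OF that] unfolding sq_coords5[symmetric] by (simp add: abs_square_less_1)
  then show ?thesis
    unfolding kleinK_def klein_chart_orthoscheme
    by (auto simp: z coords5_nth cell_def simplex4_def)
qed

lemma kleinK_borel [measurable]: "kleinK \<in> sets borel"
proof -
  have "kleinK = {y \<in> space borel. norm y < 1 \<and> 0 \<le> y $ 5 \<and> y $ 5 \<le> \<tau> \<and> y $ 1 \<le> c1 \<and> y $ 2 \<le> c2 * y $ 1 \<and> y $ 3 \<le> c3 * y $ 2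
          \<and> y $ 4 \<le> c4 * y $ 3 \<and> 0 \<le> y $ 4}"
    by (simp add: kleinK_def klein_chart_orthoscheme)
  also have "\<dots> \<in> sets borel" by measurable
  finally show ?thesis .
qed

lemma hvol_orthoscheme_eq:
  "hvol (orthoscheme b) = enn2real (\<integral>\<^sup>+t. (\<integral>\<^sup>+z. ennreal ((1 - t\<^sup>2 - (fst z)\<^sup>2 - tail_sq z) powr (- 3)) * indicator cell z \<partial>lborel)
      * indicator {0..\<tau>} t \<partial>lborel)"
proof -
  have "hvol (orthoscheme b) = enn2real (\<integral>\<^sup>+y. ennreal (1 / (1 - (norm y)\<^sup>2) ^ 3) * indicator kleinK y \<partial>lborel)"
    by (rule hvol_mink_isometry[OF linear_frame mink_frame kleinK_def[symmetric] kleinK_borel])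
  also have "(\<integral>\<^sup>+y. ennreal (1 / (1 - (norm y)\<^sup>2) ^ 3) * indicator kleinK y \<partial>lborel)
     = (\<integral>\<^sup>+t. \<integral>\<^sup>+z. ennreal (1 / (1 - (norm (coords5 (t, z)))\<^sup>2) ^ 3) * indicator kleinK (coords5 (t, z)) \<partial>lborel \<partial>lborel)"
    by (rule nn_integral_coords5) measurable
  also have "\<dots> = (\<integral>\<^sup>+t. (\<integral>\<^sup>+z. ennreal ((1 - t\<^sup>2 - (fst z)\<^sup>2 - tail_sq z) powr (- 3)) * indicator cell z \<partial>lborel)
      * indicator {0..\<tau>} t \<partial>lborel)"
  proof (rule nn_integral_cong)
    fix t
    show "(\<integral>\<^sup>+z. ennreal (1 / (1 - (norm (coords5 (t, z)))\<^sup>2) ^ 3) * indicator kleinK (coords5 (t, z)) \<partial>lborel)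
      = (\<integral>\<^sup>+z. ennreal ((1 - t\<^sup>2 - (fst z)\<^sup>2 - tail_sq z) powr (- 3)) * indicator cell z \<partial>lborel) * indicator {0..\<tau>} t"
    proof (cases "t \<in> {0..\<tau>}")
      case True
      have "ennreal (1 / (1 - (norm (coords5 (t, z)))\<^sup>2) ^ 3) * indicator kleinK (coords5 (t, z))
        = ennreal ((1 - t\<^sup>2 - (fst z)\<^sup>2 - tail_sq z) powr (- 3)) * indicator cell z" for z
      proof (cases "z \<in> cell")
        case z: True
        have pos: "0 < 1 - t\<^sup>2 - (fst z)\<^sup>2 - tail_sq z" using prism_sq[OF True z] by linarith
        have "(1 - t\<^sup>2 - (fst z)\<^sup>2 - tail_sq z) powr (- 3) = 1 / (1 - t\<^sup>2 - (fst z)\<^sup>2 - tail_sq z) ^ 3"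
          using powr_minus[of "1 - t\<^sup>2 - (fst z)\<^sup>2 - tail_sq z" 3] powr_realpow[OF pos, of 3] by (simp add: inverse_eq_divide)
        then show ?thesis using z True
          by (simp add: coords5_kleinK sq_coords5 diff_diff_eq add.assoc)
      qed (simp add: coords5_kleinK)
      then show ?thesis using True by simp
    next
      case False
      then have "indicator kleinK (coords5 (t, z)) = (0 :: ennreal)" for z
        using coords5_kleinK[of t z] by (simp only: indicator_simps simp_thms)
      then show ?thesis using False by simp
    qed
  qed
  finally show ?thesis .
qed

definition "orthoscheme_term k = rising 3 k * moment c2 c3 c4 k * (c1 ^ (2 * k + 4) / real (2 * k + 4)) * radial_J gap \<tau> 1 (k + 2)"

lemma radial_gap: "radial gap \<tau>"
  using tau_sq_less golden_pos c_pos(5) by unfold_locales (auto simp: gap_def)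

text \<open>One \<open>\<rho>\<close> must serve all heights; the expansion ratio is worst at t =
  tau, where 1 - t^2 - c1^2 equals \<open>gap\<close> minus tau^2.\<close>

lemma hvol_orthoscheme_bounds:
  assumes \<rho>: "\<rho> < 1" "10349 / 100000 \<le> \<rho> * (gap - \<tau>\<^sup>2)"
  shows "(\<Sum>k<n. orthoscheme_term k) \<le> hvol (orthoscheme b)"
    and "hvol (orthoscheme b) \<le> (\<Sum>k<n. orthoscheme_term k) + (1 - \<rho>) powr (- 3) * orthoscheme_term n"
proof -
  interpret radial gap \<tau> by (rule radial_gap)
  define Y where "Y t k = c1 ^ (2 * k + 4) / (real (2 * k + 4) * ((1 - t\<^sup>2) * (1 - t\<^sup>2 - c1\<^sup>2) ^ (k + 2)))" for t k
  define X where "X t = (\<integral>\<^sup>+z. ennreal ((1 - t\<^sup>2 - (fst z)\<^sup>2 - tail_sq z) powr (- 3)) * indicator cell z \<partial>lborel)" for t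
  have g: "1 - t\<^sup>2 - c1\<^sup>2 = gap - t\<^sup>2" for t using c1_sq by simp
  have pos: "0 < 1 - t\<^sup>2" "0 < gap - t\<^sup>2" "t\<^sup>2 \<le> \<tau>\<^sup>2" if "t \<in> {0..\<tau>}" for t
    using radial_pos[OF that] that by (auto intro: power_mono)
  have \<rho>0: "0 \<le> \<rho>"
  proof (rule ccontr)
    assume "\<not> 0 \<le> \<rho>"
    then have "\<rho> * (gap - \<tau>\<^sup>2) \<le> 0" using tau_sq_less by (intro mult_nonpos_nonneg) auto
    then show False using \<rho>(2) by simp
  qed
  have Y0: "0 \<le> Y t k" if "t \<in> {0..\<tau>}" for t k
    unfolding Y_def g using pos[OF that] c_pos(1) by (intro divide_nonneg_nonneg mult_nonneg_nonneg) auto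
  have bnd: "ennreal (\<Sum>k<n. rising 3 k * moment c2 c3 c4 k * Y t k) \<le> X t"
    "X t \<le> ennreal ((\<Sum>k<n. rising 3 k * moment c2 c3 c4 k * Y t k) + rising 3 n * (1 - \<rho>) powr (- 3) * moment c2 c3 c4 n * Y t n)"
    if t: "t \<in> {0..\<tau>}" for t
  proof -
    have A: "c1\<^sup>2 < 1 - t\<^sup>2" using pos[OF t] g[of t] by linarith
    have "\<rho> * (gap - \<tau>\<^sup>2) \<le> \<rho> * (1 - t\<^sup>2 - c1\<^sup>2)"
      unfolding g using \<rho>0 pos[OF t] by (intro mult_left_mono) auto
    then have sp: "spread c2 c3 c4 * c1\<^sup>2 \<le> \<rho> * (1 - t\<^sup>2 - c1\<^sup>2)"
      using spread_le \<rho>(2) by linarith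
    have Yint: "(\<integral>\<^sup>+y. ennreal ((1 - t\<^sup>2 - y\<^sup>2) powr (- 3 - real k) * y ^ (2 * k + 3)) * indicator {0..c1} y \<partial>lborel) = ennreal (Y t k)" for k
      unfolding Y_def using c_pos(1) A by (intro nn_integral_radial_cube) auto
    note N = nn_integral_powr_simplex4[OF c_pos(1-4) _ \<rho>(1) sp A Y0[OF t] Yint, of n, folded cell_def]
    show "ennreal (\<Sum>k<n. rising 3 k * moment c2 c3 c4 k * Y t k) \<le> X t"
      "X t \<le> ennreal ((\<Sum>k<n. rising 3 k * moment c2 c3 c4 k * Y t k) + rising 3 n * (1 - \<rho>) powr (- 3) * moment c2 c3 c4 n * Y t n)"
      unfolding X_def using N by simp_all
  qed
  define C where "C k = rising 3 k * moment c2 c3 c4 k * (c1 ^ (2 * k + 4) / real (2 * k + 4))" for k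
  have C0: "0 \<le> C k" for k
    unfolding C_def using c_pos by (intro mult_nonneg_nonneg rising_nonneg moment_nonneg) auto
  have CY: "rising 3 k * moment c2 c3 c4 k * Y t k = C k * (1 / ((1 - t\<^sup>2) ^ 1 * (gap - t\<^sup>2) ^ (k + 2)))" for t k
    by (simp add: C_def Y_def g)
  have main: "(\<integral>\<^sup>+t. ennreal (\<Sum>k\<in>K. w k * (C k * (1 / ((1 - t\<^sup>2) ^ 1 * (gap - t\<^sup>2) ^ (k + 2))))) * indicator {0..\<tau>} t \<partial>lborel)
      = ennreal (\<Sum>k\<in>K. w k * orthoscheme_term k)"
    if K: "finite K" and w: "\<And>k. 0 \<le> w k" for K w
  proof -
    have "(\<integral>\<^sup>+t. ennreal (\<Sum>k\<in>K. w k * (C k * (1 / ((1 - t\<^sup>2) ^ 1 * (gap - t\<^sup>2) ^ (k + 2))))) * indicator {0..\<tau>} t \<partial>lborel)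
      = ennreal (integral {0..\<tau>} (\<lambda>t. \<Sum>k\<in>K. w k * (C k * (1 / ((1 - t\<^sup>2) ^ 1 * (gap - t\<^sup>2) ^ (k + 2))))))"
    proof (rule nn_integral_continuous_Icc)
      show "continuous_on {0..\<tau>} (\<lambda>t. \<Sum>k\<in>K. w k * (C k * (1 / ((1 - t\<^sup>2) ^ 1 * (gap - t\<^sup>2) ^ (k + 2)))))"
        by (intro continuous_on_sum continuous_on_mult_left radial_continuous)
      fix t assume t: "t \<in> {0..\<tau>}"
      show "0 \<le> (\<Sum>k\<in>K. w k * (C k * (1 / ((1 - t\<^sup>2) ^ 1 * (gap - t\<^sup>2) ^ (k + 2)))))"
        using w C0 pos[OF t] by (intro sum_nonneg mult_nonneg_nonneg divide_nonneg_nonneg) auto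
    qed
    also have "integral {0..\<tau>} (\<lambda>t. \<Sum>k\<in>K. w k * (C k * (1 / ((1 - t\<^sup>2) ^ 1 * (gap - t\<^sup>2) ^ (k + 2))))) = (\<Sum>k\<in>K. w k * (C k * radial_J gap \<tau> 1 (k + 2)))"
      by (intro integral_unique has_integral_sum K has_integral_mult_right radial_has_integral)
    also have "\<dots> = (\<Sum>k\<in>K. w k * orthoscheme_term k)"
      by (simp add: C_def orthoscheme_term_def)
    finally show ?thesis .
  qed
  define I where "I = (\<integral>\<^sup>+t. X t * indicator {0..\<tau>} t \<partial>lborel)"
  have vol: "hvol (orthoscheme b) = enn2real I"
    unfolding hvol_orthoscheme_eq I_def X_def ..
  have "ennreal (\<Sum>k<n. 1 * orthoscheme_term k)
    = (\<integral>\<^sup>+t. ennreal (\<Sum>k<n. 1 * (C k * (1 / ((1 - t\<^sup>2) ^ 1 * (gap - t\<^sup>2) ^ (k + 2))))) * indicator {0..\<tau>} t \<partial>lborel)"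
    by (rule main[symmetric]) auto
  also have "\<dots> \<le> I"
    unfolding I_def
  proof (rule nn_integral_mono)
    fix t :: real
    show "ennreal (\<Sum>k<n. 1 * (C k * (1 / ((1 - t\<^sup>2) ^ 1 * (gap - t\<^sup>2) ^ (k + 2))))) * indicator {0..\<tau>} t \<le> X t * indicator {0..\<tau>} t"
      using bnd(1)[of t] unfolding CY by (cases "t \<in> {0..\<tau>}") simp_all
  qed
  finally have lo: "ennreal (\<Sum>k<n. orthoscheme_term k) \<le> I" by simp
  define w where "w k = (if k = n then (1 - \<rho>) powr (- 3) else 1)" for k
  have wsum: "(\<Sum>k\<in>{..n}. w k * h k) = (\<Sum>k<n. h k) + (1 - \<rho>) powr (- 3) * h n" for h :: "nat \<Rightarrow> real"
    unfolding lessThan_Suc_atMost[symmetric] sum.lessThan_Suc by (simp add: w_def)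
  have "I \<le> (\<integral>\<^sup>+t. ennreal (\<Sum>k\<in>{..n}. w k * (C k * (1 / ((1 - t\<^sup>2) ^ 1 * (gap - t\<^sup>2) ^ (k + 2))))) * indicator {0..\<tau>} t \<partial>lborel)"
    unfolding I_def
  proof (rule nn_integral_mono)
    fix t :: real
    have "rising 3 n * (1 - \<rho>) powr (- 3) * moment c2 c3 c4 n * Y t n = (1 - \<rho>) powr (- 3) * (C n * (1 / ((1 - t\<^sup>2) ^ 1 * (gap - t\<^sup>2) ^ (n + 2))))"
      unfolding CY[symmetric] by (simp only: ac_simps)
    then show "X t * indicator {0..\<tau>} t \<le> ennreal (\<Sum>k\<in>{..n}. w k * (C k * (1 / ((1 - t\<^sup>2) ^ 1 * (gap - t\<^sup>2) ^ (k + 2))))) * indicator {0..\<tau>} t"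
      using bnd(2)[of t] unfolding CY wsum by (cases "t \<in> {0..\<tau>}") simp_all
  qed
  also have "\<dots> = ennreal (\<Sum>k\<in>{..n}. w k * orthoscheme_term k)"
    by (rule main) (auto simp: w_def)
  finally have hi: "I \<le> ennreal ((\<Sum>k<n. orthoscheme_term k) + (1 - \<rho>) powr (- 3) * orthoscheme_term n)"
    unfolding wsum .
  have ot0: "0 \<le> orthoscheme_term k" for k
    unfolding orthoscheme_term_def C_def[symmetric] using C0 radial_J_nonneg by (intro mult_nonneg_nonneg) auto
  have "0 \<le> (\<Sum>k<n. orthoscheme_term k) + (1 - \<rho>) powr (- 3) * orthoscheme_term n"
    using ot0 by (intro add_nonneg_nonneg sum_nonneg mult_nonneg_nonneg) auto
  from enn2real_bounds[OF lo hi this]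
  show "(\<Sum>k<n. orthoscheme_term k) \<le> hvol (orthoscheme b)"
    and "hvol (orthoscheme b) \<le> (\<Sum>k<n. orthoscheme_term k) + (1 - \<rho>) powr (- 3) * orthoscheme_term n"
    unfolding vol .
qed

definition "hyperball_term k = rising (5 / 2) k * moment c2 c3 c4 k * sinh_poly (Suc k) golden"

text \<open>Here the height is integrated first, since its range depends on the base point. Each
  fibre contributes the same profile factor times the density of the base, so the volume splits into
  a product.\<close>

lemma hvol_opt_hyperball_eq:
  "hvol (opt_hyperball b \<inter> orthoscheme b)
    = hyper_ball_profile \<tau> * enn2real (\<integral>\<^sup>+z. ennreal ((1 - (fst z)\<^sup>2 - tail_sq z) powr (- (5 / 2))) * indicator cell z \<partial>lborel)"
proof -
  define q where "q z = 1 - (fst z)\<^sup>2 - tail_sq z" for z :: real4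
  define K where "K = kleinK \<inter> {y. (y $ 5)\<^sup>2 \<le> \<tau>\<^sup>2 * (1 - ((y $ 1)\<^sup>2 + (y $ 2)\<^sup>2 + (y $ 3)\<^sup>2 + (y $ 4)\<^sup>2))}"
  have "K = {y \<in> space borel. y \<in> kleinK \<and> (y $ 5)\<^sup>2 \<le> \<tau>\<^sup>2 * (1 - ((y $ 1)\<^sup>2 + (y $ 2)\<^sup>2 + (y $ 3)\<^sup>2 + (y $ 4)\<^sup>2))}"
    by (auto simp: K_def)
  also have "\<dots> \<in> sets borel" by measurable
  finally have [measurable]: "K \<in> sets borel" .
  have qpos: "0 < q z" "q z \<le> 1" if "z \<in> cell" for z
    using cell_sq[OF that] tail_sq_nonneg[of z] zero_le_power2[of "fst z"] unfolding q_def by linarith+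
  have KC: "coords5 (t, z) \<in> K \<longleftrightarrow> z \<in> cell \<and> t \<in> {0..\<tau> * sqrt (q z)}" for t z
  proof -
    obtain y1 y2 y3 y4 where z: "z = (y1, y2, y3, y4)" by (cases z)
    have qz: "q z = 1 - (y1\<^sup>2 + y2\<^sup>2 + y3\<^sup>2 + y4\<^sup>2)" by (simp add: q_def z tail_sq_def)
    have "coords5 (t, z) \<in> K \<longleftrightarrow> (t \<in> {0..\<tau>} \<and> z \<in> cell) \<and> t\<^sup>2 \<le> \<tau>\<^sup>2 * q z"
      unfolding K_def Int_iff coords5_kleinK mem_Collect_eq unfolding z coords5_nth qz[unfolded z] ..
    also have "\<dots> \<longleftrightarrow> z \<in> cell \<and> t \<in> {0..\<tau> * sqrt (q z)}"
    proof (cases "z \<in> cell")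
      case True
      note qz = qpos[OF True]
      have eq: "\<tau>\<^sup>2 * q z = (\<tau> * sqrt (q z))\<^sup>2" using qz by (simp add: power_mult_distrib)
      have n: "0 \<le> \<tau> * sqrt (q z)" using qz c_pos(5) by simp
      have "\<tau> * sqrt (q z) \<le> \<tau> * 1" using qz c_pos(5) by (intro mult_left_mono) auto
      moreover have "t\<^sup>2 \<le> (\<tau> * sqrt (q z))\<^sup>2 \<longleftrightarrow> t \<le> \<tau> * sqrt (q z)" if "0 \<le> t"
        using that n abs_le_square_iff[of t "\<tau> * sqrt (q z)"] by (simp only: abs_of_nonneg)
      ultimately show ?thesis using True unfolding eq by auto
    qed simp
    finally show ?thesis .
  qed
  have "hvol (opt_hyperball b \<inter> orthoscheme b) = enn2real (\<integral>\<^sup>+y. ennreal (1 / (1 - (norm y)\<^sup>2) ^ 3) * indicator K y \<partial>lborel)"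
  proof (rule hvol_mink_isometry[OF linear_frame mink_frame])
    show "klein_chart {P. frame ` P \<in> opt_hyperball b \<inter> orthoscheme b} = K"
      unfolding klein_chart_opt_hyperball K_def kleinK_def ..
  qed measurable
  also have "(\<integral>\<^sup>+y. ennreal (1 / (1 - (norm y)\<^sup>2) ^ 3) * indicator K y \<partial>lborel)
     = (\<integral>\<^sup>+t. \<integral>\<^sup>+z. ennreal (1 / (1 - (norm (coords5 (t, z)))\<^sup>2) ^ 3) * indicator K (coords5 (t, z)) \<partial>lborel \<partial>lborel)"
    by (rule nn_integral_coords5) measurable
  also have "\<dots> = (\<integral>\<^sup>+z. \<integral>\<^sup>+t. ennreal (1 / (1 - (norm (coords5 (t, z)))\<^sup>2) ^ 3) * indicator K (coords5 (t, z)) \<partial>lborel \<partial>lborel)"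
  proof -
    have [measurable]: "coords5 \<in> borel_measurable borel"
      using linear_coords5 by (intro borel_measurable_continuous_onI linear_continuous_on) (simp add: linear_conv_bounded_linear)
    have m1: "(\<lambda>p. ennreal (1 / (1 - (norm (coords5 p))\<^sup>2) ^ 3) * indicator K (coords5 p)) \<in> borel_measurable borel"
      by measurable
    have "(\<lambda>p :: real4 \<times> real. (snd p, fst p)) \<in> borel_measurable borel"
      by (intro borel_measurable_continuous_onI continuous_intros)
    then have m2: "(\<lambda>p. ennreal (1 / (1 - (norm (coords5 (snd p, fst p)))\<^sup>2) ^ 3) * indicator K (coords5 (snd p, fst p))) \<in> borel_measurable borel"
      using m1 by (rule measurable_compose)
    show ?thesis
      by (rule lborel_pair.Fubini'[symmetric] lborel_pair.Fubini') (use m1 m2 in \<open>simp add: split_def lborel_prod\<close>)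
  qed
  also have "\<dots> = (\<integral>\<^sup>+z. ennreal (hyper_ball_profile \<tau>) * (ennreal (q z powr (- (5 / 2))) * indicator cell z) \<partial>lborel)"
  proof (rule nn_integral_cong)
    fix z :: real4
    show "(\<integral>\<^sup>+t. ennreal (1 / (1 - (norm (coords5 (t, z)))\<^sup>2) ^ 3) * indicator K (coords5 (t, z)) \<partial>lborel)
      = ennreal (hyper_ball_profile \<tau>) * (ennreal (q z powr (- (5 / 2))) * indicator cell z)"
    proof (cases "z \<in> cell")
      case True
      have "(\<integral>\<^sup>+t. ennreal (1 / (1 - (norm (coords5 (t, z)))\<^sup>2) ^ 3) * indicator K (coords5 (t, z)) \<partial>lborel)
        = (\<integral>\<^sup>+t. ennreal (1 / (q z - t\<^sup>2) ^ 3) * indicator {0..\<tau> * sqrt (q z)} t \<partial>lborel)"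
      proof (rule nn_integral_cong)
        fix t
        have "1 - (norm (coords5 (t, z)))\<^sup>2 = q z - t\<^sup>2" by (simp add: sq_coords5 q_def)
        moreover have "indicator K (coords5 (t, z)) = (indicator {0..\<tau> * sqrt (q z)} t :: ennreal)"
          using KC[of t z] True by (simp add: indicator_def)
        ultimately show "ennreal (1 / (1 - (norm (coords5 (t, z)))\<^sup>2) ^ 3) * indicator K (coords5 (t, z))
          = ennreal (1 / (q z - t\<^sup>2) ^ 3) * indicator {0..\<tau> * sqrt (q z)} t" by (simp only:)
      qed
      also have "\<dots> = ennreal (hyper_ball_profile \<tau> * q z powr (- (5 / 2)))"
        using qpos[OF True] c_pos(5) tau_less_1 by (intro nn_integral_hyper_ball_fibre) auto
      also have "\<dots> = ennreal (hyper_ball_profile \<tau>) * ennreal (q z powr (- (5 / 2)))"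
        by (rule ennreal_mult'') simp
      finally show ?thesis using True by simp
    next
      case False
      then have "indicator K (coords5 (t, z)) = (0 :: ennreal)" for t
        using KC[of t z] by (simp only: indicator_simps simp_thms)
      then show ?thesis using False by simp
    qed
  qed
  also have "\<dots> = ennreal (hyper_ball_profile \<tau>) * (\<integral>\<^sup>+z. ennreal (q z powr (- (5 / 2))) * indicator cell z \<partial>lborel)"
  proof (rule nn_integral_cmult)
    have f1: "(\<lambda>z::real4. fst z) \<in> borel_measurable borel"
      unfolding borel_prod[symmetric] by measurable
    have "q \<in> borel_measurable borel"
      unfolding q_def[abs_def] using f1 by measurable
    moreover have "cell \<in> sets borel" unfolding cell_def by measurable
    ultimately show "(\<lambda>z. ennreal (q z powr (- (5 / 2))) * indicator cell z) \<in> borel_measurable lborel"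
      by measurable
  qed
  finally have v: "hvol (opt_hyperball b \<inter> orthoscheme b)
    = enn2real (ennreal (hyper_ball_profile \<tau>) * (\<integral>\<^sup>+z. ennreal (q z powr (- (5 / 2))) * indicator cell z \<partial>lborel))" .
  have "0 \<le> \<tau> / (4 * (1 - \<tau>\<^sup>2)\<^sup>2) + 3 * \<tau> / (8 * (1 - \<tau>\<^sup>2))"
  proof -
    have "0 \<le> 1 - \<tau>\<^sup>2" using c_pos(5) tau_less_1 by (simp add: power_le_one)
    then show ?thesis using c_pos(5) by (intro add_nonneg_nonneg divide_nonneg_nonneg) auto
  qed
  moreover have "0 \<le> artanh \<tau>"
    unfolding radial.radial_J_1_0[OF radial_gap, symmetric] by (rule radial.radial_J_nonneg[OF radial_gap])
  ultimately have "0 \<le> hyper_ball_profile \<tau>"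
    unfolding hyper_ball_profile_def by simp
  then show ?thesis
    unfolding v q_def by (simp add: enn2real_mult)
qed

lemma hvol_opt_hyperball_bounds:
  assumes \<rho>: "\<rho> < 1" "10349 / 100000 \<le> \<rho> * gap"
  obtains v where "hvol (opt_hyperball b \<inter> orthoscheme b) = hyper_ball_profile \<tau> * v"
    "(\<Sum>k<n. hyperball_term k) \<le> v" "v \<le> (\<Sum>k<n. hyperball_term k) + (1 - \<rho>) powr (- (5 / 2)) * hyperball_term n"
proof -
  define X where "X = (\<integral>\<^sup>+z. ennreal ((1 - (fst z)\<^sup>2 - tail_sq z) powr (- (5 / 2))) * indicator cell z \<partial>lborel)"
  have gp: "0 < gap" using golden_pos by (simp add: gap_def)
  have A: "c1\<^sup>2 < 1" using c1_sq gp by linarith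
  have sp: "spread c2 c3 c4 * c1\<^sup>2 \<le> \<rho> * (1 - c1\<^sup>2)"
    unfolding c1_sq using spread_le \<rho>(2) by linarith
  have sg: "1 / sqrt (1 - c1\<^sup>2) = golden"
  proof -
    have "gap * (golden * golden) = 1" by (simp add: gap_def golden_sq algebra_simps)
    then have "sqrt gap * golden = 1"
      using golden_pos real_sqrt_mult[of gap "golden * golden"] by simp
    moreover have "sqrt gap \<noteq> 0" using gp by simp
    ultimately show ?thesis unfolding c1_sq by (simp add: field_simps)
  qed
  have Y: "(\<integral>\<^sup>+y. ennreal ((1 - y\<^sup>2) powr (- (5 / 2) - real k) * y ^ (2 * k + 3)) * indicator {0..c1} y \<partial>lborel)
     = ennreal (sinh_poly (Suc k) golden)" for k
    using nn_integral_radial_half[of c1 k] c_pos(1) A unfolding sg by simp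
  have Y0: "0 \<le> sinh_poly (Suc k) golden" for k
    using golden_pos by (intro sinh_poly_nonneg) simp
  have s: "1 \<le> (5 / 2 :: real)" by simp
  note N = nn_integral_powr_simplex4[OF c_pos(1-4) s \<rho>(1) sp A Y0 Y, of n, folded cell_def]
  have lo: "ennreal (\<Sum>k<n. hyperball_term k) \<le> X"
    unfolding X_def hyperball_term_def using N(1) by simp
  have hi: "X \<le> ennreal ((\<Sum>k<n. hyperball_term k) + (1 - \<rho>) powr (- (5 / 2)) * hyperball_term n)"
    unfolding X_def hyperball_term_def using N(2) by (simp add: ac_simps)
  have t0: "0 \<le> hyperball_term k" for k
    unfolding hyperball_term_def using c_pos Y0 by (intro mult_nonneg_nonneg rising_nonneg moment_nonneg) auto
  have "0 \<le> (\<Sum>k<n. hyperball_term k) + (1 - \<rho>) powr (- (5 / 2)) * hyperball_term n"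
    using t0 by (intro add_nonneg_nonneg sum_nonneg mult_nonneg_nonneg) auto
  from enn2real_bounds[OF lo hi this] show thesis
    using hvol_opt_hyperball_eq by (intro that[of "enn2real X"]) (auto simp: X_def)
qed

end

end

section \<open>Fixed-point interval arithmetic\<close>

type_synonym ival = "int \<times> int"

text \<open>
  A pair of integers \<open>a\<close> encloses a nonnegative real \<open>x\<close> if \<open>fst a \<le> 2 ^ 60 * x \<le> snd a\<close>.  All
  quantities to be computed are nonnegative, which keeps the monotonicity of products and quotients
  trivial; a difference is clipped at 0 and requires a proof that it is not negative.
\<close>

definition sc :: int where "sc = 1152921504606846976"

definition encl :: "ival \<Rightarrow> real \<Rightarrow> bool" where
  "encl a x \<longleftrightarrow> 0 \<le> fst a \<and> of_int (fst a) \<le> of_int sc * x \<and> of_int sc * x \<le> of_int (snd a)"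

definition imul :: "ival \<Rightarrow> ival \<Rightarrow> ival" where
  "imul a b = (fst a * fst b div sc, snd a * snd b div sc + 1)"
definition iadd :: "ival \<Rightarrow> ival \<Rightarrow> ival" where
  "iadd a b = (fst a + fst b, snd a + snd b)"
definition isub :: "ival \<Rightarrow> ival \<Rightarrow> ival" where
  "isub a b = (max 0 (fst a - snd b), snd a - fst b)"
definition imuln :: "ival \<Rightarrow> int \<Rightarrow> ival" where
  "imuln a n = (fst a * n, snd a * n)"
definition idivn :: "ival \<Rightarrow> int \<Rightarrow> ival" where
  "idivn a n = (fst a div n, snd a div n + 1)"
definition idiv :: "ival \<Rightarrow> ival \<Rightarrow> ival" where
  "idiv a b = (fst a * sc div snd b, snd a * sc div fst b + 1)"

lemma sc_pos: "0 < sc" "(0::real) < of_int sc"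
  by (simp_all add: sc_def)

lemma encl_nonneg: "encl a x \<Longrightarrow> 0 \<le> x"
  unfolding encl_def using sc_pos(2) by (smt (verit) of_int_0_le_iff zero_le_mult_iff)

lemma of_int_div_bounds:
  fixes p n :: int assumes "0 < n"
  shows "real_of_int (p div n) \<le> real_of_int p / real_of_int n" "real_of_int p / real_of_int n \<le> real_of_int (p div n + 1)"
proof -
  have "p div n = \<lfloor>real_of_int p / of_int n\<rfloor>" by (simp add: floor_divide_of_int_eq)
  then show "real_of_int (p div n) \<le> real_of_int p / real_of_int n" "real_of_int p / real_of_int n \<le> real_of_int (p div n + 1)"
    by linarith+
qed

lemma encl_mul: "encl a x \<Longrightarrow> encl b y \<Longrightarrow> encl (imul a b) (x * y)"
proof -
  assume a: "encl a x" and b: "encl b y"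
  let ?s = "real_of_int sc"
  have x: "0 \<le> x" and y: "0 \<le> y" using a b encl_nonneg by auto
  note d = of_int_div_bounds[OF sc_pos(1)]
  have "of_int (fst a) * of_int (fst b) \<le> (?s * x) * (?s * y)"
    using a b x y sc_pos unfolding encl_def by (intro mult_mono) auto
  then have "of_int (fst a * fst b) / ?s \<le> ?s * (x * y)"
    using sc_pos(2) by (simp add: divide_le_eq ac_simps)
  moreover have "(?s * x) * (?s * y) \<le> of_int (snd a) * of_int (snd b)"
    using a b x y sc_pos unfolding encl_def by (intro mult_mono) (auto intro: order_trans[of 0 "?s * x"] mult_nonneg_nonneg)
  then have "?s * (x * y) \<le> of_int (snd a * snd b) / ?s"
    using sc_pos(2) by (simp add: le_divide_eq ac_simps)
  moreover have "0 \<le> fst a * fst b div sc"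
    using a b sc_pos(1) unfolding encl_def by (simp add: pos_imp_zdiv_nonneg_iff)
  ultimately show ?thesis
    using d[of "fst a * fst b"] d[of "snd a * snd b"] unfolding encl_def imul_def by auto
qed

lemma encl_add: "encl a x \<Longrightarrow> encl b y \<Longrightarrow> encl (iadd a b) (x + y)"
  unfolding encl_def iadd_def by (auto simp: distrib_left)

lemma encl_sub: "encl a x \<Longrightarrow> encl b y \<Longrightarrow> y \<le> x \<Longrightarrow> encl (isub a b) (x - y)"
proof -
  assume a: "encl a x" "encl b y" "y \<le> x"
  then have "0 \<le> of_int sc * x - of_int sc * y"
    using mult_left_mono[of y x "of_int sc"] sc_pos by auto
  then show ?thesis using a unfolding encl_def isub_def by (auto simp: right_diff_distrib max_def)
qed

lemma encl_muln: "encl a x \<Longrightarrow> 0 \<le> n \<Longrightarrow> encl (imuln a n) (x * of_int n)"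
  unfolding encl_def imuln_def
  by (auto simp: mult.assoc[symmetric] intro!: mult_right_mono)

lemma encl_divn: "encl a x \<Longrightarrow> 0 < n \<Longrightarrow> encl (idivn a n) (x / of_int n)"
proof -
  assume a: "encl a x" and n: "0 < n"
  have "of_int (fst a) / of_int n \<le> of_int sc * x / of_int n" "of_int sc * x / of_int n \<le> of_int (snd a) / of_int n"
    using a n unfolding encl_def by (auto intro!: divide_right_mono)
  then show ?thesis
    using of_int_div_bounds[OF n, of "fst a"] of_int_div_bounds[OF n, of "snd a"] a n
    unfolding encl_def idivn_def by (auto simp: pos_imp_zdiv_nonneg_iff)
qed

lemma encl_div: "encl a x \<Longrightarrow> encl b y \<Longrightarrow> 0 < fst b \<Longrightarrow> encl (idiv a b) (x / y)"
proof -
  assume a: "encl a x" and b: "encl b y" and p: "0 < fst b"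
  let ?s = "real_of_int sc"
  have x: "0 \<le> x" using a encl_nonneg by auto
  have fy: "of_int (fst b) \<le> ?s * y" "?s * y \<le> of_int (snd b)" using b by (auto simp: encl_def)
  have fp: "(0::real) < of_int (fst b)" using p by simp
  then have sy: "0 < ?s * y" using fy by linarith
  then have "0 < y" using sc_pos by (simp add: zero_less_mult_iff)
  have sp: "0 < snd b" using fy sy by (metis less_le_trans of_int_0_less_iff)
  have "of_int (fst a * sc) / of_int (snd b) \<le> (?s * x * ?s) / (?s * y)"
    using a fy sy sc_pos x unfolding encl_def of_int_mult by (intro frac_le mult_right_mono mult_nonneg_nonneg) auto
  also have "(?s * x * ?s) / (?s * y) = ?s * (x / y)" using sc_pos by simp
  finally have 1: "of_int (fst a * sc) / of_int (snd b) \<le> ?s * (x / y)" .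
  have "(?s * x * ?s) / (?s * y) \<le> of_int (snd a * sc) / of_int (fst b)"
    using a fy fp sc_pos x unfolding encl_def of_int_mult
    by (intro frac_le mult_right_mono) (auto intro!: mult_nonneg_nonneg intro: order_trans[of 0 "?s * x"])
  then have 2: "?s * (x / y) \<le> of_int (snd a * sc) / of_int (fst b)" using sc_pos by simp
  have "0 \<le> fst a * sc div snd b"
    using a sp sc_pos unfolding encl_def by (simp add: pos_imp_zdiv_nonneg_iff)
  then show ?thesis
    using 1 2 of_int_div_bounds[OF sp, of "fst a * sc"] of_int_div_bounds[OF p, of "snd a * sc"]
    unfolding encl_def idiv_def by auto
qed

section \<open>Enclosures of finite sequences\<close>

definition encl_list :: "ival list \<Rightarrow> (nat \<Rightarrow> real) \<Rightarrow> bool" where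
  "encl_list xs f \<longleftrightarrow> (\<forall>i<length xs. encl (xs ! i) (f i))"

lemma encl_list_Nil: "encl_list [] f"
  by (simp add: encl_list_def)

lemma encl_list_Cons: "encl_list (x # xs) f \<longleftrightarrow> encl x (f 0) \<and> encl_list xs (\<lambda>i. f (Suc i))"
  by (simp add: encl_list_def All_less_Suc2)

fun ipows :: "ival \<Rightarrow> ival \<Rightarrow> nat \<Rightarrow> ival list" where
  "ipows g p 0 = []"
| "ipows g p (Suc n) = p # ipows g (imul p g) n"

lemma encl_ipows: "encl g x \<Longrightarrow> encl p y \<Longrightarrow> encl_list (ipows g p n) (\<lambda>i. y * x ^ i)"
proof (induction n arbitrary: p y)
  case (Suc n)
  have "encl_list (ipows g (imul p g) n) (\<lambda>i. y * x * x ^ i)"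
    by (rule Suc.IH[OF Suc.prems(1) encl_mul[OF Suc.prems(2,1)]])
  then show ?case using Suc.prems by (simp add: encl_list_Cons mult.assoc)
qed (simp add: encl_list_Nil)

fun imap2 :: "ival list \<Rightarrow> ival list \<Rightarrow> ival list" where
  "imap2 (x # xs) (y # ys) = imul x y # imap2 xs ys"
| "imap2 _ _ = []"

lemma encl_imap2: "encl_list xs f \<Longrightarrow> encl_list ys g \<Longrightarrow> encl_list (imap2 xs ys) (\<lambda>i. f i * g i)"
  by (induction xs ys arbitrary: f g rule: imap2.induct) (auto simp: encl_list_Cons encl_list_Nil intro: encl_mul)

fun iadj :: "ival list \<Rightarrow> ival list" where
  "iadj (x # y # xs) = iadd x y # iadj (y # xs)"
| "iadj _ = []"

lemma encl_iadj: "encl_list xs f \<Longrightarrow> encl_list (iadj xs) (\<lambda>i. f i + f (Suc i))"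
proof (induction xs arbitrary: f rule: iadj.induct)
  case (1 x y xs)
  have "encl_list (iadj (y # xs)) (\<lambda>i. f (Suc i) + f (Suc (Suc i)))"
    by (rule "1.IH") (use "1.prems" in \<open>simp add: encl_list_Cons\<close>)
  then show ?case using "1.prems" by (auto simp: encl_list_Cons intro: encl_add)
qed (simp_all add: encl_list_Nil)

text \<open>The binomial transform, read off as the heads of iterated lists of adjacent sums.
  Pascal's rule replaces multiplications by binomial coefficients with additions of nonnegative
  enclosures.\<close>

fun ibinom :: "nat \<Rightarrow> ival list \<Rightarrow> ival list" where
  "ibinom (Suc n) (x # xs) = x # ibinom n (iadj (x # xs))"
| "ibinom _ _ = []"

lemma binomial_sum_shift:
  "(\<Sum>m\<le>Suc n. real (Suc n choose m) * f m) = (\<Sum>m\<le>n. real (n choose m) * (f m + f (Suc m)))"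
proof -
  have "(\<Sum>m\<le>Suc n. real (Suc n choose m) * f m) = f 0 + (\<Sum>m\<le>n. real (n choose m) * f (Suc m) + real (n choose Suc m) * f (Suc m))"
    by (subst sum.atMost_Suc_shift) (simp add: distrib_right)
  also have "\<dots> = (\<Sum>m\<le>n. real (n choose m) * f (Suc m)) + (f 0 + (\<Sum>m\<le>n. real (n choose Suc m) * f (Suc m)))"
    by (simp add: sum.distrib)
  also have "f 0 + (\<Sum>m\<le>n. real (n choose Suc m) * f (Suc m)) = (\<Sum>m\<le>Suc n. real (n choose m) * f m)"
    by (subst sum.atMost_Suc_shift) simp
  also have "\<dots> = (\<Sum>m\<le>n. real (n choose m) * f m)" by simp
  finally show ?thesis by (simp add: sum.distrib distrib_left)
qed

lemma encl_ibinom: "encl_list xs f \<Longrightarrow> encl_list (ibinom n xs) (\<lambda>i. \<Sum>m\<le>i. real (i choose m) * f m)"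
proof (induction n arbitrary: xs f)
  case 0
  then show ?case by (simp add: encl_list_Nil)
next
  case (Suc n)
  show ?case
  proof (cases xs)
    case (Cons y ys)
    have "encl_list (ibinom n (iadj xs)) (\<lambda>i. \<Sum>m\<le>i. real (i choose m) * (f m + f (Suc m)))"
      by (rule Suc.IH[OF encl_iadj[OF Suc.prems]])
    then show ?thesis
      using Suc.prems unfolding binomial_sum_shift[symmetric] Cons by (simp add: encl_list_Cons)
  qed (simp add: encl_list_Nil)
qed

fun idivs :: "int \<Rightarrow> ival list \<Rightarrow> ival list" where
  "idivs d (x # xs) = idivn x d # idivs (d + 2) xs"
| "idivs d [] = []"

lemma encl_idivs: "encl_list xs f \<Longrightarrow> 0 < d \<Longrightarrow> encl_list (idivs d xs) (\<lambda>i. f i / (of_int d + 2 * real i))"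
proof (induction xs arbitrary: d f)
  case (Cons x xs)
  have "encl_list (idivs (d + 2) xs) (\<lambda>i. f (Suc i) / (of_int (d + 2) + 2 * real i))"
    using Cons.prems by (intro Cons.IH) (auto simp: encl_list_Cons)
  then show ?case using Cons.prems encl_divn[of x "f 0" d] by (simp add: encl_list_Cons algebra_simps)
qed (simp add: encl_list_Nil)

text \<open>The recursion of \<open>radial_J_reduction\<close> after scaling by powers of the
  difference \<open>gap\<close> minus tau^2, started at index 1.\<close>

fun ilog_rec :: "ival \<Rightarrow> ival \<Rightarrow> ival \<Rightarrow> int \<Rightarrow> nat \<Rightarrow> ival list" where
  "ilog_rec c t l j 0 = []"
| "ilog_rec c t l j (Suc n) = l # ilog_rec c t (idivn (imul (iadd t (imuln l (2 * j - 1))) c) (2 * j)) (j + 1) n"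

lemma encl_ilog_rec:
  assumes c: "encl c C" and t: "encl t T"
    and f: "\<And>j. 1 \<le> j \<Longrightarrow> f (Suc j) = (T + f j * (2 * real j - 1)) * C / (2 * real j)"
  shows "1 \<le> j \<Longrightarrow> encl l (f j) \<Longrightarrow> encl_list (ilog_rec c t l (int j) n) (\<lambda>i. f (j + i))"
proof (induction n arbitrary: l j)
  case (Suc n)
  have "encl (idivn (imul (iadd t (imuln l (2 * int j - 1))) c) (2 * int j)) ((T + f j * of_int (2 * int j - 1)) * C / of_int (2 * int j))"
    using Suc.prems by (intro encl_divn encl_mul encl_add encl_muln c t) auto
  then have "encl (idivn (imul (iadd t (imuln l (2 * int j - 1))) c) (2 * int j)) (f (Suc j))"
    using f[OF Suc.prems(1)] by simp
  from Suc.IH[OF _ this] Suc.prems show ?case by (simp add: encl_list_Cons add.commute)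
qed (simp add: encl_list_Nil)

text \<open>The scaled recursion of \<open>radial_J_step\<close>: \<open>ls\<close> holds the
  integrals with i = 0, \<open>x0\<close> the scale, and \<open>q\<close> the factor golden = 1 / (1
  - gap). The subtraction is clipped, hence the sign hypothesis in
  \<open>encl_istep_rec\<close>.\<close>

fun istep_rec :: "ival \<Rightarrow> ival \<Rightarrow> ival \<Rightarrow> ival list \<Rightarrow> ival list" where
  "istep_rec x0 q e [] = [e]"
| "istep_rec x0 q e (l # ls) = e # istep_rec x0 q (imul (isub l (imul x0 e)) q) ls"

lemma encl_istep_rec:
  assumes x0: "encl x0 X" and q: "encl q Q"
    and h: "\<And>k. h (Suc k) = (f (Suc k) - X * h k) * Q" "\<And>k. X * h k \<le> f (Suc k)"
  shows "encl e (h k) \<Longrightarrow> encl_list ls (\<lambda>i. f (Suc k + i)) \<Longrightarrow> encl_list (istep_rec x0 q e ls) (\<lambda>i. h (k + i))"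
proof (induction ls arbitrary: e k)
  case (Cons l ls)
  have "encl (imul (isub l (imul x0 e)) q) (h (Suc k))"
    unfolding h(1) using Cons.prems h(2)[of k] by (intro encl_mul encl_sub x0 q) (auto simp: encl_list_Cons)
  moreover have "encl_list ls (\<lambda>i. f (Suc (Suc k) + i))"
    using Cons.prems by (simp add: encl_list_Cons)
  ultimately show ?case using Cons.prems Cons.IH[of _ "Suc k"] by (simp add: encl_list_Cons)
qed (simp add: encl_list_Nil encl_list_Cons)

fun irising :: "ival \<Rightarrow> int \<Rightarrow> nat \<Rightarrow> ival list" where
  "irising r k 0 = []"
| "irising r k (Suc n) = r # irising (idivn (imuln r (5 + 2 * k)) (2 * k + 2)) (k + 1) n"

lemma encl_irising:
  assumes f: "\<And>k. f (Suc k) = f k * (5 + 2 * real k) / (2 * real k + 2)"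
  shows "encl r (f k) \<Longrightarrow> encl_list (irising r (int k) n) (\<lambda>i. f (k + i))"
proof (induction n arbitrary: r k)
  case (Suc n)
  have "encl (idivn (imuln r (5 + 2 * int k)) (2 * int k + 2)) (f k * of_int (5 + 2 * int k) / of_int (2 * int k + 2))"
    using Suc.prems by (intro encl_divn encl_muln) auto
  then have "encl (idivn (imuln r (5 + 2 * int k)) (2 * int k + 2)) (f (Suc k))"
    using f[of k] by simp
  from Suc.IH[OF this] Suc.prems show ?case by (simp add: encl_list_Cons add.commute)
qed (simp add: encl_list_Nil)

text \<open>At x = golden one has x^2 - 1 = x, so the term x (x^2 - 1)^(k + 1) in the recursion of
  \<open>sinh_poly\<close> is the plain power golden^(k + 2), carried along as
  \<open>p\<close>.\<close>

fun isinh :: "ival \<Rightarrow> ival \<Rightarrow> ival \<Rightarrow> int \<Rightarrow> nat \<Rightarrow> ival list" where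
  "isinh g p s k 0 = []"
| "isinh g p s k (Suc n) = s # isinh g (imul p g) (idivn (isub p (imuln s (2 * k + 2))) (2 * k + 3)) (k + 1) n"

lemma encl_isinh:
  assumes g: "encl g G"
    and f: "\<And>k. f (Suc k) = (G ^ (k + 2) - f k * (2 * real k + 2)) / (2 * real k + 3)" "\<And>k. f k * (2 * real k + 2) \<le> G ^ (k + 2)"
  shows "encl p (G ^ (k + 2)) \<Longrightarrow> encl s (f k) \<Longrightarrow> encl_list (isinh g p s (int k) n) (\<lambda>i. f (k + i))"
proof (induction n arbitrary: p s k)
  case (Suc n)
  have "encl (idivn (isub p (imuln s (2 * int k + 2))) (2 * int k + 3)) ((G ^ (k + 2) - f k * of_int (2 * int k + 2)) / of_int (2 * int k + 3))"
    using Suc.prems f(2)[of k] by (intro encl_divn encl_sub encl_muln) auto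
  then have s': "encl (idivn (isub p (imuln s (2 * int k + 2))) (2 * int k + 3)) (f (Suc k))"
    using f(1)[of k] by simp
  have "encl (imul p g) (G ^ (Suc k + 2))"
    using encl_mul[OF Suc.prems(1) g] by (simp add: mult.commute)
  from Suc.IH[OF this s'] Suc.prems show ?case by (simp add: encl_list_Cons add.commute)
qed (simp add: encl_list_Nil)

fun isum :: "ival list \<Rightarrow> ival" where
  "isum [] = (0, 0)"
| "isum (x # xs) = iadd x (isum xs)"

lemma encl_isum: "encl_list xs f \<Longrightarrow> encl (isum xs) (\<Sum>i<length xs. f i)"
proof (induction xs arbitrary: f)
  case Nil
  then show ?case by (simp add: encl_def)
next
  case (Cons x xs)
  then have "encl (iadd x (isum xs)) (f 0 + (\<Sum>i<length xs. f (Suc i)))"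
    by (intro encl_add) (auto simp: encl_list_Cons)
  then show ?case by (simp add: sum.lessThan_Suc_shift del: sum.lessThan_Suc)
qed

fun iweigh :: "int \<Rightarrow> ival list \<Rightarrow> ival list" where
  "iweigh k [] = []"
| "iweigh k (x # xs) = imuln x k # iweigh (k + 1) xs"

lemma encl_iweigh: "encl_list xs f \<Longrightarrow> 0 \<le> k \<Longrightarrow> encl_list (iweigh k xs) (\<lambda>i. f i * (of_int k + real i))"
proof (induction xs arbitrary: k f)
  case (Cons x xs)
  have "encl_list (iweigh (k + 1) xs) (\<lambda>i. f (Suc i) * (of_int (k + 1) + real i))"
    using Cons.prems by (intro Cons.IH) (auto simp: encl_list_Cons)
  then show ?case using Cons.prems encl_muln[of x "f 0" k] by (simp add: encl_list_Cons algebra_simps)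
qed (simp add: encl_list_Nil)

text \<open>The difference of artanh and the partial sum vanishes at 0 and has derivative y^(2n) /
  (1 - y^2), which on [0, x] lies between 0 and its value at x.\<close>

lemma artanh_partial_sum:
  fixes x :: real assumes x: "0 \<le> x" "x < 1"
  shows "(\<Sum>k<n. x * (x\<^sup>2) ^ k / (1 + 2 * real k)) \<le> artanh x"
    and "artanh x \<le> (\<Sum>k<n. x * (x\<^sup>2) ^ k / (1 + 2 * real k)) + x * (x\<^sup>2) ^ n / (1 - x\<^sup>2)"
proof -
  define S where "S y = (\<Sum>k<n. y ^ Suc (2 * k) / real (Suc (2 * k)))" for y :: real
  have S_eq: "S x = (\<Sum>k<n. x * (x\<^sup>2) ^ k / (1 + 2 * real k))"
    unfolding S_def by (intro sum.cong) (auto simp: power_mult)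
  have dS: "DERIV S y :> (\<Sum>k<n. (y\<^sup>2) ^ k)" for y
    unfolding S_def
  proof (rule DERIV_sum)
    fix k
    have "DERIV (\<lambda>y. y ^ Suc (2 * k) / real (Suc (2 * k))) y :> real (Suc (2 * k)) * y ^ (Suc (2 * k) - Suc 0) / real (Suc (2 * k))"
      by (intro DERIV_cdivide DERIV_pow)
    then show "DERIV (\<lambda>y. y ^ Suc (2 * k) / real (Suc (2 * k))) y :> (y\<^sup>2) ^ k"
      by (simp add: power_mult del: of_nat_Suc)
  qed
  have d: "DERIV (\<lambda>y. artanh y - S y) y :> (y\<^sup>2) ^ n / (1 - y\<^sup>2)" if y: "0 \<le> y" "y \<le> x" for y
  proof -
    have y1: "\<bar>y\<bar> < 1" and ne: "y\<^sup>2 < 1" using y x by (auto simp: abs_square_less_1)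
    have "DERIV (\<lambda>y. artanh y - S y) y :> 1 / (1 - y\<^sup>2) - (\<Sum>k<n. (y\<^sup>2) ^ k)"
      by (intro DERIV_diff artanh_real_has_field_derivative y1 dS)
    also have "(\<Sum>k<n. (y\<^sup>2) ^ k) = (1 - (y\<^sup>2) ^ n) / (1 - y\<^sup>2)"
      using ne by (subst sum_gp_strict) auto
    also have "1 / (1 - y\<^sup>2) - (1 - (y\<^sup>2) ^ n) / (1 - y\<^sup>2) = (y\<^sup>2) ^ n / (1 - y\<^sup>2)"
      by (simp flip: diff_divide_distrib)
    finally show ?thesis .
  qed
  have x1: "x\<^sup>2 < 1" using x by (simp add: abs_square_less_1)
  have "artanh 0 - S 0 \<le> artanh x - S x"
  proof (rule DERIV_nonneg_imp_nondecreasing[OF x(1)])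
    fix y assume y: "0 \<le> y" "y \<le> x"
    have "y\<^sup>2 \<le> x\<^sup>2" using y by (intro power_mono) auto
    then have "0 \<le> (y\<^sup>2) ^ n / (1 - y\<^sup>2)" using x1 by (intro divide_nonneg_nonneg) auto
    then show "\<exists>D. DERIV (\<lambda>y. artanh y - S y) y :> D \<and> 0 \<le> D" using d[OF y] by blast
  qed
  moreover have S0: "S 0 = 0" by (simp add: S_def)
  ultimately show "(\<Sum>k<n. x * (x\<^sup>2) ^ k / (1 + 2 * real k)) \<le> artanh x" using S_eq by simp
  define M where "M = (x\<^sup>2) ^ n / (1 - x\<^sup>2)"
  have "M * 0 - (artanh 0 - S 0) \<le> M * x - (artanh x - S x)"
  proof (rule DERIV_nonneg_imp_nondecreasing[OF x(1)])
    fix y assume y: "0 \<le> y" "y \<le> x"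
    have "y\<^sup>2 \<le> x\<^sup>2" using y by (intro power_mono) auto
    moreover from this have "(y\<^sup>2) ^ n \<le> (x\<^sup>2) ^ n" by (rule power_mono) simp
    ultimately have "(y\<^sup>2) ^ n / (1 - y\<^sup>2) \<le> M"
      unfolding M_def using x1 by (intro frac_le) simp_all
    moreover have "DERIV (\<lambda>y. M * y - (artanh y - S y)) y :> M * 1 - (y\<^sup>2) ^ n / (1 - y\<^sup>2)"
      by (intro DERIV_diff DERIV_cmult DERIV_ident d[OF y])
    ultimately show "\<exists>D. DERIV (\<lambda>y. M * y - (artanh y - S y)) y :> D \<and> 0 \<le> D" by fastforce
  qed
  then have "artanh x \<le> S x + M * x" using S0 by simp
  then show "artanh x \<le> (\<Sum>k<n. x * (x\<^sup>2) ^ k / (1 + 2 * real k)) + x * (x\<^sup>2) ^ n / (1 - x\<^sup>2)"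
    unfolding S_eq M_def by (simp add: mult.commute)
qed

text \<open>Candidates for the two ends are supplied from outside; only integer comparisons of their
  squares have to be checked.\<close>

lemma encl_sqrt:
  assumes "encl a (x\<^sup>2)" "0 \<le> x" "0 \<le> l" "l * l \<le> sc * fst a" "0 \<le> u" "sc * snd a \<le> u * u"
  shows "encl (l, u) x"
proof -
  let ?s = "real_of_int sc"
  have sx: "0 \<le> ?s * x" using assms(2) sc_pos by simp
  have e: "(?s * x)\<^sup>2 = ?s * (?s * x\<^sup>2)" by (simp add: power_mult_distrib power2_eq_square)
  have "(real_of_int l)\<^sup>2 \<le> of_int (sc * fst a)"
    using assms(4) unfolding power2_eq_square of_int_mult[symmetric] of_int_le_iff .
  also have "\<dots> \<le> (?s * x)\<^sup>2"
    unfolding e of_int_mult using assms(1) sc_pos unfolding encl_def by (intro mult_left_mono) auto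
  finally have 1: "of_int l \<le> ?s * x" using sx by (rule power2_le_imp_le)
  have "(?s * x)\<^sup>2 \<le> of_int (sc * snd a)"
    unfolding e of_int_mult using assms(1) sc_pos unfolding encl_def by (intro mult_left_mono) auto
  also have "\<dots> \<le> (real_of_int u)\<^sup>2"
    using assms(6) unfolding power2_eq_square of_int_mult[symmetric] of_int_le_iff .
  finally have "?s * x \<le> of_int u" by (rule power2_le_imp_le) (use assms(5) in simp)
  with 1 assms(3) show ?thesis by (simp add: encl_def)
qed

definition ione :: ival where "ione = (sc, sc)"

lemma encl_one: "encl ione 1"
  by (simp add: encl_def ione_def sc_def)

lemma encl_numeral: "0 \<le> n \<Longrightarrow> encl (imuln ione n) (of_int n)"
  using encl_muln[OF encl_one, of n] by simp

text \<open>
  The truncation error is at most a constant times the first neglected term.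
\<close>

definition itail :: "int \<Rightarrow> nat \<Rightarrow> ival list \<Rightarrow> ival" where
  "itail c n W = (fst (isum (take n W)), snd (isum (take n W)) + c * snd (W ! n))"

lemma encl_itail:
  assumes W: "encl_list W f" and n: "n < length W"
    and v: "(\<Sum>i<n. f i) \<le> v" "v \<le> (\<Sum>i<n. f i) + C * f n" and C: "0 \<le> C" "C \<le> of_int c"
  shows "encl (itail c n W) v"
proof -
  have "encl_list (take n W) f" using W by (simp add: encl_list_def)
  from encl_isum[OF this] have s: "encl (isum (take n W)) (\<Sum>i<n. f i)" using n by simp
  have w: "encl (W ! n) (f n)" using W n by (simp add: encl_list_def)
  have "of_int sc * (C * f n) = C * (of_int sc * f n)" by simp
  also have "\<dots> \<le> of_int c * of_int (snd (W ! n))"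
    using w C encl_nonneg[OF w] sc_pos unfolding encl_def by (intro mult_mono) auto
  finally have "of_int sc * (C * f n) \<le> of_int c * of_int (snd (W ! n))" .
  moreover have "of_int sc * v \<le> of_int sc * (\<Sum>i<n. f i) + of_int sc * (C * f n)"
    using v(2) mult_left_mono[of v "(\<Sum>i<n. f i) + C * f n" "of_int sc"] sc_pos by (simp add: distrib_left)
  moreover have "of_int sc * (\<Sum>i<n. f i) \<le> of_int sc * v"
    using v(1) sc_pos by (intro mult_left_mono) auto
  ultimately show ?thesis
    using s unfolding encl_def itail_def by auto
qed

text \<open>Separate from \<open>iartanh\<close> so that the list of powers, used twice, is passed
  as one argument.\<close>

definition iartanh_sum :: "nat \<Rightarrow> ival \<Rightarrow> ival list \<Rightarrow> ival" where
  "iartanh_sum n y ps = iadd (isum (take n (idivs 1 ps))) (0, snd (idiv (ps ! n) y))"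

definition iartanh :: "nat \<Rightarrow> ival \<Rightarrow> ival" where
  "iartanh n x = iartanh_sum n (isub ione (imul x x)) (ipows (imul x x) x (Suc n))"

lemma length_ipows: "length (ipows g p n) = n"
  by (induction n arbitrary: p) auto

lemma length_idivs: "length (idivs d xs) = length xs"
  by (induction xs arbitrary: d) auto

lemma encl_artanh:
  assumes x: "encl a x" "x < 1" and p: "0 < fst (isub ione (imul a a))"
  shows "encl (iartanh n a) (artanh x)"
proof -
  let ?ps = "ipows (imul a a) a (Suc n)"
  have x0: "0 \<le> x" using x encl_nonneg by auto
  have x2: "encl (imul a a) (x\<^sup>2)" using encl_mul[OF x(1) x(1)] by (simp add: power2_eq_square)
  have "x\<^sup>2 \<le> 1" using x0 x by (simp add: power_le_one)
  have ps: "encl_list ?ps (\<lambda>i. x * (x\<^sup>2) ^ i)" by (rule encl_ipows[OF x2 x(1)])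
  have "encl_list (idivs 1 ?ps) (\<lambda>i. x * (x\<^sup>2) ^ i / (of_int 1 + 2 * real i))"
    by (rule encl_idivs[OF ps]) simp
  then have "encl_list (take n (idivs 1 ?ps)) (\<lambda>i. x * (x\<^sup>2) ^ i / (1 + 2 * real i))"
    by (simp add: encl_list_def del: ipows.simps idivs.simps)
  from encl_isum[OF this] have s: "encl (isum (take n (idivs 1 ?ps))) (\<Sum>i<n. x * (x\<^sup>2) ^ i / (1 + 2 * real i))"
    by (simp only: length_take length_idivs length_ipows min_def) simp
  have "encl (?ps ! n) (x * (x\<^sup>2) ^ n)" using ps unfolding encl_list_def length_ipows by blast
  then have t: "encl (idiv (?ps ! n) (isub ione (imul a a))) (x * (x\<^sup>2) ^ n / (1 - x\<^sup>2))"
    by (rule encl_div[OF _ encl_sub[OF encl_one x2 \<open>x\<^sup>2 \<le> 1\<close>] p])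
  have "of_int sc * artanh x \<le> of_int sc * ((\<Sum>k<n. x * (x\<^sup>2) ^ k / (1 + 2 * real k)) + x * (x\<^sup>2) ^ n / (1 - x\<^sup>2))"
    "of_int sc * (\<Sum>k<n. x * (x\<^sup>2) ^ k / (1 + 2 * real k)) \<le> of_int sc * artanh x"
    using artanh_partial_sum[OF x0 x(2), of n] sc_pos by (auto intro!: mult_left_mono)
  then show ?thesis
    using s t unfolding encl_def iartanh_def iartanh_sum_def iadd_def distrib_left by auto
qed

text \<open>Multiplying the n-th coefficient by n! turns the convolution with 1 / (n - m)! into a
  binomial transform. The factorials disappear, and the numbers stay of a size suited to fixed-point
  arithmetic.\<close>

lemma iter_coeff_binomial:
  "iter_coeff c d (\<lambda>m. K * f m / fact m) n
     = (K * c ^ (d + 1)) * ((c\<^sup>2) ^ n / (of_nat (d + 1) + 2 * real n) * (\<Sum>m\<le>n. real (n choose m) * f m)) / fact n"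
proof -
  have "(\<Sum>m\<le>n. K * f m / fact m / fact (n - m)) = K * (\<Sum>m\<le>n. real (n choose m) * f m) / fact n"
    unfolding sum_distrib_left sum_divide_distrib by (intro sum.cong) (auto simp: binomial_fact field_simps)
  moreover have "c ^ (2 * n + d + 1) = c ^ (d + 1) * (c\<^sup>2) ^ n"
    by (simp add: power_add power_mult)
  moreover have "real (2 * n + d + 1) = of_nat (d + 1) + 2 * real n" by simp
  moreover have "(A * B) / r * (K * S / F) = (K * A) * (B / r * S) / F" for A B r S F :: real
    by (simp add: ac_simps)
  ultimately show ?thesis
    unfolding iter_coeff_def by (simp only:)
qed

text \<open>
  The factors \<open>1 *\<close> and the integer coercions give the terms the syntactic shape in which the
  soundness lemmas of \<open>ipows\<close> and \<open>idivs\<close> deliver them.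
\<close>

definition inner_sum :: "real \<Rightarrow> real \<Rightarrow> nat \<Rightarrow> real" where
  "inner_sum g4 g3 k = (\<Sum>m\<le>k. real (k choose m) * (1 * g3 ^ m / (of_int 2 + 2 * real m) *
     (\<Sum>l\<le>m. real (m choose l) * (1 * g4 ^ l / (of_int 1 + 2 * real l)))))"

lemma moment_inner_sum:
  "moment c2 c3 c4 k = (c2 * c4 * c3\<^sup>2 * c2\<^sup>2) * ((c2\<^sup>2) ^ k / (3 + 2 * real k) * inner_sum (c4\<^sup>2) (c3\<^sup>2) k)"
proof -
  let ?h1 = "\<lambda>m. (c4\<^sup>2) ^ m / (of_int 1 + 2 * real m)"
  let ?h2 = "\<lambda>m. (c3\<^sup>2) ^ m / (of_int 2 + 2 * real m) * (\<Sum>l\<le>m. real (m choose l) * ?h1 l)"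
  have s1: "(\<Sum>m\<le>n. real (n choose m) * (if m = 0 then 1 else 0)) = 1" for n
    by (subst sum.mono_neutral_cong_right[of "{..n}" "{0}" _ "\<lambda>_. 1"]) auto
  have d: "(\<lambda>m. if m = 0 then 1 else 0) = (\<lambda>m::nat. 1 * (if m = 0 then 1 else 0) / fact m :: real)"
    by (rule ext) auto
  have 1: "iter_coeff c4 0 (\<lambda>m. if m = 0 then 1 else 0) = (\<lambda>n. c4 * ?h1 n / fact n)"
    by (rule ext, subst d, subst iter_coeff_binomial) (simp add: s1)
  have 2: "iter_coeff c3 1 (\<lambda>n. c4 * ?h1 n / fact n) = (\<lambda>n. (c4 * c3\<^sup>2) * ?h2 n / fact n)"
    by (rule ext, subst iter_coeff_binomial) (simp add: power2_eq_square)
  show ?thesis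
    unfolding moment_def 1 2 iter_coeff_binomial inner_sum_def
    by (simp add: power2_eq_square power3_eq_cube eval_nat_numeral ac_simps)
qed

definition iinner :: "ival \<Rightarrow> ival \<Rightarrow> nat \<Rightarrow> ival list" where
  "iinner g4 g3 n = ibinom n (imap2 (idivs 2 (ipows g3 ione n)) (ibinom n (idivs 1 (ipows g4 ione n))))"

lemma encl_iinner: "encl g4 x \<Longrightarrow> encl g3 y \<Longrightarrow> encl_list (iinner g4 g3 n) (inner_sum x y)"
  unfolding iinner_def inner_sum_def[abs_def]
  by (intro encl_ibinom encl_imap2 encl_idivs encl_ipows encl_one) auto

section \<open>Computable enclosures of the constants and of the two volumes\<close>

definition igolden :: ival where "igolden = (1865466180814546881, 1865466180814546882)"

lemma encl_golden: "encl igolden golden"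
proof -
  let ?s = "real_of_int sc"
  have "?s * golden = (?s + sqrt (5 * ?s\<^sup>2)) / 2"
    using sc_pos by (simp add: golden_def real_sqrt_mult distrib_left)
  moreover have "2 * 1865466180814546881 - ?s \<le> sqrt (5 * ?s\<^sup>2)"
    by (rule real_le_rsqrt) (simp add: sc_def power2_eq_square)
  moreover have "sqrt (5 * ?s\<^sup>2) \<le> 2 * 1865466180814546882 - ?s"
    by (rule real_le_lsqrt) (simp_all add: sc_def power2_eq_square)
  ultimately show ?thesis by (simp add: encl_def igolden_def)
qed

text \<open>\<open>igap\<close> encloses c3^2 and 1 - c1^2, which coincide; \<open>ic1\<close>,
  \<open>ig2\<close>, \<open>ig4\<close> enclose c1^2, c2^2, c4^2, and \<open>iK\<close> the common
  factor of the moments.\<close>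

definition "igap = isub (imuln ione 2) igolden"
definition "ic1 = isub igolden ione"
definition "ig2 = idiv igap (iadd (imuln ione 2) igolden)"
definition "ig4 = isub (imuln ione 7) (imuln igolden 4)"
definition "iK = imul (imul (isub (imuln igolden 2) (imuln ione 3)) igap) ig2"

lemma encl_igap: "encl igap (2 - golden)"
  unfolding igap_def using encl_sub[OF encl_numeral[of 2] encl_golden] golden_pos by simp

lemma encl_ig4: "encl ig4 (7 - 4 * golden)"
  unfolding ig4_def using encl_sub[OF encl_numeral[of 7] encl_muln[OF encl_golden, of 4]] golden_bounds(2) by (simp add: mult.commute)

lemma encl_ig2: "encl ig2 ((2 - golden) / (2 + golden))"
proof -
  have "0 < fst (iadd (imuln ione 2) igolden)" by (simp add: iadd_def imuln_def ione_def igolden_def sc_def)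
  then show ?thesis
    unfolding ig2_def using encl_div[OF encl_igap encl_add[OF encl_numeral[of 2] encl_golden]] by simp
qed

lemma encl_iK: "encl iK ((2 * golden - 3) * (2 - golden) * ((2 - golden) / (2 + golden)))"
  unfolding iK_def using encl_sub[OF encl_muln[OF encl_golden, of 2] encl_numeral[of 3]] golden_bounds(1)
  by (intro encl_mul encl_igap encl_ig2) (simp add: mult.commute)

definition iball_volume4 :: "nat \<Rightarrow> ival" where
  "iball_volume4 n = imul iK (itail 3 n (imap2 (imap2 (irising ione 0 (Suc n))
     (imap2 (idivs 3 (ipows ig2 ione (Suc n))) (iinner ig4 igap (Suc n)))) (tl (isinh igolden (imul igolden igolden) ic1 0 (n + 2)))))"

text \<open>With \<open>k2\<close> enclosing the square of \<open>\<kappa>\<close> these enclose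
  tau^2, the difference \<open>gap\<close> minus tau^2, and the quotient of c1^2 by that
  difference.\<close>

definition "itausq k2 = idiv k2 (iadd igolden k2)"
definition "ix0 k2 = isub igap (itausq k2)"
definition "iratio k2 = idiv ic1 (ix0 k2)"

text \<open>The two \<open>tl\<close> drop the indices 0 and 1, since the volume series starts with
  k + 2 = 2.\<close>

definition iJ :: "ival \<Rightarrow> ival \<Rightarrow> nat \<Rightarrow> nat \<Rightarrow> ival list" where
  "iJ k2 t m n = tl (tl (istep_rec (ix0 k2) igolden (iartanh m t)
     (ilog_rec (idiv (ix0 k2) igap) t (imul (imul (iartanh m (imul t igolden)) igolden) (ix0 k2)) 1 n)))"

text \<open>The coefficient (k + 1)(k + 2) / 2 of the series over the 2 k + 4 of the y1-integral
  leaves (k + 1) / 4, hence \<open>iweigh 1\<close> and the division by 4. The powers of c1 join the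
  scale of the height integrals in \<open>iratio\<close>, two of whose factors are pulled out in
  front.\<close>

definition iorthoscheme :: "ival \<Rightarrow> ival \<Rightarrow> nat \<Rightarrow> int \<Rightarrow> nat \<Rightarrow> ival" where
  "iorthoscheme k2 t m c n = imul (idivn (imul iK (imul (iratio k2) (iratio k2))) 4)
     (itail c n (iweigh 1 (imap2 (imap2 (idivs 3 (ipows (imul ig2 (iratio k2)) ione (Suc n))) (iinner ig4 igap (Suc n))) (iJ k2 t m (n + 2)))))"

definition iprofile :: "ival \<Rightarrow> ival \<Rightarrow> nat \<Rightarrow> ival" where
  "iprofile k2 t m = iadd (iadd (idiv t (imuln (imul (isub ione (itausq k2)) (isub ione (itausq k2))) 4))
     (idiv (imuln t 3) (imuln (isub ione (itausq k2)) 8))) (idivn (imuln (iartanh m t) 3) 8)"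

text \<open>All conditions on the candidate \<open>t\<close> and on denominators, gathered so that a
  single evaluation decides them.\<close>

definition itau_valid :: "ival \<Rightarrow> ival \<Rightarrow> bool" where
  "itau_valid k2 t \<longleftrightarrow> 0 \<le> fst t \<and> fst t * fst t \<le> sc * fst (itausq k2) \<and> 0 \<le> snd t \<and> sc * snd (itausq k2) \<le> snd t * snd t
     \<and> 0 < fst (ix0 k2) \<and> 0 < fst (isub ione (imul t t)) \<and> 0 < fst (isub ione (imul (imul t igolden) (imul t igolden)))
     \<and> 0 < fst (imul (isub ione (itausq k2)) (isub ione (itausq k2))) \<and> 0 < fst (isub ione (itausq k2))"

definition "k2_0 = idivn ione 4"
definition "k2_2 = idivn ione 2"

text \<open>
  The height is \<open>artanh \<tau>\<close>; the two pairs are integer square roots of the enclosures of \<open>\<tau>\<^sup>2\<close>.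
\<close>

definition t_0 :: ival where "t_0 = (421771623359782017, 421771623359782019)"
definition t_2 :: ival where "t_2 = (560167978914400347, 560167978914400351)"

section \<open>Numerical enclosures\<close>

lemma length_iadj: "length (iadj xs) = length xs - 1"
  by (induction xs rule: iadj.induct) auto

lemma length_ibinom: "length (ibinom n xs) = min n (length xs)"
  by (induction n xs rule: ibinom.induct) (auto simp: length_iadj)

lemma length_imap2: "length (imap2 xs ys) = min (length xs) (length ys)"
  by (induction xs ys rule: imap2.induct) auto

lemma length_iinner: "length (iinner g4 g3 n) = n"
  by (simp add: iinner_def length_ibinom length_imap2 length_idivs length_ipows)

lemma length_ilog_rec: "length (ilog_rec c t l j n) = n"
  by (induction n arbitrary: l j) auto

lemma length_istep_rec: "length (istep_rec x0 q e ls) = Suc (length ls)"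
  by (induction ls arbitrary: e) auto

lemma length_irising: "length (irising r k n) = n"
  by (induction n arbitrary: r k) auto

lemma length_isinh: "length (isinh g p s k n) = n"
  by (induction n arbitrary: p s k) auto

lemma length_iweigh: "length (iweigh k xs) = length xs"
  by (induction xs arbitrary: k) auto

lemma encl_list_tl: "encl_list xs f \<Longrightarrow> encl_list (tl xs) (\<lambda>i. f (Suc i))"
  by (cases xs) (auto simp: encl_list_Cons encl_list_Nil)

lemma rising_3: "rising 3 k = (real k + 1) * (real k + 2) / 2"
proof (induction k)
  case 0
  then show ?case by (simp add: rising_def)
next
  case (Suc k)
  then show ?case unfolding rising_Suc by (simp add: field_simps)
qed

lemma golden_minus_1: "(golden - 1) * golden = 1"
  by (simp add: algebra_simps golden_sq)

lemma encl_igolden_pos: "0 < fst igolden" "0 < fst igap"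
  by (simp_all add: igolden_def igap_def isub_def imuln_def ione_def sc_def)

lemma encl_ic1: "encl ic1 (golden - 1)"
  unfolding ic1_def using encl_sub[OF encl_golden encl_one] golden_pos by simp

context coxeter_frame
begin

definition "K0 = (2 * golden - 3) * (2 - golden) * ((2 - golden) / (2 + golden))"

lemma c4_sq: "c4\<^sup>2 = 7 - 4 * golden"
  by (simp add: c_sq algebra_simps golden_sq)

text \<open>Although c2 and c4 are irrational over Q(golden), their product is 2 golden - 3, so the
  moments need no square roots: (2 - golden)(7 - 4 golden) = (2 golden - 3)^2 (2 + golden).\<close>

lemma moment_factor: "c2 * c4 * c3\<^sup>2 * c2\<^sup>2 = K0"
proof -
  have "c2 * c4 = 2 * golden - 3"
  proof (rule power2_eq_imp_eq)
    have "(2 - golden) * (7 - 4 * golden) = (2 * golden - 3)\<^sup>2 * (2 + golden)"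
      by (simp add: power2_eq_square algebra_simps golden_sq golden_sq')
    moreover have "2 + golden \<noteq> 0" using golden_pos by simp
    ultimately show "(c2 * c4)\<^sup>2 = (2 * golden - 3)\<^sup>2"
      unfolding power_mult_distrib c4_sq c_sq(2) by (simp add: divide_eq_eq)
  qed (use c_pos golden_bounds in auto)
  then show ?thesis by (simp add: K0_def c_sq)
qed

lemma K0_pos: "0 < K0"
  using moment_factor c_pos by (metis mult_pos_pos zero_less_power)

lemma moment_eq: "moment c2 c3 c4 k = K0 * (1 * ((2 - golden) / (2 + golden)) ^ k / (of_int 3 + 2 * real k) * inner_sum (7 - 4 * golden) (2 - golden) k)"
  unfolding moment_inner_sum unfolding moment_factor unfolding c4_sq c_sq(2,3) by simp

lemma encl_moment:
  "encl_list (imap2 (idivs 3 (ipows ig2 ione n)) (iinner ig4 igap n))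
     (\<lambda>k. 1 * ((2 - golden) / (2 + golden)) ^ k / (of_int 3 + 2 * real k) * inner_sum (7 - 4 * golden) (2 - golden) k)"
  by (intro encl_imap2 encl_idivs encl_ipows encl_ig2 encl_one encl_iinner encl_ig4 encl_igap) simp

lemma gap_eq: "gap = (golden - 1)\<^sup>2"
  by (simp add: gap_def power2_eq_square algebra_simps golden_sq)

lemma gap_golden: "gap * golden\<^sup>2 = 1"
  by (simp add: gap_def power2_eq_square algebra_simps golden_sq golden_sq')

lemma sinh_poly_golden: "sinh_poly (Suc k) golden = (golden ^ (k + 2) - sinh_poly k golden * (2 * real k + 2)) / (2 * real k + 3)"
proof -
  have "golden\<^sup>2 - 1 = golden" by (simp add: power2_eq_square golden_sq)
  then show ?thesis by (simp add: sinh_poly.simps(2) algebra_simps)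
qed

lemma encl_sinh: "encl_list (tl (isinh igolden (imul igolden igolden) ic1 0 n)) (\<lambda>k. sinh_poly (Suc k) golden)"
proof -
  have "encl_list (isinh igolden (imul igolden igolden) ic1 (int 0) n) (\<lambda>i. sinh_poly (0 + i) golden)"
  proof (rule encl_isinh[OF encl_golden sinh_poly_golden])
    fix k
    \<comment> \<open>Nonnegativity of the next integral is what makes the clipped subtraction in
      the recursion exact.\<close>
    have "0 < 2 * real k + 3" by simp
    then have "0 \<le> golden ^ (k + 2) - sinh_poly k golden * (2 * real k + 2)"
      using sinh_poly_nonneg[of golden k] golden_pos unfolding sinh_poly_golden zero_le_divide_iff by linarith
    then show "sinh_poly k golden * (2 * real k + 2) \<le> golden ^ (k + 2)" by simp
  next
    show "encl (imul igolden igolden) (golden ^ (0 + 2))"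
      using encl_mul[OF encl_golden encl_golden] by (simp add: power2_eq_square)
    show "encl ic1 (sinh_poly 0 golden)" using encl_ic1 by simp
  qed
  from encl_list_tl[OF this] show ?thesis by simp
qed

lemma encl_rising: "encl_list (irising ione 0 n) (rising (5 / 2))"
proof -
  have "rising (5 / 2) (Suc k) = rising (5 / 2) k * (5 + 2 * real k) / (2 * real k + 2)" for k
    unfolding rising_Suc by (simp add: field_simps)
  then have "encl_list (irising ione (int 0) n) (\<lambda>i. rising (5 / 2) (0 + i))"
    by (rule encl_irising) (use encl_one in \<open>simp add: rising_def\<close>)
  then show ?thesis by simp
qed

definition "depth = gap - \<tau>\<^sup>2"

context
  fixes k2 t :: ival
  assumes kappa: "\<kappa>\<^sup>2 \<le> 1 / 2" and k2: "encl k2 (\<kappa>\<^sup>2)" and valid: "itau_valid k2 t"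
begin

interpretation R: radial gap \<tau>
  by (rule radial_gap[OF kappa])

lemma depth_pos: "0 < depth" "0 < gap"
  using tau_sq_less[OF kappa] golden_pos by (auto simp: depth_def gap_def)

lemma encl_itausq: "encl (itausq k2) (\<tau>\<^sup>2)"
proof -
  have "0 < fst (iadd igolden k2)"
    using k2 encl_igolden_pos by (simp add: encl_def iadd_def)
  then show ?thesis
    unfolding itausq_def c_sq by (rule encl_div[OF k2 encl_add[OF encl_golden k2]])
qed

lemma encl_tau: "encl t \<tau>"
  using encl_sqrt[OF encl_itausq, of "fst t" "snd t"] c_pos valid unfolding itau_valid_def by simp

lemma encl_depth: "encl (ix0 k2) depth"
  unfolding ix0_def depth_def
  using encl_sub[OF encl_igap encl_itausq] tau_sq_less[OF kappa] by (simp add: gap_def)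

lemma tau_golden_less: "\<tau> * golden < 1"
proof -
  have "(\<tau> * golden)\<^sup>2 < gap * golden\<^sup>2"
    using tau_sq_less[OF kappa] golden_pos by (simp add: power_mult_distrib)
  then show ?thesis unfolding gap_golden using power2_less_imp_less[of "\<tau> * golden" 1] by simp
qed

lemma encl_artanh_tau: "encl (iartanh m t) (artanh \<tau>)"
  using valid unfolding itau_valid_def by (intro encl_artanh encl_tau tau_less_1) auto

lemma encl_artanh_tau_golden: "encl (iartanh m (imul t igolden)) (artanh (\<tau> * golden))"
  using valid unfolding itau_valid_def by (intro encl_artanh encl_mul encl_tau encl_golden tau_golden_less) auto

text \<open>
  Without the factor \<open>depth ^ j\<close> the integrals grow geometrically and the two recursions below
  would lose the precision of the fixed-point arithmetic.
\<close>

definition "log_moment j = radial_J gap \<tau> 0 j * depth ^ j"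
definition "radial_moment k = radial_J gap \<tau> 1 k * depth ^ k"

text \<open>The square root of \<open>gap\<close> is golden - 1, whose inverse is golden.\<close>

lemma log_moment_1: "log_moment 1 = artanh (\<tau> * golden) * golden * depth"
proof -
  have "1 / (golden - 1) = golden" using golden_minus_1 golden_pos by (simp add: field_simps)
  then have "artanh (\<tau> / (golden - 1)) / (golden - 1) = artanh (\<tau> * golden) * golden"
    by (metis divide_inverse inverse_eq_divide)
  then show ?thesis
    using R.radial_J_0_1[of "golden - 1"] golden_pos gap_eq by (simp add: log_moment_def)
qed

lemma log_moment_Suc:
  assumes "1 \<le> j"
  shows "log_moment (Suc j) = (\<tau> + log_moment j * (2 * real j - 1)) * (depth / gap) / (2 * real j)"
proof -
  obtain i where j: "j = Suc i" using assms by (cases j) auto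
  have e: "2 * real j * gap * radial_J gap \<tau> 0 (Suc j) = \<tau> / depth ^ j + (2 * real j - 1) * radial_J gap \<tau> 0 j"
    unfolding j depth_def by (rule R.radial_J_reduction)
  have "R * (d * D) = (T + r * D * m) * (d / G) / n"
    if "n * G * R = T / D + m * r" "0 < D" "0 < n" "0 < G" for R d D T r m G n :: real
  proof -
    have "n * G * R * D = T + m * r * D" unfolding that(1) using that(2) by (simp add: distrib_right)
    then have "T + r * D * m = n * G * R * D" by (simp add: ac_simps)
    then show ?thesis using that(2-4) by simp
  qed
  from this[OF e] show ?thesis
    unfolding log_moment_def power_Suc using depth_pos assms by simp
qed

lemma radial_moment_nonneg: "0 \<le> radial_moment k"
  unfolding radial_moment_def using depth_pos R.radial_J_nonneg by simp

lemma radial_moment_Suc: "radial_moment (Suc k) = (log_moment (Suc k) - depth * radial_moment k) * golden"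
proof -
  have "(golden - 1) * radial_J gap \<tau> 1 (Suc k) = radial_J gap \<tau> 0 (Suc k) - radial_J gap \<tau> 1 k"
    using R.radial_J_step[of k] by (simp add: gap_def)
  then have "((golden - 1) * golden) * radial_J gap \<tau> 1 (Suc k) = (radial_J gap \<tau> 0 (Suc k) - radial_J gap \<tau> 1 k) * golden"
    by (simp only: ac_simps)
  then have "radial_J gap \<tau> 1 (Suc k) = (radial_J gap \<tau> 0 (Suc k) - radial_J gap \<tau> 1 k) * golden"
    unfolding golden_minus_1 by simp
  then show ?thesis
    unfolding radial_moment_def log_moment_def by (simp only: power_Suc) (simp add: right_diff_distrib left_diff_distrib ac_simps)
qed

lemma radial_moment_le: "depth * radial_moment k \<le> log_moment (Suc k)"
  using radial_moment_nonneg[of "Suc k"] golden_pos unfolding radial_moment_Suc zero_le_mult_iff by simp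

lemma encl_radial_moment: "encl_list (iJ k2 t m n) (\<lambda>k. radial_moment (k + 2))"
proof -
  have 1: "encl_list (ilog_rec (idiv (ix0 k2) igap) t (imul (imul (iartanh m (imul t igolden)) igolden) (ix0 k2)) (int 1) n) (\<lambda>i. log_moment (1 + i))"
  proof (rule encl_ilog_rec[OF _ encl_tau log_moment_Suc])
    show "encl (idiv (ix0 k2) igap) (depth / gap)"
      using encl_div[OF encl_depth encl_igap encl_igolden_pos(2)] by (simp add: gap_def)
    show "encl (imul (imul (iartanh m (imul t igolden)) igolden) (ix0 k2)) (log_moment 1)"
      unfolding log_moment_1 by (intro encl_mul encl_artanh_tau_golden encl_golden encl_depth)
  qed auto
  have "encl_list (istep_rec (ix0 k2) igolden (iartanh m t)
     (ilog_rec (idiv (ix0 k2) igap) t (imul (imul (iartanh m (imul t igolden)) igolden) (ix0 k2)) 1 n)) (\<lambda>i. radial_moment (0 + i))"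
  proof (rule encl_istep_rec[where h = radial_moment and f = log_moment, OF encl_depth encl_golden radial_moment_Suc radial_moment_le])
    show "encl (iartanh m t) (radial_moment 0)"
      using encl_artanh_tau by (simp add: radial_moment_def R.radial_J_1_0)
  qed (use 1 in \<open>simp add: One_nat_def\<close>)
  from encl_list_tl[OF encl_list_tl[OF this]] show ?thesis unfolding iJ_def by (simp add: numeral_2_eq_2)
qed

lemma encl_ratio: "encl (iratio k2) ((golden - 1) / depth)"
  unfolding iratio_def using valid unfolding itau_valid_def by (intro encl_div encl_ic1 encl_depth) auto

lemma orthoscheme_term_eq:
  "orthoscheme_term k = (K0 * ((golden - 1) / depth * ((golden - 1) / depth)) / of_int 4)
     * (1 * ((2 - golden) / (2 + golden) * ((golden - 1) / depth)) ^ k / (of_int 3 + 2 * real k) * inner_sum (7 - 4 * golden) (2 - golden) k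
        * radial_moment (k + 2) * (of_int 1 + real k))"
proof -
  let ?u = "(golden - 1) / depth" and ?g = "(2 - golden) / (2 + golden)" and ?I = "inner_sum (7 - 4 * golden) (2 - golden) k"
  let ?R = "radial_J gap \<tau> 1 (k + 2)"
  have "c1 ^ (2 * k + 4) = (c1\<^sup>2) ^ (k + 2)" by (simp add: power_add power_mult flip: power_mult)
  also have "\<dots> = (?u * depth) ^ (k + 2)" using depth_pos by (simp add: c_sq)
  also have "\<dots> = ?u ^ k * (?u * ?u) * depth ^ (k + 2)" by (simp only: power_mult_distrib power_add power2_eq_square) (simp only: ac_simps)
  finally have c: "c1 ^ (2 * k + 4) = ?u ^ k * (?u * ?u) * depth ^ (k + 2)" .
  have w: "(real k + 1) * (real k + 2) / 2 * (K0 * (1 * G / D * I)) * (U * V * E / real (2 * k + 4)) * R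
      = (K0 * V / of_int 4) * (1 * (G * U) / D * I * (R * E) * (of_int 1 + real k))" for G D I U V E R :: real
  proof -
    have r: "real (2 * k + 4) = 2 * (real k + 2)" by simp
    have "(real k + 1) * y / 2 * (K0 * (1 * G / D * I)) * (U * V * E / (2 * y)) * R
      = (K0 * V / of_int 4) * (1 * (G * U) / D * I * (R * E) * (of_int 1 + real k))" if "y \<noteq> 0" for y
      using that by simp
    from this[of "real k + 2"] show ?thesis unfolding r by simp
  qed
  show ?thesis
    unfolding orthoscheme_term_def[OF kappa] rising_3 moment_eq c w radial_moment_def power_mult_distrib ..
qed

text \<open>\<open>r\<close> is the expansion ratio in percent and \<open>c\<close> an integer bound
  for (1 - r/100)^(-3); in this form the hypotheses are integer inequalities that can be
  evaluated.\<close>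

lemma encl_orthoscheme:
  assumes r: "r < 100" "10349 * sc \<le> r * 1000 * fst (ix0 k2)" "100 ^ 3 \<le> c * (100 - r) ^ 3"
  shows "encl (iorthoscheme k2 t m c n) (hvol (orthoscheme b))"
proof -
  define Kc where "Kc = K0 * ((golden - 1) / depth * ((golden - 1) / depth)) / of_int 4"
  define f where "f k = 1 * ((2 - golden) / (2 + golden) * ((golden - 1) / depth)) ^ k / (of_int 3 + 2 * real k)
    * inner_sum (7 - 4 * golden) (2 - golden) k * radial_moment (k + 2) * (of_int 1 + real k)" for k
  have Kc: "0 < Kc" using K0_pos depth_pos golden_pos by (simp add: Kc_def)
  have t: "orthoscheme_term k = Kc * f k" for k
    unfolding orthoscheme_term_eq Kc_def f_def ..
  let ?r = "real_of_int r / 100"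
  have r1: "?r < 1" using r(1) by simp
  have "real_of_int r * 1000 * of_int (fst (ix0 k2)) \<le> real_of_int r * 1000 * (of_int sc * depth)"
  proof (rule mult_left_mono)
    show "real_of_int (fst (ix0 k2)) \<le> of_int sc * depth" using encl_depth by (simp add: encl_def)
    have "0 < r * 1000 * fst (ix0 k2)" using r(2) sc_pos by linarith
    then have "0 \<le> r" using valid by (auto simp: itau_valid_def zero_less_mult_iff)
    then show "0 \<le> real_of_int r * 1000" by simp
  qed
  moreover have "real_of_int (10349 * sc) \<le> of_int (r * 1000 * fst (ix0 k2))" using r(2) by (simp only: of_int_le_iff)
  ultimately have "of_int sc * 10349 \<le> of_int sc * (real_of_int r * 1000 * depth)" by (simp add: ac_simps)
  then have "10349 \<le> real_of_int r * 1000 * depth" using sc_pos by simp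
  then have r2: "10349 / 100000 \<le> ?r * (gap - \<tau>\<^sup>2)" unfolding depth_def by simp
  have C: "(1 - ?r) powr (- 3) \<le> of_int c"
  proof -
    have "real_of_int (100 ^ 3) \<le> of_int (c * (100 - r) ^ 3)" using r(3) by (simp only: of_int_le_iff)
    then have "100 ^ 3 \<le> of_int c * (100 * (1 - ?r)) ^ 3" by (simp add: right_diff_distrib)
    then have "1 \<le> of_int c * (1 - ?r) ^ 3" unfolding power_mult_distrib by simp
    moreover have "(1 - ?r) powr (- 3) = 1 / (1 - ?r) ^ 3"
      using r1 powr_realpow[of "1 - ?r" 3] by (simp add: powr_minus inverse_eq_divide)
    ultimately show ?thesis using r1 by (simp add: divide_le_eq)
  qed
  note B = hvol_orthoscheme_bounds[OF kappa r1 r2, of n, unfolded t, folded sum_distrib_left]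
  have W: "encl_list (iweigh 1 (imap2 (imap2 (idivs 3 (ipows (imul ig2 (iratio k2)) ione (Suc n))) (iinner ig4 igap (Suc n))) (iJ k2 t m (n + 2)))) f"
    unfolding f_def[abs_def]
    by (intro encl_iweigh encl_imap2 encl_idivs encl_ipows encl_mul encl_ig2 encl_ratio encl_one encl_iinner encl_ig4 encl_igap encl_radial_moment) auto
  have "encl (itail c n (iweigh 1 (imap2 (imap2 (idivs 3 (ipows (imul ig2 (iratio k2)) ione (Suc n))) (iinner ig4 igap (Suc n))) (iJ k2 t m (n + 2)))))
      (hvol (orthoscheme b) / Kc)"
  proof (rule encl_itail[OF W])
    show "(\<Sum>i<n. f i) \<le> hvol (orthoscheme b) / Kc" using B(1) Kc by (simp add: le_divide_eq mult.commute)
    have "hvol (orthoscheme b) \<le> Kc * ((\<Sum>i<n. f i) + (1 - ?r) powr (- 3) * f n)"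
      using B(2) by (simp only: distrib_left ac_simps)
    then show "hvol (orthoscheme b) / Kc \<le> (\<Sum>i<n. f i) + (1 - ?r) powr (- 3) * f n"
      using Kc by (simp add: divide_le_eq mult.commute)
  qed (use C in \<open>auto simp: length_iweigh length_imap2 length_idivs length_ipows length_iinner iJ_def length_istep_rec length_ilog_rec\<close>)
  then have "encl (iorthoscheme k2 t m c n) (Kc * (hvol (orthoscheme b) / Kc))"
    unfolding iorthoscheme_def Kc_def K0_def by (intro encl_mul encl_divn encl_iK encl_ratio) auto
  then show ?thesis using Kc by simp
qed

lemma encl_profile: "encl (iprofile k2 t m) (hyper_ball_profile \<tau>)"
proof -
  have t1: "\<tau>\<^sup>2 \<le> 1" using tau_less_1 c_pos by (simp add: power_le_one)
  have "encl (iprofile k2 t m) (\<tau> / ((1 - \<tau>\<^sup>2) * (1 - \<tau>\<^sup>2) * of_int 4) + \<tau> * of_int 3 / ((1 - \<tau>\<^sup>2) * of_int 8) + artanh \<tau> * of_int 3 / of_int 8)"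
    unfolding iprofile_def using valid t1 unfolding itau_valid_def
    by (intro encl_add encl_div encl_divn encl_muln encl_mul encl_sub encl_one encl_tau encl_itausq encl_artanh_tau) (auto simp: imuln_def)
  then show ?thesis by (simp add: hyper_ball_profile_def power2_eq_square ac_simps)
qed

lemma encl_hyperball:
  obtains v where "hvol (opt_hyperball b \<inter> orthoscheme b) = hyper_ball_profile \<tau> * v" "encl (iball_volume4 n) v"
proof -
  \<comment> \<open>The ratio 0.10349 / \<open>gap\<close> is about 0.271, and 0.72^(-5/2) is about
    2.3, which explains the constant 3 in \<open>iball_volume4\<close>.\<close>
  have g: "10349 / 100000 \<le> (28 / 100) * gap" using golden_bounds by (simp add: gap_def)
  obtain v where v: "hvol (opt_hyperball b \<inter> orthoscheme b) = hyper_ball_profile \<tau> * v"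
    "(\<Sum>k<n. hyperball_term k) \<le> v" "v \<le> (\<Sum>k<n. hyperball_term k) + (1 - 28 / 100) powr (- (5 / 2)) * hyperball_term n"
    by (rule hvol_opt_hyperball_bounds[OF kappa _ g, of n]) auto
  define f where "f k = rising (5 / 2) k * (1 * ((2 - golden) / (2 + golden)) ^ k / (of_int 3 + 2 * real k) * inner_sum (7 - 4 * golden) (2 - golden) k)
    * sinh_poly (Suc k) golden" for k
  have t: "hyperball_term k = K0 * f k" for k
    unfolding hyperball_term_def[OF kappa] moment_eq f_def by (simp only: ac_simps)
  note B = v(2,3)[unfolded t, folded sum_distrib_left]
  have C: "(1 - 28 / 100) powr (- (5 / 2)) \<le> real_of_int 3"
  proof -
    have s: "4 / 5 \<le> sqrt (18 / 25)" by (rule real_le_rsqrt) (simp add: power2_eq_square)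
    have "(18 / 25 :: real) powr (- (5 / 2)) = 1 / ((18 / 25)\<^sup>2 * sqrt (18 / 25))"
      using powr_minus_half_odd[of "18 / 25" 0] by (simp only: of_nat_0 diff_zero add_0)
    also have "\<dots> \<le> 1 / ((18 / 25)\<^sup>2 * (4 / 5))"
      using s by (intro divide_left_mono mult_left_mono) (auto intro!: mult_pos_pos)
    also have "\<dots> \<le> 3" by (simp add: power2_eq_square)
    finally show ?thesis by simp
  qed
  have W: "encl_list (imap2 (imap2 (irising ione 0 (Suc n)) (imap2 (idivs 3 (ipows ig2 ione (Suc n))) (iinner ig4 igap (Suc n))))
      (tl (isinh igolden (imul igolden igolden) ic1 0 (n + 2)))) f"
    unfolding f_def[abs_def] by (intro encl_imap2[of _ "\<lambda>k. rising (5 / 2) k * _ k"] encl_imap2[OF encl_rising] encl_moment encl_sinh)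
  have "encl (itail 3 n (imap2 (imap2 (irising ione 0 (Suc n)) (imap2 (idivs 3 (ipows ig2 ione (Suc n))) (iinner ig4 igap (Suc n))))
      (tl (isinh igolden (imul igolden igolden) ic1 0 (n + 2))))) (v / K0)"
  proof (rule encl_itail[OF W])
    show "(\<Sum>i<n. f i) \<le> v / K0" using B(1) K0_pos by (simp add: le_divide_eq mult.commute)
    have "v \<le> K0 * ((\<Sum>i<n. f i) + (1 - 28 / 100) powr (- (5 / 2)) * f n)"
      using B(2) by (simp only: distrib_left ac_simps)
    then show "v / K0 \<le> (\<Sum>i<n. f i) + (1 - 28 / 100) powr (- (5 / 2)) * f n"
      using K0_pos by (simp add: divide_le_eq mult.commute)
  qed (use C in \<open>auto simp: length_imap2 length_idivs length_ipows length_iinner length_irising length_isinh\<close>)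
  then have "encl (iball_volume4 n) (K0 * (v / K0))"
    unfolding iball_volume4_def K0_def by (intro encl_mul encl_iK)
  then show thesis using v(1) K0_pos by (intro that[of v]) auto
qed

end

end

section \<open>From enclosures to eight decimals\<close>

definition bounded_by :: "ival \<Rightarrow> int \<Rightarrow> int \<Rightarrow> bool" where
  "bounded_by a p q \<longleftrightarrow> 0 \<le> p \<and> p \<le> fst a \<and> snd a \<le> q"

lemma encl_bounded_by: "encl a x \<Longrightarrow> bounded_by a p q \<Longrightarrow> encl (p, q) x"
  unfolding encl_def bounded_by_def by auto

definition within_units :: "nat \<Rightarrow> ival \<Rightarrow> int \<Rightarrow> bool" where
  "within_units k a N \<longleftrightarrow> (N - int k) * sc \<le> 10 ^ 8 * fst a \<and> 10 ^ 8 * snd a \<le> (N + int k) * sc"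

lemma approx8_encl:
  assumes "encl a x" "within_units k a N"
  shows "approx8 k x (of_int N / 10 ^ 8)"
proof -
  let ?s = "real_of_int sc"
  have "real_of_int ((N - int k) * sc) \<le> of_int (10 ^ 8 * fst a)" "real_of_int (10 ^ 8 * snd a) \<le> of_int ((N + int k) * sc)"
    using assms(2) unfolding within_units_def by (simp_all only: of_int_le_iff)
  moreover have "of_int (fst a) \<le> ?s * x" "?s * x \<le> of_int (snd a)"
    using assms(1) by (auto simp: encl_def)
  ultimately have "?s * (of_int N - real k) \<le> ?s * (10 ^ 8 * x)" "?s * (10 ^ 8 * x) \<le> ?s * (of_int N + real k)"
    by (simp_all add: algebra_simps)
  then have "of_int N - real k \<le> 10 ^ 8 * x" "10 ^ 8 * x \<le> of_int N + real k"
    using sc_pos by simp_all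
  then show ?thesis unfolding approx8_def by (simp add: abs_le_iff field_simps)
qed

text \<open>The literal intervals \<open>V\<close>, \<open>P\<close>, \<open>w\<close> stand in for
  the long evaluations: the later checks work on numerals only, and \<open>w\<close>, which belongs
  to the base simplex, serves both tilings.\<close>

lemma (in coxeter_frame) encl_packing:
  assumes "\<kappa>\<^sup>2 \<le> 1 / 2" "encl k2 (\<kappa>\<^sup>2)" "itau_valid k2 t"
    and r: "r < 100" "10349 * sc \<le> r * 1000 * fst (ix0 k2)" "100 ^ 3 \<le> c * (100 - r) ^ 3"
    and V: "bounded_by (iorthoscheme k2 t m c n) (fst V) (snd V)" and P: "bounded_by (iprofile k2 t m) (fst P) (snd P)"
    and w: "bounded_by (iball_volume4 l) (fst w) (snd w)" and pos: "0 < fst V"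
  shows "encl V (hvol (orthoscheme b))" "encl (iartanh m t) (opt_height b)" "encl (imul P w) (opt_hyperball_vol b)"
    "encl (idiv (imul P w) V) (opt_density b)"
proof -
  note k = assms(1-3)
  show 1: "encl V (hvol (orthoscheme b))"
    using encl_bounded_by[OF encl_orthoscheme[OF k r] V] by simp
  show "encl (iartanh m t) (opt_height b)"
    unfolding opt_height_eq by (rule encl_artanh_tau[OF k])
  obtain v where v: "hvol (opt_hyperball b \<inter> orthoscheme b) = hyper_ball_profile \<tau> * v" "encl (iball_volume4 l) v"
    by (rule encl_hyperball[OF k])
  have "encl P (hyper_ball_profile \<tau>)" "encl w v"
    using encl_bounded_by[OF encl_profile[OF k] P] encl_bounded_by[OF v(2) w] by simp_all
  then show 2: "encl (imul P w) (opt_hyperball_vol b)"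
    unfolding opt_hyperball_vol_def v(1) by (rule encl_mul)
  show "encl (idiv (imul P w) V) (opt_density b)"
    unfolding opt_density_def by (rule encl_div[OF 2 1 pos])
qed

lemma coxeter_frameI:
  assumes "coxeter_normals [5,3,3,3,t] b" "0 < cos (pi / real t)"
  shows "coxeter_frame b (cos (pi / real t))"
proof -
  have "mink (b j) (b k) = coxeter_matrix [5,3,3,3,t] j k" if "j \<le> 5" "k \<le> 5" for j k
    using assms(1) that unfolding coxeter_normals_def by blast
  then show ?thesis
    using assms(2) cos_pi_div_5 cos_60
    by unfold_locales (simp_all add: coxeter_matrix_def)
qed

text \<open>
  \<open>V\<close> encloses the volume of the orthoscheme, \<open>P\<close> the factor of the hyperball volume that depends on the
  height, and \<open>w\<close> its other factor, the volume of the base simplex.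
\<close>

definition V_0 :: ival where "V_0 = (884632266336646, 884632266747341)"
definition P_0 :: ival where "P_0 = (488993034305537264, 488993034305537288)"
definition V_2 :: ival where "V_2 = (2288199193292677, 2288199212428617)"
definition P_2 :: ival where "P_2 = (744360337115552616, 744360337115552654)"
definition w_4 :: ival where "w_4 = (1053599921841359, 1053599921887316)"

lemma ball_volume4_bounds: "bounded_by (iball_volume4 18) (fst w_4) (snd w_4)"
  by code_simp

text \<open>The numerals are the number of artanh terms, the remainder constant and the number of
  series terms. The second orthoscheme needs more terms because its tau * golden and its expansion
  ratio are closer to 1.\<close>

lemma orthoscheme_bounds_0: "bounded_by (iorthoscheme k2_0 t_0 40 6 20) (fst V_0) (snd V_0)"
  by code_simp

lemma orthoscheme_bounds_2: "bounded_by (iorthoscheme k2_2 t_2 70 42 40) (fst V_2) (snd V_2)"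
  by code_simp

lemma profile_bounds:
  "bounded_by (iprofile k2_0 t_0 40) (fst P_0) (snd P_0)" "bounded_by (iprofile k2_2 t_2 70) (fst P_2) (snd P_2)"
  by code_simp+

lemma tau_valid: "itau_valid k2_0 t_0" "itau_valid k2_2 t_2"
  by code_simp+

text \<open>The quotients of 0.10349 by \<open>gap\<close> minus tau^2 are about 0.417 and 0.709,
  rounded up to 42 and 71 percent; 0.58^(-3) is about 5.1 and 0.29^(-3) about 41.\<close>

lemma ratio_bounds:
  "10349 * sc \<le> 42 * 1000 * fst (ix0 k2_0)" "100 ^ 3 \<le> (6 :: int) * (100 - 42) ^ 3" "0 < fst V_0"
  "10349 * sc \<le> 71 * 1000 * fst (ix0 k2_2)" "100 ^ 3 \<le> (42 :: int) * (100 - 71) ^ 3" "0 < fst V_2"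
  by code_simp+

lemma units_0:
  "within_units 1 V_0 76730" "within_units 1 (iartanh 40 t_0) 38359861" "within_units 1 (imul P_0 w_4) 38760"
  "within_units 2 (idiv (imul P_0 w_4) V_0) 50514481"
  by code_simp+

lemma units_2:
  "within_units 1 V_2 198469" "within_units 1 (iartanh 70 t_2) 53063753" "within_units 1 (imul P_2 w_4) 59001"
  "within_units 1 (idiv (imul P_2 w_4) V_2) 29727979"
  by code_simp+

(* The first density is 0.505144799893..., i.e. 1.01 units in the last place away from the
   published 0.50514481; hence the tolerance of two units there. *)
theorem mainTheorem1:
  fixes b0 b2 :: "nat \<Rightarrow> real \<times> (real^5)"
  assumes "coxeter_normals [5,3,3,3,3] b0"
    and "coxeter_normals [5,3,3,3,4] b2"
  shows "(approx8 1 (hvol (orthoscheme b0)) 0.00076730 \<and>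
          approx8 1 (opt_height b0) 0.38359861 \<and>
          approx8 1 (opt_hyperball_vol b0) 0.00038760 \<and>
          approx8 2 (opt_density b0) 0.50514481) \<and>
         (approx8 1 (hvol (orthoscheme b2)) 0.00198469 \<and>
          approx8 1 (opt_height b2) 0.53063753 \<and>
          approx8 1 (opt_hyperball_vol b2) 0.00059001 \<and>
          approx8 1 (opt_density b2) 0.29727979)"
proof -
  interpret F0: coxeter_frame b0 "cos (pi / real 3)"
    using coxeter_frameI[of 3 b0] assms(1) by (simp add: cos_60)
  interpret F2: coxeter_frame b2 "cos (pi / real 4)"
    using coxeter_frameI[of 4 b2] assms(2) by (simp add: cos_45)
  have sq: "(cos (pi / real 3))\<^sup>2 = 1 / 4" "(cos (pi / real 4))\<^sup>2 = 1 / 2"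
    by (simp_all add: cos_60 cos_45 power_divide)
  have k: "encl k2_0 ((cos (pi / real 3))\<^sup>2)" "encl k2_2 ((cos (pi / real 4))\<^sup>2)"
    unfolding sq k2_0_def k2_2_def using encl_divn[OF encl_one, of 4] encl_divn[OF encl_one, of 2] by simp_all
  have le: "(cos (pi / real 3))\<^sup>2 \<le> 1 / 2" "(cos (pi / real 4))\<^sup>2 \<le> 1 / 2"
    unfolding sq by simp_all
  note E0 = F0.encl_packing[OF le(1) k(1) tau_valid(1) _ ratio_bounds(1,2) orthoscheme_bounds_0 profile_bounds(1) ball_volume4_bounds ratio_bounds(3)]
  note E2 = F2.encl_packing[OF le(2) k(2) tau_valid(2) _ ratio_bounds(4,5) orthoscheme_bounds_2 profile_bounds(2) ball_volume4_bounds ratio_bounds(6)]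
  show ?thesis
    using approx8_encl[OF E0(1) units_0(1)] approx8_encl[OF E0(2) units_0(2)] approx8_encl[OF E0(3) units_0(3)] approx8_encl[OF E0(4) units_0(4)]
      approx8_encl[OF E2(1) units_2(1)] approx8_encl[OF E2(2) units_2(2)] approx8_encl[OF E2(3) units_2(3)] approx8_encl[OF E2(4) units_2(4)]
    by simp
qed

end
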